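(* Let $G_I$ and $G_c$ ($c\in\mathbb R$) be the simply connected $3$-dimensional Lie groups, with the left invariant metrics $g_\nu$, $g_{\mu,\nu}$, $g'_{\lambda,\nu}$, described in the context. The index of symmetry $i_{\mathfrak s}(G,g)$ and the distribution of symmetry $\mathfrak s_g$ (spanned by the indicated left invariant fields) are as follows. (1) $G=G_I$, $g=g_\nu$: $i_{\mathfrak s}=3$ and $\mathfrak s_g=TG_I$. (2) $G=G_c$ with $c<0$, $g=g_{\mu,\nu}$: if $\mu<|c|$, then $i_{\mathfrak s}=0$; if $\mu=|c|$, then $i_{\mathfrak s}=1$ and $\mathfrak s_g=\mathbb R e_2$. (3) $G=G_0$: for $g=g_{\mu,\nu}$, $i_{\mathfrak s}=1$ and $\mathfrak s_g=\mathbb R(e_0-\tfrac12e_1)$; for $g=g_\nu$, $i_{\mathfrak s}=3$ and $\mathfrak s_g=TG_0$. (4) $G=G_c$ with $0<c<1$, $g=g_{\mu,\nu}$: if $\mu=0$, then $i_{\mathfrak s}=1$ and $\mathfrak s_g=\mathbb R e_2$; if $0<\mu\ne\sqrt c$, then $i_{\mathfrak s}=0$; if $\mu=\sqrt c$, then $i_{\mathfrak s}=1$ and $\mathfrak s_g=\mathbb R\bigl(e_0+\tfrac1{\sqrt c}e_1\bigr)$. (5) $G=G_1$: for $g=g_{\mu,\nu}$ with $\mu<1$, $i_{\mathfrak s}=0$; for $g=g_{1,\nu}$ (that is, $\mu=1$), $i_{\mathfrak s}=1$ and $\mathfrak s_g=\mathbb R e_0$; for $g=g'_{\lambda,\nu}$,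 $i_{\mathfrak s}=0$. (6) $G=G_c$ with $c>1$, $g=g_{\mu,\nu}$: if $\mu<c$ and $\mu\ne(\sqrt c-1)^2+1$, then $i_{\mathfrak s}=0$; if $\mu<c$ and $\mu=(\sqrt c-1)^2+1$, then $i_{\mathfrak s}=1$ and $\mathfrak s_g=\mathbb R\Bigl(\tfrac{c-3\sqrt c+2}{\sqrt c-1}e_0+e_1\Bigr)$; if $\mu=c$, then $i_{\mathfrak s}=3$ and $\mathfrak s_g=TG_c$.
   Context: Lie groups. $G_I$ is the simply connected Lie group whose Lie algebra has a basis $e_0,e_1,e_2$ with $[e_0,e_1]=0$, $[e_2,e_0]=e_0$, $[e_2,e_1]=e_1$. For $c\in\mathbb R$, $G_c$ is the simply connected Lie group whose Lie algebra has a basis $e_0,e_1,e_2$ with $[e_0,e_1]=0$, $[e_2,e_0]=e_1$, $[e_2,e_1]=-c\,e_0+2e_1$. The $e_i$ are regarded as left invariant vector fields. Metrics. Left invariant metrics are given by their Gram matrices in the basis $e_0,e_1,e_2$, with $\nu>0$ always: - $G_I$: $g_\nu=\operatorname{diag}(1,1,\nu)$. - $G_c$, $c<0$: $g_{\mu,\nu}=\operatorname{diag}(1,\mu,\nu)$, $0<\mu\le|c|$. - $G_0$: $g_{\mu,\nu}=\operatorname{diag}(1,\mu,\nu)$, $\mu>0$; and $g_\nu=\begin{pmatrix}1&\frac12&0\\\frac12&1&0\\0&0&\nu\end{pmatrix}$. - $G_c$, $0<c<1$: $g_{\mu,\nu}=P^T\begin{pmatrix}1&\mu&0\\\mu&1&0\\0&0&\nu\end{pmatrix}P$,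 $0\le\mu<1$, where $P=\begin{pmatrix}-\frac{1+\sqrt{1-c}}{2c\sqrt{1-c}}&-\frac1{2\sqrt{1-c}}&0\\ \frac{1-\sqrt{1-c}}{2c\sqrt{1-c}}&\frac1{2\sqrt{1-c}}&0\\0&0&1\end{pmatrix}$. - $G_1$: $g_{\mu,\nu}=\operatorname{diag}(1,\mu,\nu)$, $0<\mu\le1$; and $g'_{\lambda,\nu}=\begin{pmatrix}1&\lambda&0\\\lambda&1&0\\0&0&\nu\end{pmatrix}$, $0<\lambda<1$. - $G_c$, $c>1$: $g_{\mu,\nu}=\begin{pmatrix}1&1&0\\1&\mu&0\\0&0&\nu\end{pmatrix}$, $1<\mu\le c$. Index of symmetry. For a homogeneous Riemannian manifold $(M,g)$ with Levi-Civita connection $\nabla$ and Lie algebra of Killing fields $\mathcal K(M,g)$, the distribution of symmetry $\mathfrak s_g$ is defined at $p\in M$ by $\{v\in T_pM: v=X_p\text{ for some }X\in\mathcal K(M,g)\text{ with }(\nabla X)_p=0\}$. The index of symmetry $i_{\mathfrak s}(M,g)$ is the rank of $\mathfrak s_g$. *)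

theory Defs
  imports "HOL-Analysis.Analysis"
begin

section \<open>Smooth maps\<close>

primrec times_cont_diff ::
    "nat \<Rightarrow> ('a::real_normed_vector \<Rightarrow> 'b::real_normed_vector) \<Rightarrow> bool" where
  "times_cont_diff 0 = (\<lambda>f. continuous_on UNIV f)"
| "times_cont_diff (Suc k) = (\<lambda>f. (\<forall>x. f differentiable (at x)) \<and>
      (\<forall>v. times_cont_diff k (\<lambda>x. frechet_derivative f (at x) v)))"

definition smooth :: "('a::real_normed_vector \<Rightarrow> 'b::real_normed_vector) \<Rightarrow> bool" where
  "smooth f \<longleftrightarrow> (\<forall>k. times_cont_diff k f)"

lemma times_cont_diff_SucI:
  assumes "\<And>x. (f has_derivative f' x) (at x)"
    and "\<And>v. times_cont_diff k (\<lambda>x. f' x v)"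
  shows "times_cont_diff (Suc k) f"
proof -
  have "frechet_derivative f (at x) = f' x" for x
    using frechet_derivative_at[OF assms(1)] by simp
  then show ?thesis using assms by (auto simp: differentiable_def)
qed

lemma times_cont_diff_SucE:
  assumes "times_cont_diff (Suc k) f"
  obtains f' where "\<And>x. (f has_derivative f' x) (at x)"
    and "\<And>v. times_cont_diff k (\<lambda>x. f' x v)"
proof (rule that[of "\<lambda>x. frechet_derivative f (at x)"])
  show "(f has_derivative frechet_derivative f (at x)) (at x)" for x
    using assms by (simp add: frechet_derivative_works[symmetric])
  show "times_cont_diff k (\<lambda>x. frechet_derivative f (at x) v)" for v
    using assms by simp
qed

lemma times_cont_diff_Suc_imp:
  "times_cont_diff (Suc k) f \<Longrightarrow> times_cont_diff k f"
proof (induction k arbitrary: f)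
  case 0
  then show ?case
    by (auto simp: continuous_on_eq_continuous_within intro: differentiable_imp_continuous_within)
next
  case (Suc k)
  have "f differentiable (at x)" for x using Suc.prems by simp
  moreover have "times_cont_diff k (\<lambda>x. frechet_derivative f (at x) v)" for v
    by (rule Suc.IH) (use Suc.prems in simp)
  ultimately show ?case by simp
qed

lemma times_cont_diff_const: "times_cont_diff k (\<lambda>x. c)"
  by (induction k arbitrary: c) auto

lemma times_cont_diff_add:
  "times_cont_diff k f \<Longrightarrow> times_cont_diff k g \<Longrightarrow> times_cont_diff k (\<lambda>x. f x + g x)"
proof (induction k arbitrary: f g)
  case 0
  then show ?case by (auto intro: continuous_on_add)
next
  case (Suc k)
  obtain f' where f': "\<And>x. (f has_derivative f' x) (at x)"
    "\<And>v. times_cont_diff k (\<lambda>x. f' x v)" using Suc.prems(1) by (rule times_cont_diff_SucE) blast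
  obtain g' where g': "\<And>x. (g has_derivative g' x) (at x)"
    "\<And>v. times_cont_diff k (\<lambda>x. g' x v)" using Suc.prems(2) by (rule times_cont_diff_SucE) blast
  show ?case
    by (rule times_cont_diff_SucI[where f' = "\<lambda>x h. f' x h + g' x h"])
      (use f' g' Suc.IH in \<open>auto intro: has_derivative_add\<close>)
qed

lemma times_cont_diff_bilinear:
  assumes "bounded_bilinear b"
  shows "times_cont_diff k f \<Longrightarrow> times_cont_diff k g \<Longrightarrow> times_cont_diff k (\<lambda>x. b (f x) (g x))"
proof (induction k arbitrary: f g)
  case 0
  then show ?case using bounded_bilinear.continuous_on[OF assms] by auto
next
  case (Suc k)
  obtain f' where f': "\<And>x. (f has_derivative f' x) (at x)"
    "\<And>v. times_cont_diff k (\<lambda>x. f' x v)" using Suc.prems(1) by (rule times_cont_diff_SucE) blast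
  obtain g' where g': "\<And>x. (g has_derivative g' x) (at x)"
    "\<And>v. times_cont_diff k (\<lambda>x. g' x v)" using Suc.prems(2) by (rule times_cont_diff_SucE) blast
  have fg: "times_cont_diff k f" "times_cont_diff k g"
    using Suc.prems times_cont_diff_Suc_imp by blast+
  show ?case
    by (rule times_cont_diff_SucI[where f' = "\<lambda>x h. b (f x) (g' x h) + b (f' x h) (g x)"])
      (use f' g' fg Suc.IH in
        \<open>auto intro!: times_cont_diff_add bounded_bilinear.FDERIV[OF assms]\<close>)
qed

lemma times_cont_diff_linear_comp:
  assumes "bounded_linear L"
  shows "times_cont_diff k f \<Longrightarrow> times_cont_diff k (\<lambda>x. L (f x))"
proof (induction k arbitrary: f)
  case 0
  then show ?case using bounded_linear.continuous_on[OF assms] by auto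
next
  case (Suc k)
  obtain f' where f': "\<And>x. (f has_derivative f' x) (at x)"
    "\<And>v. times_cont_diff k (\<lambda>x. f' x v)" using Suc.prems by (rule times_cont_diff_SucE) blast
  show ?case
    by (rule times_cont_diff_SucI[where f' = "\<lambda>x h. L (f' x h)"])
      (use f' Suc.IH in \<open>auto intro!: bounded_linear.has_derivative[OF assms]\<close>)
qed

lemma times_cont_diff_comp_linear:
  assumes L: "bounded_linear L"
  shows "times_cont_diff k f \<Longrightarrow> times_cont_diff k (\<lambda>x. f (L x))"
proof (induction k arbitrary: f)
  case 0
  then show ?case
    using continuous_on_compose2[of UNIV f UNIV L] linear_continuous_on[OF L] by auto
next
  case (Suc k)
  obtain f' where f': "\<And>x. (f has_derivative f' x) (at x)"
    "\<And>v. times_cont_diff k (\<lambda>x. f' x v)" using Suc.prems by (rule times_cont_diff_SucE) blast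
  have "((\<lambda>x. f (L x)) has_derivative (\<lambda>h. f' (L x) (L h))) (at x)" for x
    using has_derivative_compose[OF bounded_linear_imp_has_derivative[OF L] f'(1)] .
  then show ?case
    by (rule times_cont_diff_SucI) (use f' Suc.IH in auto)
qed

lemma times_cont_diff_linear:
  assumes "bounded_linear L"
  shows "times_cont_diff k L"
  using assms
  by (cases k) (auto intro!: times_cont_diff_SucI[where f' = "\<lambda>x. L"] times_cont_diff_const
      bounded_linear_imp_has_derivative linear_continuous_on simp del: times_cont_diff.simps(2))

section \<open>Riemannian metrics on a vector space\<close>

text \<open>All manifolds here are diffeomorphic to a Euclidean space, which serves as a global chart;
  a vector field is a map from points to tangent vectors, a metric \<open>g\<close> sends a point \<open>p\<close> and
  tangent vectors \<open>u v\<close> at \<open>p\<close> to \<open>g p u v\<close>.\<close>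

type_synonym 'a vfield = "'a \<Rightarrow> 'a"
type_synonym 'a metric = "'a \<Rightarrow> 'a \<Rightarrow> 'a \<Rightarrow> real"

definition deriv_along :: "'a::euclidean_space vfield \<Rightarrow> ('a \<Rightarrow> 'b::real_normed_vector) \<Rightarrow> 'a \<Rightarrow> 'b"
  where "deriv_along X f p = frechet_derivative f (at p) (X p)"

text \<open>The field corresponding to the derivation \<open>f \<mapsto> X (Y f) - Y (X f)\<close>.\<close>
definition lie_bracket :: "'a::euclidean_space vfield \<Rightarrow> 'a vfield \<Rightarrow> 'a vfield" where
  "lie_bracket X Y p = deriv_along X Y p - deriv_along Y X p"

definition affine_connection :: "('a::euclidean_space vfield \<Rightarrow> 'a vfield \<Rightarrow> 'a vfield) \<Rightarrow> bool" where
  "affine_connection D \<longleftrightarrow>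
    (\<forall>X Y. smooth X \<longrightarrow> smooth Y \<longrightarrow> smooth (D X Y)) \<and>
    (\<forall>X X' Y p. smooth X \<longrightarrow> smooth X' \<longrightarrow> smooth Y \<longrightarrow>
       D (\<lambda>q. X q + X' q) Y p = D X Y p + D X' Y p) \<and>
    (\<forall>X Y Y' p. smooth X \<longrightarrow> smooth Y \<longrightarrow> smooth Y' \<longrightarrow>
       D X (\<lambda>q. Y q + Y' q) p = D X Y p + D X Y' p) \<and>
    (\<forall>f X Y p. smooth f \<longrightarrow> smooth X \<longrightarrow> smooth Y \<longrightarrow>
       D (\<lambda>q. f q *\<^sub>R X q) Y p = f p *\<^sub>R D X Y p) \<and>
    (\<forall>f X Y p. smooth f \<longrightarrow> smooth X \<longrightarrow> smooth Y \<longrightarrow>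
       D X (\<lambda>q. f q *\<^sub>R Y q) p = deriv_along X f p *\<^sub>R Y p + f p *\<^sub>R D X Y p)"

definition is_levi_civita ::
    "'a::euclidean_space metric \<Rightarrow> ('a vfield \<Rightarrow> 'a vfield \<Rightarrow> 'a vfield) \<Rightarrow> bool" where
  "is_levi_civita g D \<longleftrightarrow> affine_connection D \<and>
    (\<forall>X Y p. smooth X \<longrightarrow> smooth Y \<longrightarrow> D X Y p - D Y X p = lie_bracket X Y p) \<and>
    (\<forall>X Y Z p. smooth X \<longrightarrow> smooth Y \<longrightarrow> smooth Z \<longrightarrow>
       deriv_along X (\<lambda>q. g q (Y q) (Z q)) p = g p (D X Y p) (Z p) + g p (Y p) (D X Z p))"

text \<open>The axioms determine the connection on smooth fields only, hence the choice operator;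
  \<open>levi_civita g\<close> is applied to smooth fields only.\<close>
definition levi_civita :: "'a::euclidean_space metric \<Rightarrow> 'a vfield \<Rightarrow> 'a vfield \<Rightarrow> 'a vfield" where
  "levi_civita g = (SOME D. is_levi_civita g D)"

text \<open>Vanishing of the Lie derivative of \<open>g\<close> along \<open>X\<close>.\<close>
definition killing_field :: "'a::euclidean_space metric \<Rightarrow> 'a vfield \<Rightarrow> bool" where
  "killing_field g X \<longleftrightarrow> smooth X \<and>
    (\<forall>Y Z p. smooth Y \<longrightarrow> smooth Z \<longrightarrow>
       deriv_along X (\<lambda>q. g q (Y q) (Z q)) p =
         g p (lie_bracket X Y p) (Z p) + g p (Y p) (lie_bracket X Z p))"

definition distribution_of_symmetry :: "'a::euclidean_space metric \<Rightarrow> 'a \<Rightarrow> 'a set" where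
  "distribution_of_symmetry g p =
    {v. \<exists>X. killing_field g X \<and> (\<forall>Y. smooth Y \<longrightarrow> levi_civita g Y X p = 0) \<and> v = X p}"

text \<open>The rank: the dimension of the fibre, which is the same at every point of a homogeneous
  Riemannian manifold.\<close>
definition index_of_symmetry :: "'a::euclidean_space metric \<Rightarrow> nat" where
  "index_of_symmetry g = (THE k. \<forall>p. dim (distribution_of_symmetry g p) = k)"

section \<open>Lie group structures on a vector space\<close>

definition lie_group_structure ::
    "('a::euclidean_space \<Rightarrow> 'a \<Rightarrow> 'a) \<Rightarrow> 'a \<Rightarrow> ('a \<Rightarrow> 'a) \<Rightarrow> bool" where
  "lie_group_structure mul e iv \<longleftrightarrow>
    (\<forall>p q r. mul (mul p q) r = mul p (mul q r)) \<and>
    (\<forall>p. mul e p = p \<and> mul p e = p) \<and>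
    (\<forall>p. mul (iv p) p = e \<and> mul p (iv p) = e) \<and>
    smooth (\<lambda>(p, q). mul p q) \<and> smooth iv"

definition left_inv_field ::
    "('a::euclidean_space \<Rightarrow> 'a \<Rightarrow> 'a) \<Rightarrow> 'a \<Rightarrow> 'a \<Rightarrow> 'a vfield" where
  "left_inv_field mul e v p = frechet_derivative (mul p) (at e) v"

definition left_inv_metric ::
    "('a::euclidean_space \<Rightarrow> 'a \<Rightarrow> 'a) \<Rightarrow> ('a \<Rightarrow> 'a) \<Rightarrow> ('a \<Rightarrow> 'a \<Rightarrow> real) \<Rightarrow> 'a metric" where
  "left_inv_metric mul iv B p u v =
    B (frechet_derivative (mul (iv p)) (at p) u) (frechet_derivative (mul (iv p)) (at p) v)"

section \<open>The groups $\mathbb{R}^2 \rtimes_{\exp(tA)} \mathbb{R}$\<close>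

definition mpow :: "real^'n^'n \<Rightarrow> nat \<Rightarrow> real^'n^'n" where
  "mpow A k = (((**) A) ^^ k) (mat 1)"

definition mexp :: "real^'n^'n \<Rightarrow> real^'n^'n" where
  "mexp A = (\<Sum>k. (1 / fact k) *\<^sub>R mpow A k)"

type_synonym pt = "(real^2) \<times> real"

text \<open>The identity element is \<open>0\<close>.\<close>
definition sd_mult :: "real^2^2 \<Rightarrow> pt \<Rightarrow> pt \<Rightarrow> pt" where
  "sd_mult A = (\<lambda>(v, s) (w, t). (v + mexp (s *\<^sub>R A) *v w, s + t))"

definition sd_inv :: "real^2^2 \<Rightarrow> pt \<Rightarrow> pt" where
  "sd_inv A = (\<lambda>(v, s). (- (mexp (- s *\<^sub>R A) *v v), - s))"

definition basis0 :: pt where "basis0 = (axis 1 1, 0)"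
definition basis1 :: pt where "basis1 = (axis 2 1, 0)"
definition basis2 :: pt where "basis2 = (0, 1)"

definition coords :: "pt \<Rightarrow> real^3" where
  "coords = (\<lambda>(v, t). vector [v $ 1, v $ 2, t])"

definition sd_field :: "real^2^2 \<Rightarrow> pt \<Rightarrow> pt vfield" where
  "sd_field A = left_inv_field (sd_mult A) 0"

text \<open>\<open>Q\<close> is the Gram matrix in the frame of left invariant fields
  \<open>sd_field A basis0, sd_field A basis1, sd_field A basis2\<close>.\<close>
definition sd_metric :: "real^2^2 \<Rightarrow> real^3^3 \<Rightarrow> pt metric" where
  "sd_metric A Q = left_inv_metric (sd_mult A) (sd_inv A) (\<lambda>u v. coords u \<bullet> (Q *v coords v))"

text \<open>The simply connected groups $G_I$ and $G_c$ are \<open>sd_mult A_I\<close> and \<open>sd_mult (A_c c)\<close>: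
  the underlying manifold is a vector space, and the bracket relations are \<open>brackets_G_I\<close> and
  \<open>brackets_G_c\<close> below. \<open>A_I\<close> and \<open>A_c c\<close> are the matrices of $\mathrm{ad}\,e_2$
  on the span of $e_0, e_1$.\<close>
definition A_I :: "real^2^2" where "A_I = mat 1"

definition A_c :: "real \<Rightarrow> real^2^2" where
  "A_c c = vector [vector [0, - c], vector [1, 2]]"

definition change_of_basis :: "real \<Rightarrow> real^3^3" where
  "change_of_basis c = vector
    [vector [- (1 + sqrt (1 - c)) / (2 * c * sqrt (1 - c)), - 1 / (2 * sqrt (1 - c)), 0],
     vector [(1 - sqrt (1 - c)) / (2 * c * sqrt (1 - c)), 1 / (2 * sqrt (1 - c)), 0],
     vector [0, 0, 1]]"

section \<open>Lie group laws, brackets and Gram matrices\<close>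

lemma bounded_bilinear_mm: "bounded_bilinear ((**) :: real^'n^'n \<Rightarrow> real^'n^'n \<Rightarrow> real^'n^'n)"
proof -
  have "linear (\<lambda>B. A ** B)" "linear (\<lambda>B. B ** A)" for A :: "real^'n^'n"
    by (rule linearI; simp add: matrix_matrix_mult_def vec_eq_iff distrib_left distrib_right
        sum.distrib sum_distrib_left mult.assoc mult.left_commute)+
  then show ?thesis
    unfolding bilinear_conv_bounded_bilinear[symmetric] bilinear_def by blast
qed

lemma bounded_bilinear_mv: "bounded_bilinear ((*v) :: real^'n^'n \<Rightarrow> real^'n \<Rightarrow> real^'n)"
proof -
  have "linear (\<lambda>x. A *v x)" for A :: "real^'n^'n" by simp
  moreover have "linear (\<lambda>A :: real^'n^'n. A *v x)" for x
    by (rule linearI; simp add: matrix_vector_mult_def vec_eq_iff distrib_right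
        sum.distrib sum_distrib_left mult.assoc)
  ultimately show ?thesis
    unfolding bilinear_conv_bounded_bilinear[symmetric] bilinear_def by blast
qed

lemma mpow_0 [simp]: "mpow A 0 = mat 1"
  and mpow_Suc: "mpow A (Suc k) = A ** mpow A k"
  by (simp_all add: mpow_def)

lemma mpow_scale: "mpow (t *\<^sub>R A) k = t ^ k *\<^sub>R mpow A k"
  by (induction k) (simp_all add: mpow_Suc bounded_bilinear.scaleR_left[OF bounded_bilinear_mm] bounded_bilinear.scaleR_right[OF bounded_bilinear_mm])

lemma mpow_commute: "A ** mpow A k = mpow A k ** A"
proof (induction k)
  case (Suc k)
  have "A ** mpow A (Suc k) = A ** (mpow A k ** A)" using Suc by (simp add: mpow_Suc)
  then show ?case by (simp only: mpow_Suc matrix_mul_assoc)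
qed simp

lemma summable_mexp: "summable (\<lambda>k. (1 / fact k) *\<^sub>R mpow (A :: real^'n^'n) k)"
proof -
  have "\<exists>C>0. \<forall>(a::real^'n^'n) (b::real^'n^'n). norm (a ** b) \<le> norm a * norm b * C"
    by (rule bounded_bilinear.pos_bounded[OF bounded_bilinear_mm])
  then obtain C where C: "C > 0" "\<And>(a::real^'n^'n) (b::real^'n^'n). norm (a ** b) \<le> norm a * norm b * C"
    by blast
  have *: "norm (mpow A k) \<le> (norm A * C) ^ k * norm (mat 1 :: real^'n^'n)" for k
  proof (induction k)
    case (Suc k)
    have "norm (mpow A (Suc k)) \<le> norm A * norm (mpow A k) * C" by (simp only: mpow_Suc C)
    also have "\<dots> = (norm A * C) * norm (mpow A k)" by (simp only: mult_ac)
    also have "\<dots> \<le> (norm A * C) * ((norm A * C) ^ k * norm (mat 1 :: real^'n^'n))"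
      using C(1) by (intro mult_left_mono Suc) auto
    finally show ?case by (simp only: power_Suc mult.assoc)
  qed simp
  have "summable (\<lambda>k. ((norm A * C) ^ k /\<^sub>R fact k) * norm (mat 1 :: real^'n^'n))"
    by (intro summable_mult2 summable_exp_generic)
  moreover have "norm ((1 / fact k) *\<^sub>R mpow A k)
      \<le> ((norm A * C) ^ k /\<^sub>R fact k) * norm (mat 1 :: real^'n^'n)" for k
  proof -
    have "norm ((1 / fact k) *\<^sub>R mpow A k) = inverse (fact k) * norm (mpow A k)"
      by (simp add: divide_inverse)
    also have "\<dots> \<le> inverse (fact k) * ((norm A * C) ^ k * norm (mat 1 :: real^'n^'n))"
      by (rule mult_left_mono[OF *]) simp
    finally show ?thesis by (simp only: real_scaleR_def mult.assoc)
  qed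
  ultimately show ?thesis
    by (rule summable_comparison_test'[where N = 0])
qed

lemma mexp_entry:
  fixes A :: "real^'n^'n"
  shows "summable (\<lambda>k. (mpow A k $ i $ j / fact k) * t ^ k)"
  "mexp (t *\<^sub>R A) $ i $ j = (\<Sum>k. (mpow A k $ i $ j / fact k) * t ^ k)"
proof -
  have bl: "bounded_linear (\<lambda>M :: real^'n^'n. M $ i $ j)"
    by (rule bounded_linear_compose[OF bounded_linear_vec_nth bounded_linear_vec_nth])
  have eq: "(\<lambda>k. ((1 / fact k) *\<^sub>R mpow (t *\<^sub>R A) k) $ i $ j) = (\<lambda>k. (mpow A k $ i $ j / fact k) * t ^ k)"
    by (simp add: mpow_scale mult.commute)
  show "summable (\<lambda>k. (mpow A k $ i $ j / fact k) * t ^ k)"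
    using bounded_linear.summable[OF bl summable_mexp[of "t *\<^sub>R A"]] unfolding eq .
  show "mexp (t *\<^sub>R A) $ i $ j = (\<Sum>k. (mpow A k $ i $ j / fact k) * t ^ k)"
    unfolding mexp_def using bounded_linear.suminf[OF bl summable_mexp[of "t *\<^sub>R A"]] unfolding eq by simp
qed

lemma mexp_has_vector_derivative:
  "((\<lambda>t. mexp (t *\<^sub>R A)) has_vector_derivative (A ** mexp (t *\<^sub>R A))) (at t)"
proof -
  have "((\<lambda>t. mexp (t *\<^sub>R A) $ i $ j) has_real_derivative (A ** mexp (t *\<^sub>R A)) $ i $ j) (at t)" for i j
  proof -
    define c where "c = (\<lambda>k. mpow A k $ i $ j / fact k)"
    have d: "diffs c k = (\<Sum>l\<in>UNIV. A $ i $ l * (mpow A k $ l $ j / fact k))" for k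
    proof -
      have "diffs c k = mpow A (Suc k) $ i $ j / fact k"
        by (simp add: diffs_def c_def del: of_nat_Suc)
      also have "\<dots> = (\<Sum>l\<in>UNIV. A $ i $ l * (mpow A k $ l $ j / fact k))"
        by (simp add: mpow_Suc matrix_matrix_mult_def sum_divide_distrib)
      finally show ?thesis .
    qed
    have "(\<lambda>k. \<Sum>l\<in>UNIV. A $ i $ l * ((mpow A k $ l $ j / fact k) * t ^ k)) sums
        (\<Sum>l\<in>UNIV. A $ i $ l * mexp (t *\<^sub>R A) $ l $ j)"
      by (intro sums_sum sums_mult) (simp only: mexp_entry(2) summable_sums[OF mexp_entry(1)])
    then have "(\<Sum>k. diffs c k * t ^ k) = (A ** mexp (t *\<^sub>R A)) $ i $ j"
      by (simp add: d sum_distrib_right mult.assoc sums_iff matrix_matrix_mult_def)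
    moreover have "((\<lambda>t. \<Sum>k. c k * t ^ k) has_real_derivative (\<Sum>k. diffs c k * t ^ k)) (at t)"
      by (rule termdiffs_strong_converges_everywhere) (simp only: c_def mexp_entry(1))
    ultimately show ?thesis by (simp add: mexp_entry(2) c_def)
  qed
  then have "((\<lambda>t. mexp (t *\<^sub>R A) $ i $ j) has_derivative
      (\<lambda>h. (h *\<^sub>R (A ** mexp (t *\<^sub>R A))) $ i $ j)) (at t)" for i j
    by (simp add: has_field_derivative_def mult_commute_abs)
  then show ?thesis
    unfolding has_vector_derivative_def
    by (subst has_derivative_componentwise_within) (auto simp: Basis_vec_def inner_axis)
qed

lemma mexp_commute: "A ** mexp (t *\<^sub>R A) = mexp (t *\<^sub>R A) ** A"
proof -
  have "(\<lambda>k. (1 / fact k) *\<^sub>R mpow (t *\<^sub>R A) k) sums mexp (t *\<^sub>R A)"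
    unfolding mexp_def using summable_mexp by (rule summable_sums)
  then have "(\<lambda>k. A ** ((1 / fact k) *\<^sub>R mpow (t *\<^sub>R A) k)) sums (A ** mexp (t *\<^sub>R A))"
    and "(\<lambda>k. ((1 / fact k) *\<^sub>R mpow (t *\<^sub>R A) k) ** A) sums (mexp (t *\<^sub>R A) ** A)"
    by (rule bounded_linear.sums[OF bounded_bilinear.bounded_linear_right[OF bounded_bilinear_mm]],
        rule bounded_linear.sums[OF bounded_bilinear.bounded_linear_left[OF bounded_bilinear_mm]])
  moreover have "(\<lambda>k. A ** ((1 / fact k) *\<^sub>R mpow (t *\<^sub>R A) k)) =
      (\<lambda>k. ((1 / fact k) *\<^sub>R mpow (t *\<^sub>R A) k) ** A)"
    by (rule ext) (simp only: mpow_scale mpow_commute bounded_bilinear.scaleR_left[OF bounded_bilinear_mm]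
        bounded_bilinear.scaleR_right[OF bounded_bilinear_mm])
  ultimately show ?thesis by (simp only: sums_unique2)
qed

lemma mexp_0 [simp]: "mexp (0 :: real^'n^'n) = mat 1"
proof -
  have 0: "(0 :: real^'n^'n) ** M = 0" for M
    by (simp add: matrix_matrix_mult_def vec_eq_iff)
  have "mexp (0 :: real^'n^'n) = (\<Sum>k\<in>{0}. (1 / fact k) *\<^sub>R mpow 0 k)"
    unfolding mexp_def
  proof (rule suminf_finite)
    fix k :: nat assume "k \<notin> {0}"
    then show "(1 / fact k) *\<^sub>R mpow (0 :: real^'n^'n) k = 0"
      by (cases k) (simp_all add: mpow_Suc 0)
  qed simp
  then show ?thesis by simp
qed

lemma mexp_minus_has_vector_derivative:
  "((\<lambda>t. mexp (- t *\<^sub>R A)) has_vector_derivative (- (A ** mexp (- t *\<^sub>R A)))) (at t)"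
  using vector_diff_chain_at[of uminus "-1" t "\<lambda>t. mexp (t *\<^sub>R A)" "A ** mexp (- t *\<^sub>R A)"]
    mexp_has_vector_derivative[of A "- t"]
  by (simp add: o_def has_vector_derivative_minus)

lemma mexp_shift: "mexp (- s *\<^sub>R A) ** mexp ((s + t) *\<^sub>R A) = mexp (t *\<^sub>R A)"
proof -
  let ?f = "\<lambda>s. mexp (- s *\<^sub>R A) ** mexp ((s + t) *\<^sub>R A)"
  have "(?f has_vector_derivative 0) (at s)" for s
  proof -
    have 1: "((\<lambda>s. mexp ((s + t) *\<^sub>R A)) has_vector_derivative A ** mexp ((s + t) *\<^sub>R A)) (at s)"
      using vector_diff_chain_at[of "\<lambda>s. s + t" 1 s "\<lambda>t. mexp (t *\<^sub>R A)" "A ** mexp ((s + t) *\<^sub>R A)"]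
        mexp_has_vector_derivative[of A "s + t"]
      by (simp add: o_def has_vector_derivative_def has_derivative_add_const)
    have "(?f has_vector_derivative (mexp (- s *\<^sub>R A) ** (A ** mexp ((s + t) *\<^sub>R A)) +
         (- (A ** mexp (- s *\<^sub>R A))) ** mexp ((s + t) *\<^sub>R A))) (at s)"
      by (rule bounded_bilinear.has_vector_derivative[OF bounded_bilinear_mm
            mexp_minus_has_vector_derivative 1])
    moreover have "mexp (- s *\<^sub>R A) ** (A ** mexp ((s + t) *\<^sub>R A)) +
         (- (A ** mexp (- s *\<^sub>R A))) ** mexp ((s + t) *\<^sub>R A) = 0"
      using mexp_commute[of A "- s"]
      by (simp add: matrix_mul_assoc bounded_bilinear.minus_left[OF bounded_bilinear_mm])
    ultimately show ?thesis by simp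
  qed
  then obtain C where C: "\<And>s. ?f s = C"
    using has_derivative_zero_constant[of UNIV ?f] by (auto simp: has_vector_derivative_def)
  have "?f s = ?f 0" using C by metis
  then show ?thesis by simp
qed

lemma mexp_inverse:
  "mexp (- s *\<^sub>R A) ** mexp (s *\<^sub>R A) = mat 1"
  "mexp (s *\<^sub>R A) ** mexp (- s *\<^sub>R A) = mat 1"
  using mexp_shift[of s A 0] mexp_shift[of "- s" A 0] by simp_all

lemma mexp_add: "mexp ((s + t) *\<^sub>R A) = mexp (s *\<^sub>R A) ** mexp (t *\<^sub>R A)"
proof -
  have "mexp (s *\<^sub>R A) ** mexp (t *\<^sub>R A)
      = (mexp (s *\<^sub>R A) ** mexp (- s *\<^sub>R A)) ** mexp ((s + t) *\<^sub>R A)"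
    unfolding matrix_mul_assoc[symmetric] mexp_shift ..
  then show ?thesis by (simp only: mexp_inverse(2) matrix_mul_lid)
qed

lemma times_cont_diff_mexp:
  fixes A :: "real^'a^'a"
  shows "times_cont_diff k (\<lambda>t. mexp (t *\<^sub>R A))"
proof (induction k)
  case 0
  then show ?case
    using mexp_has_vector_derivative has_vector_derivative_continuous
    by (simp add: continuous_on_eq_continuous_within) blast
next
  case (Suc k)
  have "bounded_linear (\<lambda>M :: real^'a^'a. h *\<^sub>R (A ** M))" for h
    by (rule bounded_linear_compose[OF bounded_linear_scaleR_right
          bounded_bilinear.bounded_linear_right[OF bounded_bilinear_mm]])
  then show ?case
    using mexp_has_vector_derivative Suc
    by (intro times_cont_diff_SucI[where f' = "\<lambda>t h. h *\<^sub>R (A ** mexp (t *\<^sub>R A))"]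
        times_cont_diff_linear_comp[where L = "\<lambda>M. _ *\<^sub>R (A ** M)"])
      (auto simp: has_vector_derivative_def)
qed

lemma times_cont_diff_Pair:
  assumes "times_cont_diff k f" "times_cont_diff k g"
  shows "times_cont_diff k (\<lambda>x. (f x, g x))"
proof -
  have "times_cont_diff k (\<lambda>x. (f x, 0) + (0, g x))"
    by (intro times_cont_diff_add times_cont_diff_linear_comp[where L = "\<lambda>y. (y, 0)"]
        times_cont_diff_linear_comp[where L = "\<lambda>y. (0, y)"] assms bounded_linear_Pair
        bounded_linear_ident bounded_linear_zero)
  then show ?thesis by simp
qed

lemma sd_mult_eq: "sd_mult A p = (\<lambda>q. (fst p + mexp (snd p *\<^sub>R A) *v fst q, snd p + snd q))"
  and sd_inv_eq: "sd_inv A = (\<lambda>p. (- (mexp (- snd p *\<^sub>R A) *v fst p), - snd p))"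
  by (simp_all add: sd_mult_def sd_inv_def split_beta fun_eq_iff)

lemma lie_group_structure_sd: "lie_group_structure (sd_mult A) 0 (sd_inv A)"
  unfolding lie_group_structure_def
proof (intro conjI allI)
  show "sd_mult A (sd_mult A p q) r = sd_mult A p (sd_mult A q r)" for p q r
    by (cases p; cases q; cases r)
      (simp add: sd_mult_def mexp_add matrix_vector_right_distrib matrix_vector_mul_assoc)
  show "sd_mult A 0 p = p" "sd_mult A p 0 = p" for p
    by (simp_all add: sd_mult_def zero_prod_def split_beta)
  show "sd_mult A (sd_inv A p) p = 0" for p
    by (simp add: sd_mult_def sd_inv_def zero_prod_def split_beta)
  show "sd_mult A p (sd_inv A p) = 0" for p
    using mexp_inverse(2)[of "snd p" A]
    by (simp add: sd_mult_def sd_inv_def zero_prod_def split_beta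
        bounded_bilinear.minus_right[OF bounded_bilinear_mv] matrix_vector_mul_assoc)
  have "times_cont_diff k (\<lambda>x::pt \<times> pt.
      (fst (fst x) + mexp (snd (fst x) *\<^sub>R A) *v fst (snd x), snd (fst x) + snd (snd x)))" for k
    by (intro times_cont_diff_Pair times_cont_diff_add times_cont_diff_bilinear[OF bounded_bilinear_mv]
        times_cont_diff_comp_linear[where f = "\<lambda>t. mexp (t *\<^sub>R A)" and L = "\<lambda>x. snd (fst x)"]
        times_cont_diff_mexp times_cont_diff_linear bounded_linear_fst_comp bounded_linear_snd_comp
        bounded_linear_fst bounded_linear_snd)
  then show "smooth (\<lambda>(p, q). sd_mult A p q)"
    by (simp add: smooth_def sd_mult_eq case_prod_beta')
  have "times_cont_diff k (\<lambda>x::pt. (- (mexp (- snd x *\<^sub>R A) *v fst x), - snd x))" for k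
    by (intro times_cont_diff_Pair times_cont_diff_linear_comp[where L = uminus]
        times_cont_diff_bilinear[OF bounded_bilinear_mv]
        times_cont_diff_comp_linear[where f = "\<lambda>t. mexp (t *\<^sub>R A)" and L = "\<lambda>x. - snd x"]
        times_cont_diff_mexp times_cont_diff_linear bounded_linear_minus bounded_linear_ident
        bounded_linear_fst bounded_linear_snd)
  then show "smooth (sd_inv A)"
    by (simp add: smooth_def sd_inv_eq)
qed

lemma sd_mult_has_derivative:
  "(sd_mult A p has_derivative (\<lambda>h. (mexp (snd p *\<^sub>R A) *v fst h, snd h))) (at q)"
proof -
  have "((\<lambda>q. (fst p + mexp (snd p *\<^sub>R A) *v fst q, snd p + snd q)) has_derivative
      (\<lambda>h. (0 + mexp (snd p *\<^sub>R A) *v fst h, 0 + snd h))) (at q)"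
    by (intro has_derivative_Pair has_derivative_add has_derivative_const
        bounded_linear.has_derivative[OF matrix_vector_mul_bounded_linear]
        has_derivative_fst has_derivative_snd has_derivative_ident)
  then show ?thesis by (simp add: sd_mult_eq)
qed

lemma frechet_derivative_sd_mult:
  "frechet_derivative (sd_mult A p) (at q) = (\<lambda>h. (mexp (snd p *\<^sub>R A) *v fst h, snd h))"
  using frechet_derivative_at[OF sd_mult_has_derivative] by simp

lemma sd_field_eq: "sd_field A v p = (mexp (snd p *\<^sub>R A) *v fst v, snd v)"
  by (simp add: sd_field_def left_inv_field_def frechet_derivative_sd_mult)

lemma sd_field_has_derivative:
  "(sd_field A v has_derivative (\<lambda>h. (snd h *\<^sub>R (mexp (snd p *\<^sub>R A) *v (A *v fst v)), 0))) (at p)"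
proof -
  have 1: "((\<lambda>t. mexp (t *\<^sub>R A)) has_derivative (\<lambda>h. h *\<^sub>R (A ** mexp (snd p *\<^sub>R A)))) (at (snd p))"
    using mexp_has_vector_derivative[of A "snd p"] by (simp add: has_vector_derivative_def)
  have "((\<lambda>p. mexp (snd p *\<^sub>R A)) has_derivative (\<lambda>h. snd h *\<^sub>R (A ** mexp (snd p *\<^sub>R A)))) (at p)"
    using has_derivative_compose[OF has_derivative_snd[OF has_derivative_ident] 1] by simp
  then have "((\<lambda>p. mexp (snd p *\<^sub>R A) *v fst v) has_derivative
      (\<lambda>h. (snd h *\<^sub>R (A ** mexp (snd p *\<^sub>R A))) *v fst v)) (at p)"
    by (rule bounded_linear.has_derivative[OF
          bounded_bilinear.bounded_linear_left[OF bounded_bilinear_mv]])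
  then have "((\<lambda>p. (mexp (snd p *\<^sub>R A) *v fst v, snd v)) has_derivative
      (\<lambda>h. ((snd h *\<^sub>R (A ** mexp (snd p *\<^sub>R A))) *v fst v, 0))) (at p)"
    by (intro has_derivative_Pair has_derivative_const)
  then show ?thesis
    by (simp add: sd_field_eq[abs_def] mexp_commute matrix_vector_mul_assoc
        bounded_bilinear.scaleR_left[OF bounded_bilinear_mv])
qed

lemma lie_bracket_sd_field:
  "lie_bracket (sd_field A u) (sd_field A v) =
    sd_field A (snd u *\<^sub>R (A *v fst v) - snd v *\<^sub>R (A *v fst u), 0)"
proof
  fix p
  have "frechet_derivative (sd_field A v) (at p) =
      (\<lambda>h. (snd h *\<^sub>R (mexp (snd p *\<^sub>R A) *v (A *v fst v)), 0))" for v
    using frechet_derivative_at[OF sd_field_has_derivative] by simp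
  then show "lie_bracket (sd_field A u) (sd_field A v) p =
      sd_field A (snd u *\<^sub>R (A *v fst v) - snd v *\<^sub>R (A *v fst u), 0) p"
    by (simp add: lie_bracket_def deriv_along_def sd_field_eq matrix_vector_mult_diff_distrib
        bounded_bilinear.scaleR_right[OF bounded_bilinear_mv])
qed

lemma sd_metric_sd_field:
  "sd_metric A Q p (sd_field A u p) (sd_field A v p) = coords u \<bullet> (Q *v coords v)"
  using mexp_inverse(1)[of "snd p" A]
  by (simp add: sd_metric_def left_inv_metric_def frechet_derivative_sd_mult sd_field_eq
      sd_inv_def split_beta matrix_vector_mul_assoc)

lemma coords_basis:
  "coords basis0 = axis 1 1" "coords basis1 = axis 2 1" "coords basis2 = axis 3 1"
  by (simp_all add: coords_def basis0_def basis1_def basis2_def vec_eq_iff forall_3 axis_def)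

lemma gram_entry: "axis i 1 \<bullet> (Q *v axis j 1) = (Q $ i $ j :: real)" for Q :: "real^'n^'n"
  by (simp add: inner_axis' matrix_vector_mul_component inner_axis)

lemma sd_metric_frame:
  fixes b :: "3 \<Rightarrow> pt"
  assumes "b 1 = basis0" "b 2 = basis1" "b 3 = basis2"
  shows "sd_metric A Q p (sd_field A (b i) p) (sd_field A (b j) p) = Q $ i $ j"
proof -
  have "coords (b i) = axis i 1" for i
    using exhaust_3[of i] assms coords_basis by metis
  then show ?thesis by (simp add: sd_metric_sd_field gram_entry)
qed

lemma brackets_G_I:
  "lie_bracket (sd_field A_I basis0) (sd_field A_I basis1) = (\<lambda>p. 0)"
  "lie_bracket (sd_field A_I basis2) (sd_field A_I basis0) = sd_field A_I basis0"
  "lie_bracket (sd_field A_I basis2) (sd_field A_I basis1) = sd_field A_I basis1"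
  by (simp_all add: lie_bracket_sd_field sd_field_eq fun_eq_iff A_I_def
      basis0_def basis1_def basis2_def zero_prod_def)

lemma brackets_G_c:
  "lie_bracket (sd_field (A_c c) basis0) (sd_field (A_c c) basis1) = (\<lambda>p. 0)"
  "lie_bracket (sd_field (A_c c) basis2) (sd_field (A_c c) basis0) = sd_field (A_c c) basis1"
  "lie_bracket (sd_field (A_c c) basis2) (sd_field (A_c c) basis1) =
    (\<lambda>p. - c *\<^sub>R sd_field (A_c c) basis0 p + 2 *\<^sub>R sd_field (A_c c) basis1 p)"
proof -
  have 0: "A_c c *v axis 1 1 = axis 2 1"
    and 1: "A_c c *v axis 2 1 = - c *\<^sub>R axis 1 1 + 2 *\<^sub>R axis 2 1"
    by (simp_all add: A_c_def vec_eq_iff forall_2 matrix_vector_mult_def sum_2 axis_def)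
  show "lie_bracket (sd_field (A_c c) basis0) (sd_field (A_c c) basis1) = (\<lambda>p. 0)"
    "lie_bracket (sd_field (A_c c) basis2) (sd_field (A_c c) basis0) = sd_field (A_c c) basis1"
    by (simp_all add: lie_bracket_sd_field sd_field_eq fun_eq_iff 0
        basis0_def basis1_def basis2_def zero_prod_def)
  show "lie_bracket (sd_field (A_c c) basis2) (sd_field (A_c c) basis1) =
    (\<lambda>p. - c *\<^sub>R sd_field (A_c c) basis0 p + 2 *\<^sub>R sd_field (A_c c) basis1 p)"
    unfolding lie_bracket_sd_field
    by (simp add: sd_field_eq fun_eq_iff 1 basis0_def basis1_def basis2_def
        bounded_bilinear.scaleR_right[OF bounded_bilinear_mv]
        bounded_bilinear.add_right[OF bounded_bilinear_mv]
        bounded_bilinear.diff_right[OF bounded_bilinear_mv])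
qed

end

(* The metric on R^2 x R depends on the last coordinate only. Write X = E_zeta + tau e_2 for a
Killing field in the left invariant frame, B for the adjoint of A with respect to the Gram matrix,
S = (A + B) / 2 and K = (A - B) / 2. The bilinear form q(tau A u - E_u zeta, w) is skew, hence phi
times the area form. Its e_2-derivative expresses the second derivatives E_u E_w tau by phi and
e_2 phi; their symmetry gives e_2 phi = 0 (as trace B = trace A), and a second e_2-derivative gives
phi (m M + [M, A]) = 0 with m = trace A, M = 2 S - m, so phi = 0 unless S is scalar or m = 0. Then
E_u zeta = tau A u, and commuting derivatives, (E_w tau) A u = (E_u tau) A w. If A is invertible,
tau is therefore constant and the Killing fields are the right invariant ones; if A has rank one,
there is one more. Such a field is parallel at a point iff tau K = 0 there and
q(S zeta, u) = - nu E_u tau for all u. If S is the identity, the space is hyperbolic. *)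
theory Submission
  imports Defs
begin

text \<open>A Killing field is known only through a differential equation, and the isometry group
  can be larger than the group acting by translations. So each fibre needs an upper bound, from
  integrability conditions, and explicit global Killing fields for the lower bound. All matrices
  \<open>A\<close> of the theorem have trace 2, and \<open>S\<close> is scalar only in the
  hyperbolic cases, where rotations of the horizontal plane make phi nonzero. Outside these cases
  the rest is linear algebra of the Gram matrix with entries a, b, d on the plane. Two invariants
  matter: the symmetric form \<open>q (S *v w) u\<close>, whose kernel gives the horizontal
  directions if c is not 0, and the number d + c a - 2 b, which vanishes iff K = 0 and then admits
  e_2. The exceptional values mu = sqrt c and mu = (sqrt c - 1)^2 + 1 are zeros of the determinant
  of that form, and the spanning vectors found there are its null vectors. For c = 0 the additional
  Killing field relaxes \<open>S *v w = 0\<close>: the form in u need only be a multiple of the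
  covector l with A u = (l . u) f.\<close>

section \<open>Second derivatives of smooth maps\<close>

lemma smooth_has_derivative:
  assumes "smooth f"
  shows "(f has_derivative frechet_derivative f (at x)) (at x)"
proof -
  have "times_cont_diff (Suc 0) f" using assms unfolding smooth_def by blast
  then show ?thesis by (simp add: frechet_derivative_works)
qed

lemma smooth_frechet_derivative:
  assumes "smooth f"
  shows "smooth (\<lambda>x. frechet_derivative f (at x) v)"
  unfolding smooth_def
proof
  fix k
  have "times_cont_diff (Suc k) f" using assms unfolding smooth_def by blast
  then show "times_cont_diff k (\<lambda>x. frechet_derivative f (at x) v)" by simp
qed

lemma smooth_imp_continuous_on:
  assumes "smooth f"
  shows "continuous_on UNIV f"
proof -
  have "times_cont_diff 0 f" using assms unfolding smooth_def by blast
  then show ?thesis by simp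
qed

lemma linear_frechet_derivative_smooth: "smooth f \<Longrightarrow> linear (frechet_derivative f (at x))"
  by (rule bounded_linear.linear[OF has_derivative_bounded_linear[OF smooth_has_derivative]])

section \<open>Closure properties of smooth maps\<close>

lemma smooth_const: "smooth (\<lambda>x. c)"
  by (simp add: smooth_def times_cont_diff_const)

lemma smooth_add: "smooth f \<Longrightarrow> smooth g \<Longrightarrow> smooth (\<lambda>x. f x + g x)"
  by (simp add: smooth_def times_cont_diff_add)

lemma smooth_bilinear:
  "bounded_bilinear b \<Longrightarrow> smooth f \<Longrightarrow> smooth g \<Longrightarrow> smooth (\<lambda>x. b (f x) (g x))"
  unfolding smooth_def by (blast intro: times_cont_diff_bilinear)

lemma smooth_linear_comp: "bounded_linear L \<Longrightarrow> smooth f \<Longrightarrow> smooth (\<lambda>x. L (f x))"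
  unfolding smooth_def by (blast intro: times_cont_diff_linear_comp)

lemma smooth_comp_linear: "smooth f \<Longrightarrow> bounded_linear L \<Longrightarrow> smooth (\<lambda>x. f (L x))"
  unfolding smooth_def by (blast intro: times_cont_diff_comp_linear)

lemma smooth_linear: "bounded_linear L \<Longrightarrow> smooth L"
  by (simp add: smooth_def times_cont_diff_linear)

lemma smooth_Pair: "smooth f \<Longrightarrow> smooth g \<Longrightarrow> smooth (\<lambda>x. (f x, g x))"
  by (simp add: smooth_def times_cont_diff_Pair)

lemma smooth_minus: "smooth f \<Longrightarrow> smooth (\<lambda>x. - f x)"
  by (rule smooth_linear_comp) (rule bounded_linear_minus[OF bounded_linear_ident])

lemma smooth_diff: "smooth f \<Longrightarrow> smooth g \<Longrightarrow> smooth (\<lambda>x. f x - g x)"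
  using smooth_add[OF _ smooth_minus, of f g] by simp

lemma smooth_sum: "(\<And>i. i \<in> I \<Longrightarrow> smooth (f i)) \<Longrightarrow> smooth (\<lambda>x. \<Sum>i\<in>I. f i x)"
  by (induction I rule: infinite_finite_induct) (auto intro: smooth_add smooth_const)

lemma smooth_fst: "smooth f \<Longrightarrow> smooth (\<lambda>x. fst (f x))"
  by (rule smooth_linear_comp) (rule bounded_linear_fst)

lemma smooth_snd: "smooth f \<Longrightarrow> smooth (\<lambda>x. snd (f x))"
  by (rule smooth_linear_comp) (rule bounded_linear_snd)

lemma smooth_ident: "smooth (\<lambda>x. x)"
  by (rule smooth_linear) (rule bounded_linear_ident)

lemmas smooth_scaleR = smooth_bilinear[OF bounded_bilinear_scaleR]
  and smooth_mult = smooth_bilinear[OF bounded_bilinear_mult]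
  and smooth_inner = smooth_bilinear[OF bounded_bilinear_inner]
  and smooth_matrix_vector_mult = smooth_bilinear[OF bounded_bilinear_mv]

lemmas smooth_intros = smooth_const smooth_ident smooth_add smooth_minus smooth_diff smooth_fst
  smooth_snd smooth_scaleR smooth_mult smooth_inner smooth_matrix_vector_mult smooth_Pair

lemma smooth_deriv_along:
  fixes V :: "'a::euclidean_space vfield"
  assumes "smooth V" "smooth f"
  shows "smooth (deriv_along V f)"
proof -
  have "deriv_along V f p = (\<Sum>b\<in>Basis. (V p \<bullet> b) *\<^sub>R frechet_derivative f (at p) b)" for p
  proof -
    have "deriv_along V f p = frechet_derivative f (at p) (\<Sum>b\<in>Basis. (V p \<bullet> b) *\<^sub>R b)"
      by (simp add: deriv_along_def euclidean_representation)
    also have "\<dots> = (\<Sum>b\<in>Basis. (V p \<bullet> b) *\<^sub>R frechet_derivative f (at p) b)"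
      using linear_frechet_derivative_smooth[OF assms(2)] by (simp add: linear_sum linear_scale)
    finally show ?thesis .
  qed
  then have "deriv_along V f = (\<lambda>p. \<Sum>b\<in>Basis. (V p \<bullet> b) *\<^sub>R frechet_derivative f (at p) b)"
    by auto
  then show ?thesis
    by (auto intro!: smooth_sum smooth_intros smooth_frechet_derivative assms)
qed

text \<open>Apply the mean value theorem to the w-increment of f along v, then to the v-derivative
  of f along w. The left side is symmetric in v and w while the right side is not, which forces
  mixed derivatives to agree in the limit.\<close>

lemma second_difference_mvt:
  fixes f :: "'a::real_normed_vector \<Rightarrow> real"
  assumes f: "smooth f"
  shows "\<exists>a\<in>{0<..<1}. \<exists>b\<in>{0<..<1}. f (p + v + w) - f (p + v) - f (p + w) + f p =
    frechet_derivative (\<lambda>x. frechet_derivative f (at x) v) (at (p + a *\<^sub>R v + b *\<^sub>R w)) w"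
proof -
  have along: "((\<lambda>r. h (x + r *\<^sub>R u)) has_real_derivative frechet_derivative h (at (x + r *\<^sub>R u)) u) (at r)"
    if "smooth h" for h :: "'a \<Rightarrow> real" and x u r
  proof -
    have "((\<lambda>r. x + r *\<^sub>R u) has_derivative (\<lambda>d. d *\<^sub>R u)) (at r)"
      by (auto intro!: derivative_eq_intros)
    from has_derivative_compose[OF this smooth_has_derivative[OF that]] show ?thesis
      unfolding has_field_derivative_def
      by (simp add: linear_scale[OF linear_frechet_derivative_smooth[OF that]] mult_commute_abs)
  qed
  let ?fv = "\<lambda>x. frechet_derivative f (at x) v"
  let ?G = "\<lambda>r. f (p + w + r *\<^sub>R v) - f (p + r *\<^sub>R v)"
  have "(?G has_real_derivative ?fv (p + w + r *\<^sub>R v) - ?fv (p + r *\<^sub>R v)) (at r)" for r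
    by (intro DERIV_diff along f)
  then obtain a where a: "0 < a" "a < 1" "?G 1 - ?G 0 = ?fv (p + w + a *\<^sub>R v) - ?fv (p + a *\<^sub>R v)"
    using MVT2[of 0 1 ?G "\<lambda>r. ?fv (p + w + r *\<^sub>R v) - ?fv (p + r *\<^sub>R v)"] by auto
  let ?h = "\<lambda>r. ?fv (p + a *\<^sub>R v + r *\<^sub>R w)"
  have "(?h has_real_derivative frechet_derivative ?fv (at (p + a *\<^sub>R v + r *\<^sub>R w)) w) (at r)" for r
    by (rule along[OF smooth_frechet_derivative[OF f]])
  then obtain b where b: "0 < b" "b < 1"
    "?h 1 - ?h 0 = frechet_derivative ?fv (at (p + a *\<^sub>R v + b *\<^sub>R w)) w"
    using MVT2[of 0 1 ?h "\<lambda>r. frechet_derivative ?fv (at (p + a *\<^sub>R v + r *\<^sub>R w)) w"] by auto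
  have "f (p + v + w) - f (p + v) - f (p + w) + f p = ?G 1 - ?G 0"
    by (simp add: algebra_simps)
  also have "\<dots> = ?h 1 - ?h 0" using a(3) by (simp add: algebra_simps)
  finally show ?thesis using a(1,2) b by (intro bexI[of _ a] bexI[of _ b]) simp_all
qed

text \<open>On the parallelogram with sides s v and s w, both orders of differentiation give the
  same second difference, each as s * s times a second derivative at a point near p. Cancel s * s
  and use continuity.\<close>

lemma second_derivative_symmetric_real:
  fixes f :: "'a::real_normed_vector \<Rightarrow> real"
  assumes f: "smooth f"
  shows "frechet_derivative (\<lambda>x. frechet_derivative f (at x) v) (at p) w =
    frechet_derivative (\<lambda>x. frechet_derivative f (at x) w) (at p) v"
proof -
  define F where "F = (\<lambda>v w q. frechet_derivative (\<lambda>x. frechet_derivative f (at x) v) (at q) w)"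
  have F_fold: "frechet_derivative (\<lambda>x. frechet_derivative f (at x) v) (at q) w = F v w q" for v w q
    by (simp add: F_def)
  have scale: "F (s *\<^sub>R v) (s *\<^sub>R w) q = s * s * F v w q" for s v w q
  proof -
    have 1: "frechet_derivative f (at x) (s *\<^sub>R v) = s * frechet_derivative f (at x) v" for x
      using linear_scale[OF linear_frechet_derivative_smooth[OF f]] by simp
    have "((\<lambda>x. s * frechet_derivative f (at x) v) has_derivative (\<lambda>h. s * F v h q)) (at q)"
      unfolding F_def
      by (intro has_derivative_mult_right smooth_has_derivative smooth_frechet_derivative f)
    from fun_cong[OF frechet_derivative_at[OF this]]
    have "F (s *\<^sub>R v) (s *\<^sub>R w) q = s * F v (s *\<^sub>R w) q"
      unfolding F_def 1 by simp
    also have "F v (s *\<^sub>R w) q = s * F v w q"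
      unfolding F_def
      using linear_scale[OF linear_frechet_derivative_smooth[OF smooth_frechet_derivative[OF f]]]
      by simp
    finally show ?thesis by simp
  qed
  have cont: "isCont (F v w) p" for v w
    using smooth_imp_continuous_on[OF smooth_frechet_derivative[OF smooth_frechet_derivative[OF f]]]
    by (simp add: F_def continuous_on_eq_continuous_within)
  have le: "\<bar>F v w p - F w v p\<bar> \<le> e" if "e > 0" for e
  proof -
    have e2: "e / 2 > 0" using that by simp
    obtain d1 where d1: "d1 > 0" "\<And>x. dist x p < d1 \<Longrightarrow> dist (F v w x) (F v w p) < e / 2"
      using cont[of v w, unfolded continuous_at_eps_delta] e2 by blast
    obtain d2 where d2: "d2 > 0" "\<And>x. dist x p < d2 \<Longrightarrow> dist (F w v x) (F w v p) < e / 2"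
      using cont[of w v, unfolded continuous_at_eps_delta] e2 by blast
    \<comment> \<open>The summand 1 keeps N positive for v = w = 0 and makes the distance estimate
      below strict.\<close>
    define N where "N = norm v + norm w + 1"
    define s where "s = min d1 d2 / N"
    have N: "N > 0" unfolding N_def by (smt (verit) norm_ge_zero)
    have s: "s > 0" using d1 d2 N by (simp add: s_def)
    have near: "dist (p + a *\<^sub>R (s *\<^sub>R v') + b *\<^sub>R (s *\<^sub>R w')) p < min d1 d2"
      if "a \<in> {0<..<1}" "b \<in> {0<..<1}" "norm v' + norm w' + 1 = N" for a b v' w'
    proof -
      have "dist (p + a *\<^sub>R (s *\<^sub>R v') + b *\<^sub>R (s *\<^sub>R w')) p \<le> s * (a * norm v' + b * norm w')"
        using that s norm_triangle_ineq[of "(a * s) *\<^sub>R v'" "(b * s) *\<^sub>R w'"]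
        by (simp add: dist_norm algebra_simps)
      also have "\<dots> < s * N"
      proof -
        have "a * norm v' \<le> 1 * norm v'" "b * norm w' \<le> 1 * norm w'"
          using that by (intro mult_right_mono; simp)+
        then show ?thesis using s that(3) by (intro mult_strict_left_mono) auto
      qed
      also have "\<dots> = min d1 d2" using N by (simp add: s_def)
      finally show ?thesis .
    qed
    obtain a b where ab: "a \<in> {0<..<1}" "b \<in> {0<..<1}"
      "f (p + s *\<^sub>R v + s *\<^sub>R w) - f (p + s *\<^sub>R v) - f (p + s *\<^sub>R w) + f p =
        s * s * F v w (p + a *\<^sub>R (s *\<^sub>R v) + b *\<^sub>R (s *\<^sub>R w))"
      using second_difference_mvt[OF f, of p "s *\<^sub>R v" "s *\<^sub>R w"]
      unfolding F_fold scale by blast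
    obtain a' b' where ab': "a' \<in> {0<..<1}" "b' \<in> {0<..<1}"
      "f (p + s *\<^sub>R w + s *\<^sub>R v) - f (p + s *\<^sub>R w) - f (p + s *\<^sub>R v) + f p =
        s * s * F w v (p + a' *\<^sub>R (s *\<^sub>R w) + b' *\<^sub>R (s *\<^sub>R v))"
      using second_difference_mvt[OF f, of p "s *\<^sub>R w" "s *\<^sub>R v"]
      unfolding F_fold scale by blast
    have "s * s * F v w (p + a *\<^sub>R (s *\<^sub>R v) + b *\<^sub>R (s *\<^sub>R w)) =
        s * s * F w v (p + a' *\<^sub>R (s *\<^sub>R w) + b' *\<^sub>R (s *\<^sub>R v))"
      using ab(3) ab'(3) by (simp add: algebra_simps)
    then have "F v w (p + a *\<^sub>R (s *\<^sub>R v) + b *\<^sub>R (s *\<^sub>R w)) =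
        F w v (p + a' *\<^sub>R (s *\<^sub>R w) + b' *\<^sub>R (s *\<^sub>R v))"
      using s by simp
    moreover have "dist (F v w (p + a *\<^sub>R (s *\<^sub>R v) + b *\<^sub>R (s *\<^sub>R w))) (F v w p) < e / 2"
      using near[OF ab(1,2), of v w] by (intro d1) (simp add: N_def)
    moreover have "dist (F w v (p + a' *\<^sub>R (s *\<^sub>R w) + b' *\<^sub>R (s *\<^sub>R v))) (F w v p) < e / 2"
      using near[OF ab'(1,2), of w v] by (intro d2) (simp add: N_def)
    ultimately show ?thesis unfolding dist_real_def by linarith
  qed
  have "\<bar>F v w p - F w v p\<bar> \<le> 0"
  proof (rule field_le_epsilon)
    show "\<bar>F v w p - F w v p\<bar> \<le> 0 + e" if "e > 0" for e
      using le[OF that] by simp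
  qed
  then show ?thesis by (simp add: F_def)
qed

lemma frechet_derivative_linear_comp:
  assumes "bounded_linear L" "smooth f"
  shows "frechet_derivative (\<lambda>x. L (f x)) (at p) = (\<lambda>h. L (frechet_derivative f (at p) h))"
  using frechet_derivative_at[OF bounded_linear.has_derivative[OF assms(1) smooth_has_derivative[OF assms(2)]]]
  by simp

lemma second_derivative_symmetric:
  fixes f :: "'a::real_normed_vector \<Rightarrow> 'b::euclidean_space"
  assumes f: "smooth f"
  shows "frechet_derivative (\<lambda>x. frechet_derivative f (at x) v) (at p) w =
    frechet_derivative (\<lambda>x. frechet_derivative f (at x) w) (at p) v"
proof (rule euclidean_eqI)
  fix b :: 'b assume "b \<in> Basis"
  note bl = bounded_linear_inner_left[of b]
  have "frechet_derivative (\<lambda>x. frechet_derivative f (at x) v) (at p) w \<bullet> b =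
    frechet_derivative (\<lambda>x. frechet_derivative (\<lambda>x. f x \<bullet> b) (at x) v) (at p) w" for v w
    by (simp add: frechet_derivative_linear_comp[OF bl] f smooth_frechet_derivative)
  then show "frechet_derivative (\<lambda>x. frechet_derivative f (at x) v) (at p) w \<bullet> b =
    frechet_derivative (\<lambda>x. frechet_derivative f (at x) w) (at p) v \<bullet> b"
    using second_derivative_symmetric_real[OF smooth_inner[OF f smooth_const]] by metis
qed

text \<open>The point enters through the derivative of f and through its argument V, so this is a
  product rule. Expanding V in the basis reduces it to derivatives of f in fixed directions, the
  ones that \<open>smooth\<close> controls.\<close>

lemma frechet_derivative_deriv_along:
  fixes V :: "'a::euclidean_space vfield"
  assumes V: "smooth V" and f: "smooth f"
  shows "frechet_derivative (deriv_along V f) (at p) h =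
    frechet_derivative (\<lambda>x. frechet_derivative f (at x) (V p)) (at p) h +
    frechet_derivative f (at p) (frechet_derivative V (at p) h)"
proof -
  have lin: "linear (frechet_derivative f (at x))" for x
    by (rule linear_frechet_derivative_smooth[OF f])
  have sum: "frechet_derivative f (at x) y = (\<Sum>b\<in>Basis. (y \<bullet> b) *\<^sub>R frechet_derivative f (at x) b)" for x y
    
    by (subst euclidean_representation[of y, symmetric], subst linear_sum[OF lin])
      (simp only: linear_scale[OF lin])
  have fd: "frechet_derivative (\<lambda>x. frechet_derivative f (at x) y) (at p) h =
      (\<Sum>b\<in>Basis. (y \<bullet> b) *\<^sub>R frechet_derivative (\<lambda>x. frechet_derivative f (at x) b) (at p) h)" for y
  proof -
    have *: "((\<lambda>x. \<Sum>b\<in>Basis. (y \<bullet> b) *\<^sub>R frechet_derivative f (at x) b) has_derivative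
      (\<lambda>h. \<Sum>b\<in>Basis. (y \<bullet> b) *\<^sub>R frechet_derivative (\<lambda>x. frechet_derivative f (at x) b) (at p) h)) (at p)"
      by (intro has_derivative_sum has_derivative_scaleR_right smooth_has_derivative
          smooth_frechet_derivative f)
    moreover have "(\<lambda>x. \<Sum>b\<in>Basis. (y \<bullet> b) *\<^sub>R frechet_derivative f (at x) b) =
        (\<lambda>x. frechet_derivative f (at x) y)"
      by (rule ext) (rule sum[symmetric])
    ultimately have "frechet_derivative (\<lambda>x. frechet_derivative f (at x) y) (at p) =
        (\<lambda>h. \<Sum>b\<in>Basis. (y \<bullet> b) *\<^sub>R frechet_derivative (\<lambda>x. frechet_derivative f (at x) b) (at p) h)"
      using frechet_derivative_at[OF *] by simp
    then show ?thesis by simp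
  qed
  have *: "((\<lambda>x. \<Sum>b\<in>Basis. (V x \<bullet> b) *\<^sub>R frechet_derivative f (at x) b) has_derivative
     (\<lambda>h. \<Sum>b\<in>Basis. (V p \<bullet> b) *\<^sub>R frechet_derivative (\<lambda>x. frechet_derivative f (at x) b) (at p) h +
        (frechet_derivative V (at p) h \<bullet> b) *\<^sub>R frechet_derivative f (at p) b)) (at p)"
    by (intro has_derivative_sum has_derivative_scaleR smooth_has_derivative
        smooth_frechet_derivative f has_derivative_inner_left V)
  moreover have "deriv_along V f = (\<lambda>x. \<Sum>b\<in>Basis. (V x \<bullet> b) *\<^sub>R frechet_derivative f (at x) b)"
    unfolding deriv_along_def by (rule ext) (rule sum)
  ultimately have "frechet_derivative (deriv_along V f) (at p) h =
      (\<Sum>b\<in>Basis. (V p \<bullet> b) *\<^sub>R frechet_derivative (\<lambda>x. frechet_derivative f (at x) b) (at p) h +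
        (frechet_derivative V (at p) h \<bullet> b) *\<^sub>R frechet_derivative f (at p) b)"
    using fun_cong[OF frechet_derivative_at[OF *], of h] by simp
  also have "\<dots> = frechet_derivative (\<lambda>x. frechet_derivative f (at x) (V p)) (at p) h +
      frechet_derivative f (at p) (frechet_derivative V (at p) h)"
    by (subst fd, subst (3) sum) (simp only: sum.distrib)
  finally show ?thesis .
qed

text \<open>The two second order terms cancel by symmetry. What remains is the derivative of f in
  the direction of the commutator of V and W.\<close>

lemma deriv_along_commute:
  fixes V W :: "'a::euclidean_space vfield" and f :: "'a \<Rightarrow> 'b::euclidean_space"
  assumes "smooth V" "smooth W" "smooth f"
  shows "deriv_along V (deriv_along W f) p - deriv_along W (deriv_along V f) p =
    deriv_along (lie_bracket V W) f p"
proof -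
  have "deriv_along V (deriv_along W f) p =
      frechet_derivative (\<lambda>x. frechet_derivative f (at x) (W p)) (at p) (V p) +
      frechet_derivative f (at p) (deriv_along V W p)" if "smooth V" "smooth W" for V W
    unfolding deriv_along_def[of V] using frechet_derivative_deriv_along[OF that(2) assms(3)] by simp
  then show ?thesis
    using assms second_derivative_symmetric[OF assms(3), of "W p" p "V p"]
    by (simp add: deriv_along_def lie_bracket_def
        linear_diff[OF linear_frechet_derivative_smooth[OF assms(3)]])
qed

section \<open>The Levi-Civita connection of a left invariant metric\<close>

text \<open>The difference of two such connections, paired with Z, is symmetric in its first two
  fields (no torsion) and skew in the last two (metric). Alternating these swaps six times returns
  to the start with the opposite sign.\<close>

lemma levi_civita_unique:
  fixes g :: "'a::euclidean_space metric"
  assumes g: "\<And>p. bilinear (g p)" "\<And>p u v. g p u v = g p v u" "\<And>p u. g p u u = 0 \<Longrightarrow> u = 0"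
    and D: "is_levi_civita g D" "is_levi_civita g D'" and XY: "smooth X" "smooth Y"
  shows "D X Y p = D' X Y p"
proof -
  define t where "t X Y Z = g p (D X Y p - D' X Y p) (Z p)" for X Y Z
  have anti: "t X Y Z = - t X Z Y" if "smooth X" "smooth Y" "smooth Z" for X Y Z
  proof -
    have "deriv_along X (\<lambda>q. g q (Y q) (Z q)) p = g p (D X Y p) (Z p) + g p (Y p) (D X Z p)"
      if "is_levi_civita g D" for D
      using that \<open>smooth X\<close> \<open>smooth Y\<close> \<open>smooth Z\<close> unfolding is_levi_civita_def by blast
    from this[OF D(1)] this[OF D(2)] show ?thesis
      unfolding t_def bilinear_lsub[OF g(1)] using g(2)[of p "Y p"] by simp
  qed
  have sym: "t X Y Z = t Y X Z" if "smooth X" "smooth Y" for X Y Z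
  proof -
    have "D X Y p - D Y X p = lie_bracket X Y p" if "is_levi_civita g D" for D
      using that \<open>smooth X\<close> \<open>smooth Y\<close> unfolding is_levi_civita_def by blast
    from this[OF D(1)] this[OF D(2)] have "D X Y p - D' X Y p = D Y X p - D' Y X p" by (simp add: algebra_simps)
    then show ?thesis by (simp only: t_def)
  qed
  \<comment> \<open>The constant field equal to the difference at p, so that t X Y Z is the squared
    length of that difference.\<close>
  define Z where "Z = (\<lambda>q :: 'a. D X Y p - D' X Y p)"
  have Z: "smooth Z" by (simp add: Z_def smooth_const)
  have "t X Y Z = - t X Z Y" "t X Z Y = t Z X Y" "t Z X Y = - t Z Y X"
    "t Z Y X = t Y Z X" "t Y Z X = - t Y X Z" "t Y X Z = t X Y Z"
    by (intro anti sym XY Z)+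
  then have "t X Y Z = 0" by linarith
  then show ?thesis using g(3)[of p "D X Y p - D' X Y p"] by (simp add: t_def Z_def)
qed

text \<open>All metrics of the theorem are block diagonal: e_2 is orthogonal to the plane of e_0,
  e_1 and has squared length \<nu>. Only the plane block \<open>Q\<close> varies in shape.\<close>

locale sd_space =
  fixes A Q :: "real^2^2" and \<nu> :: real
  assumes Q_sym: "u \<bullet> (Q *v w) = w \<bullet> (Q *v u)"
    and Q_pos: "u \<noteq> 0 \<Longrightarrow> 0 < u \<bullet> (Q *v u)"
    and nu_pos: "0 < \<nu>"
begin

definition q where "q u w = u \<bullet> (Q *v w)"

definition B :: "real^2^2" where "B = matrix_inv Q ** transpose A ** Q"

definition S :: "real^2^2" where "S = (1/2) *\<^sub>R (A + B)"

definition E where "E t = mexp (t *\<^sub>R A)"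

text \<open>Coordinates of a horizontal vector at p in the left invariant frame, obtained by
  translating it back to the identity.\<close>

definition pull where "pull p v = E (- snd p) *v v" for p :: pt

definition g :: "pt metric" where
  "g p u v = q (pull p (fst u)) (pull p (fst v)) + \<nu> * (snd u * snd v)"

text \<open>The Christoffel symbols in the global chart. The coefficients depend on the height t
  only, with derivative -2 q(S ., .) after \<open>pull\<close>. Hence -S for the mixed indices and
  q(S ., .) / \<nu> for the vertical part of two horizontal vectors.\<close>

definition christoffel :: "pt \<Rightarrow> pt \<Rightarrow> pt \<Rightarrow> pt" where
  "christoffel p x y =
    (- (E (snd p) *v (S *v pull p (snd x *\<^sub>R fst y + snd y *\<^sub>R fst x))),
     (1 / \<nu>) * q (S *v pull p (fst x)) (pull p (fst y)))"

section \<open>The inner product \<open>q\<close>, the adjoint of \<open>A\<close> and its symmetric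
  part\<close>

lemma bounded_bilinear_q: "bounded_bilinear q"
proof -
  have "linear (q u)" "linear (\<lambda>u. q u w)" for u w
    by (rule linearI; simp add: q_def algebra_simps)+
  then show ?thesis
    unfolding bilinear_conv_bounded_bilinear[symmetric] bilinear_def by blast
qed

sublocale q: bounded_bilinear q by (rule bounded_bilinear_q)

lemma q_sym: "q u w = q w u"
  unfolding q_def by (rule Q_sym)

lemma q_pos: "u \<noteq> 0 \<Longrightarrow> 0 < q u u"
  unfolding q_def by (rule Q_pos)

lemma q_eq_0: "q u u = 0 \<longleftrightarrow> u = 0"
  using q_pos[of u] q.zero_left by fastforce

lemma q_eqI: assumes "\<And>w. q u w = q v w" shows "u = v"
  using assms[of "u - v"] q_eq_0[of "u - v"] by (simp add: q.diff_left)

lemma Q_inv: "Q ** matrix_inv Q = mat 1" "matrix_inv Q ** Q = mat 1"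
proof -
  have "inj ((*v) Q)"
  proof (rule injI)
    fix x y assume "Q *v x = Q *v y"
    then have "(x - y) \<bullet> (Q *v (x - y)) = 0" by (simp add: matrix_vector_mult_diff_distrib)
    then show "x = y" using Q_pos[of "x - y"] by force
  qed
  then have "\<exists>R. Q ** R = mat 1 \<and> R ** Q = mat 1"
    using matrix_left_invertible_injective[of Q] matrix_left_right_inverse by blast
  from someI_ex[OF this] show "Q ** matrix_inv Q = mat 1" "matrix_inv Q ** Q = mat 1"
    unfolding matrix_inv_def by auto
qed

lemma q_B: "q (B *v u) w = q u (A *v w)"
proof -
  have "q (B *v u) w = (Q *v (B *v u)) \<bullet> w"
    using Q_sym[of "B *v u" w] by (simp add: q_def inner_commute)
  also have "Q *v (B *v u) = transpose A *v (Q *v u)"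
    unfolding B_def matrix_vector_mul_assoc matrix_mul_assoc Q_inv by simp
  also have "\<dots> \<bullet> w = (Q *v u) \<bullet> (A *v w)"
    using dot_lmul_matrix[of "Q *v u" A w] by simp
  finally show ?thesis using Q_sym[of u "A *v w"] by (simp add: q_def inner_commute)
qed

lemma trace_B: "trace B = trace A"
proof -
  have "trace B = trace (matrix_inv Q ** (transpose A ** Q))"
    by (simp add: B_def matrix_mul_assoc)
  also have "\<dots> = trace (transpose A)"
    by (subst trace_mul_sym) (simp add: matrix_mul_assoc[symmetric] Q_inv)
  also have "\<dots> = trace A"
    by (simp add: trace_def transpose_def)
  finally show ?thesis .
qed

lemma S_mult: "S *v u = (1/2) *\<^sub>R (A *v u + B *v u)"
  by (simp add: S_def scaleR_matrix_vector_assoc[symmetric] matrix_vector_mult_add_rdistrib)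

lemma q_S: "2 * q (S *v u) w = q (A *v u) w + q u (A *v w)"
  by (simp add: S_mult q.scaleR_left q.add_left q_B)

lemma q_S_sym: "q (S *v u) w = q (S *v w) u"
  using q_S[of u w] q_S[of w u] q_sym[of "A *v u"] q_sym[of "A *v w"] by simp

section \<open>The one-parameter group of \<open>A\<close> and the coordinate form of the
  metric\<close>

lemma E_inv [simp]: "E (- t) *v (E t *v u) = u" "E t *v (E (- t) *v u) = u"
  using mexp_inverse[of t A] by (simp_all add: E_def matrix_vector_mul_assoc)

lemma E_commute: "E t *v (A *v u) = A *v (E t *v u)"
  using mexp_commute[of A t] by (simp add: E_def matrix_vector_mul_assoc)

lemma E_0 [simp]: "E 0 = mat 1"
  by (simp add: E_def)

lemma pull_E [simp]: "pull p (E (snd p) *v u) = u" "E (snd p) *v pull p u = u"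
  by (simp_all add: pull_def)

lemma pull_A: "pull p (A *v u) = A *v pull p u"
  by (simp add: pull_def E_commute)

lemma pull_simps:
  "pull p (u + v) = pull p u + pull p v" "pull p (u - v) = pull p u - pull p v"
  "pull p (- u) = - pull p u" "pull p (c *\<^sub>R u) = c *\<^sub>R pull p u" "pull p 0 = 0"
  by (simp_all add: pull_def matrix_vector_right_distrib matrix_vector_mult_diff_distrib
      bounded_bilinear.scaleR_right[OF bounded_bilinear_mv]
      bounded_bilinear.minus_right[OF bounded_bilinear_mv])

lemma pull_eq_0: "pull p u = 0 \<longleftrightarrow> u = 0"
  by (metis pull_E(2) pull_simps(5) matrix_vector_mult_0_right)

lemma sd_field_E: "sd_field A v p = (E (snd p) *v fst v, snd v)"
  by (simp add: sd_field_eq E_def)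

lemma sd_field_pull: "sd_field A (pull p (fst v), snd v) p = v"
  by (simp add: sd_field_E)

lemma E_has_derivative:
  "((\<lambda>t. E t *v u) has_derivative (\<lambda>h. h *\<^sub>R (A *v (E t *v u)))) (at t)"
proof -
  have "((\<lambda>t. E t) has_derivative (\<lambda>h. h *\<^sub>R (A ** E t))) (at t)"
    using mexp_has_vector_derivative[of A t] by (simp add: has_vector_derivative_def E_def)
  from bounded_linear.has_derivative[OF bounded_bilinear.bounded_linear_left[OF bounded_bilinear_mv] this]
  show ?thesis
    by (simp add: bounded_bilinear.scaleR_left[OF bounded_bilinear_mv] matrix_vector_mul_assoc)
qed

lemma smooth_E: "smooth E"
  unfolding E_def[abs_def] by (simp add: smooth_def times_cont_diff_mexp)

lemma smooth_pull: "smooth f \<Longrightarrow> smooth (\<lambda>p. pull p (f p))"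
  unfolding pull_def
  by (intro smooth_matrix_vector_mult smooth_comp_linear[OF smooth_E]
      bounded_linear_minus bounded_linear_snd)

lemma smooth_q: "smooth f \<Longrightarrow> smooth h \<Longrightarrow> smooth (\<lambda>p. q (f p) (h p))"
  by (rule smooth_bilinear[OF bounded_bilinear_q])

lemma smooth_E_snd: "smooth f \<Longrightarrow> smooth (\<lambda>p::pt. E (snd p) *v f p)"
  by (intro smooth_matrix_vector_mult smooth_comp_linear[OF smooth_E] bounded_linear_snd)

lemma pull_has_derivative:
  assumes "(f has_derivative f') (at p)"
  shows "((\<lambda>p. pull p (f p)) has_derivative
    (\<lambda>h. pull p (f' h) - snd h *\<^sub>R (A *v pull p (f p)))) (at p)"
proof -
  have "((\<lambda>t. E t) has_derivative (\<lambda>h. h *\<^sub>R (A ** E (- snd p)))) (at (- snd p))"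
    using mexp_has_vector_derivative[of A "- snd p"] by (simp add: has_vector_derivative_def E_def)
  moreover have "((\<lambda>p::pt. - snd p) has_derivative (\<lambda>h. - snd h)) (at p)"
    by (auto intro!: derivative_eq_intros)
  ultimately have "((\<lambda>p::pt. E (- snd p)) has_derivative (\<lambda>h. (- snd h) *\<^sub>R (A ** E (- snd p)))) (at p)"
    by (rule has_derivative_compose[rotated])
  from bounded_bilinear.FDERIV[OF bounded_bilinear_mv this assms]
  show ?thesis
    by (simp add: pull_def bounded_bilinear.scaleR_left[OF bounded_bilinear_mv]
        bounded_bilinear.minus_left[OF bounded_bilinear_mv] matrix_vector_mul_assoc)
qed

text \<open>The last term is the derivative of the coefficients of the metric. Only the symmetric
  part of \<open>A\<close> survives in it, by \<open>q_S\<close>.\<close>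

lemma g_has_derivative:
  assumes Y: "(Y has_derivative Y') (at p)" and Z: "(Z has_derivative Z') (at p)"
  shows "((\<lambda>p. g p (Y p) (Z p)) has_derivative (\<lambda>h. g p (Y' h) (Z p) + g p (Y p) (Z' h)
    - 2 * snd h * q (S *v pull p (fst (Y p))) (pull p (fst (Z p))))) (at p)"
proof -
  have fY: "((\<lambda>p. pull p (fst (Y p))) has_derivative
      (\<lambda>h. pull p (fst (Y' h)) - snd h *\<^sub>R (A *v pull p (fst (Y p))))) (at p)"
    by (intro pull_has_derivative has_derivative_fst Y)
  have fZ: "((\<lambda>p. pull p (fst (Z p))) has_derivative
      (\<lambda>h. pull p (fst (Z' h)) - snd h *\<^sub>R (A *v pull p (fst (Z p))))) (at p)"
    by (intro pull_has_derivative has_derivative_fst Z)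
  have "((\<lambda>p. \<nu> * (snd (Y p) * snd (Z p))) has_derivative
      (\<lambda>h. \<nu> * (snd (Y p) * snd (Z' h) + snd (Y' h) * snd (Z p)))) (at p)"
    by (intro has_derivative_mult_right has_derivative_mult has_derivative_snd Y Z)
  from has_derivative_add[OF bounded_bilinear.FDERIV[OF bounded_bilinear_q fY fZ] this]
  show ?thesis
    unfolding g_def
  proof (rule has_derivative_eq_rhs, intro ext, goal_cases)
    case (1 h)
    show ?case
      using arg_cong[OF q_S[of "pull p (fst (Y p))" "pull p (fst (Z p))"], of "\<lambda>x. snd h * x"]
      by (simp add: q.diff_left q.diff_right q.scaleR_left q.scaleR_right algebra_simps)
  qed
qed

lemma deriv_along_g:
  assumes "smooth Y" "smooth Z"
  shows "deriv_along X (\<lambda>p. g p (Y p) (Z p)) p = g p (deriv_along X Y p) (Z p) +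
    g p (Y p) (deriv_along X Z p) - 2 * snd (X p) * q (S *v pull p (fst (Y p))) (pull p (fst (Z p)))"
  using frechet_derivative_at[OF g_has_derivative[OF assms[THEN smooth_has_derivative]], symmetric]
  by (simp add: deriv_along_def)

lemma g_bilinear: "bilinear (g p)"
proof -
  have "linear (g p u)" "linear (\<lambda>u. g p u w)" for u w
    by (rule linearI; simp add: g_def pull_simps q.add_left q.add_right q.scaleR_left q.scaleR_right
        algebra_simps)+
  then show ?thesis by (simp add: bilinear_def)
qed

lemma g_sym: "g p u v = g p v u"
  by (simp add: g_def q_sym[of "pull p (fst u)"])

lemma g_nondegenerate: assumes "g p u u = 0" shows "u = 0"
proof -
  have "0 \<le> q (pull p (fst u)) (pull p (fst u))" "0 \<le> \<nu> * (snd u * snd u)"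
    using q_pos[of "pull p (fst u)"] q_eq_0[of "pull p (fst u)"] nu_pos
    by (cases "pull p (fst u) = 0"; simp)+
  with assms have "q (pull p (fst u)) (pull p (fst u)) = 0" "\<nu> * (snd u * snd u) = 0"
    unfolding g_def by linarith+
  then show ?thesis
    using nu_pos by (simp add: q_eq_0 pull_eq_0 prod_eq_iff)
qed

section \<open>The explicit Levi-Civita connection\<close>

definition connection :: "pt vfield \<Rightarrow> pt vfield \<Rightarrow> pt vfield" where
  "connection X Y p = deriv_along X Y p + christoffel p (X p) (Y p)"

lemma christoffel_bilinear:
  "christoffel p (x + x') y = christoffel p x y + christoffel p x' y"
  "christoffel p x (y + y') = christoffel p x y + christoffel p x y'"
  "christoffel p (c *\<^sub>R x) y = c *\<^sub>R christoffel p x y"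
  "christoffel p x (c *\<^sub>R y) = c *\<^sub>R christoffel p x y"
  by (simp_all add: christoffel_def pull_simps q.add_left q.add_right q.scaleR_left q.scaleR_right
      matrix_vector_right_distrib bounded_bilinear.scaleR_right[OF bounded_bilinear_mv]
      algebra_simps)

lemma christoffel_sym: "christoffel p x y = christoffel p y x"
  by (simp add: christoffel_def add.commute q_S_sym)

text \<open>This cancels exactly the coefficient term of \<open>deriv_along_g\<close>, hence the
  connection is metric.\<close>

lemma christoffel_metric:
  "g p (christoffel p x y) z + g p y (christoffel p x z) =
    - 2 * snd x * q (S *v pull p (fst y)) (pull p (fst z))"
proof -
  define u w z' where "u = pull p (fst x)" "w = pull p (fst y)" "z' = pull p (fst z)"
  have 1: "\<nu> * ((1 / \<nu>) * c * d) = c * d" "\<nu> * (d * ((1 / \<nu>) * c)) = c * d" for c d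
    using nu_pos by simp_all
  have "g p (christoffel p x y) z =
      - (snd x * q (S *v w) z' + snd y * q (S *v u) z') + q (S *v u) w * snd z"
    using 1 unfolding g_def christoffel_def
    by (simp add: pull_simps u_w_z'_def matrix_vector_right_distrib q.add_left q.scaleR_left
        q.minus_left q.diff_left bounded_bilinear.scaleR_right[OF bounded_bilinear_mv])
  moreover have "g p y (christoffel p x z) =
      - (snd x * q (S *v z') w + snd z * q (S *v u) w) + q (S *v u) z' * snd y"
    using 1 unfolding g_def christoffel_def
    by (simp add: pull_simps u_w_z'_def matrix_vector_right_distrib q.add_left q.scaleR_left
        q.minus_left q.diff_left bounded_bilinear.scaleR_right[OF bounded_bilinear_mv] q_sym[of "pull p (fst y)"]
        q.minus_right q.diff_right)
  ultimately show ?thesis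
    using q_S_sym[of w z'] by (simp add: u_w_z'_def[symmetric] algebra_simps)
qed

lemma is_levi_civita_connection: "is_levi_civita g connection"
  unfolding is_levi_civita_def affine_connection_def
proof (intro conjI allI impI)
  fix X Y :: "pt vfield" assume X: "smooth X" and Y: "smooth Y"
  have "smooth (\<lambda>p. deriv_along X Y p + christoffel p (X p) (Y p))"
    unfolding christoffel_def
    by (intro smooth_intros smooth_deriv_along smooth_q smooth_E_snd smooth_pull X Y)
  then show "smooth (connection X Y)"
    by (simp add: connection_def[abs_def])
next
  fix X X' Y :: "pt vfield" and p assume "smooth X" "smooth X'" "smooth Y"
  then show "connection (\<lambda>q. X q + X' q) Y p = connection X Y p + connection X' Y p"
    by (simp add: connection_def deriv_along_def christoffel_bilinear
        linear_add[OF linear_frechet_derivative_smooth])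
next
  fix X Y Y' :: "pt vfield" and p assume *: "smooth X" "smooth Y" "smooth Y'"
  then have "deriv_along X (\<lambda>q. Y q + Y' q) p = deriv_along X Y p + deriv_along X Y' p"
    using frechet_derivative_at[OF has_derivative_add[OF *(2,3)[THEN smooth_has_derivative]], symmetric]
    by (simp add: deriv_along_def)
  then show "connection X (\<lambda>q. Y q + Y' q) p = connection X Y p + connection X Y' p"
    by (simp add: connection_def christoffel_bilinear)
next
  fix f :: "pt \<Rightarrow> real" and X Y :: "pt vfield" and p
  assume *: "smooth f" "smooth X" "smooth Y"
  then show "connection (\<lambda>q. f q *\<^sub>R X q) Y p = f p *\<^sub>R connection X Y p"
    by (simp add: connection_def deriv_along_def christoffel_bilinear scaleR_add_right
        linear_scale[OF linear_frechet_derivative_smooth])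
  have "deriv_along X (\<lambda>q. f q *\<^sub>R Y q) p = deriv_along X f p *\<^sub>R Y p + f p *\<^sub>R deriv_along X Y p"
    using frechet_derivative_at[OF has_derivative_scaleR[OF *(1,3)[THEN smooth_has_derivative]], symmetric]
    by (simp add: deriv_along_def)
  then show "connection X (\<lambda>q. f q *\<^sub>R Y q) p = deriv_along X f p *\<^sub>R Y p + f p *\<^sub>R connection X Y p"
    by (simp add: connection_def christoffel_bilinear scaleR_add_right)
next
  fix X Y :: "pt vfield" and p
  show "connection X Y p - connection Y X p = lie_bracket X Y p"
    by (simp add: connection_def lie_bracket_def christoffel_sym[of p "X p"])
next
  fix X Y Z :: "pt vfield" and p assume *: "smooth X" "smooth Y" "smooth Z"
  show "deriv_along X (\<lambda>q. g q (Y q) (Z q)) p =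
      g p (connection X Y p) (Z p) + g p (Y p) (connection X Z p)"
    unfolding deriv_along_g[OF *(2,3)] connection_def bilinear_ladd[OF g_bilinear]
      bilinear_radd[OF g_bilinear]
    using christoffel_metric[of p "X p" "Y p" "Z p"] by simp
qed

text \<open>The choice in \<open>levi_civita\<close> is governed by the axioms because
  \<open>connection\<close> satisfies them, and uniqueness then identifies the two on smooth
  fields.\<close>

lemma levi_civita_eq:
  assumes "smooth X" "smooth Y"
  shows "levi_civita g X Y p = connection X Y p"
proof -
  have "is_levi_civita g (levi_civita g)"
    unfolding levi_civita_def 
    by (rule someI[where P = "is_levi_civita g", OF is_levi_civita_connection])
  then show ?thesis
    by (intro levi_civita_unique[OF g_bilinear g_sym g_nondegenerate _ is_levi_civita_connection assms])
qed

text \<open>The derivatives of Y and Z cancel against parts of the brackets. The remaining condition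
  depends only on the values of Y and Z at p, so constant fields suffice to test it.\<close>

lemma killing_field_iff:
  "killing_field g X \<longleftrightarrow> smooth X \<and> (\<forall>p u w.
    g p (frechet_derivative X (at p) u) w + g p u (frechet_derivative X (at p) w) =
      2 * snd (X p) * q (S *v pull p (fst u)) (pull p (fst w)))"
proof (cases "smooth X")
  case True
  have "deriv_along X (\<lambda>q. g q (Y q) (Z q)) p =
      g p (lie_bracket X Y p) (Z p) + g p (Y p) (lie_bracket X Z p) \<longleftrightarrow>
    g p (frechet_derivative X (at p) (Y p)) (Z p) + g p (Y p) (frechet_derivative X (at p) (Z p)) =
      2 * snd (X p) * q (S *v pull p (fst (Y p))) (pull p (fst (Z p)))"
    if "smooth Y" "smooth Z" for Y Z p
    unfolding deriv_along_g[OF that] lie_bracket_def bilinear_lsub[OF g_bilinear]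
      bilinear_rsub[OF g_bilinear]
    by (auto simp: deriv_along_def[of Y] deriv_along_def[of Z])
  then have "killing_field g X \<longleftrightarrow> (\<forall>Y Z p. smooth Y \<longrightarrow> smooth Z \<longrightarrow>
    g p (frechet_derivative X (at p) (Y p)) (Z p) + g p (Y p) (frechet_derivative X (at p) (Z p)) =
      2 * snd (X p) * q (S *v pull p (fst (Y p))) (pull p (fst (Z p))))"
    using True unfolding killing_field_def by blast
  also have "\<dots> \<longleftrightarrow> (\<forall>p u w.
    g p (frechet_derivative X (at p) u) w + g p u (frechet_derivative X (at p) w) =
      2 * snd (X p) * q (S *v pull p (fst u)) (pull p (fst w)))"
    using smooth_const by metis
  finally show ?thesis using True by simp
qed (simp add: killing_field_def)

lemma distribution_of_symmetry_iff:
  "v \<in> distribution_of_symmetry g p \<longleftrightarrow> (\<exists>X. killing_field g X \<and> X p = v \<and>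
    (\<forall>u. frechet_derivative X (at p) u + christoffel p u v = 0))"
proof -
  have "(\<forall>Y. smooth Y \<longrightarrow> levi_civita g Y X p = 0) \<longleftrightarrow>
    (\<forall>u. frechet_derivative X (at p) u + christoffel p u (X p) = 0)" if "smooth X" for X
  proof -
    have "(\<forall>Y. smooth Y \<longrightarrow> levi_civita g Y X p = 0) \<longleftrightarrow>
      (\<forall>Y. smooth Y \<longrightarrow> frechet_derivative X (at p) (Y p) + christoffel p (Y p) (X p) = 0)"
      using levi_civita_eq[OF _ that] by (auto simp: connection_def deriv_along_def)
    then show ?thesis using smooth_const by metis
  qed
  then show ?thesis
    unfolding distribution_of_symmetry_def killing_field_def by blast
qed

end

section \<open>Killing fields which are parallel at a point\<close>

lemma smooth_exp: "smooth (exp :: real \<Rightarrow> real)"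
proof -
  have "times_cont_diff k (exp :: real \<Rightarrow> real)" for k
  proof (induction k)
    case 0
    then show ?case by (simp add: continuous_on_exp)
  next
    case (Suc k)
    have "(exp has_derivative (\<lambda>h. exp x * h)) (at x)" for x :: real
      using DERIV_exp[of x] by (simp add: has_field_derivative_def)
    then show ?case
      by (rule times_cont_diff_SucI)
        (rule times_cont_diff_linear_comp[OF bounded_linear_mult_left Suc])
  qed
  then show ?thesis by (simp add: smooth_def)
qed

context sd_space
begin

lemma killing_fieldI:
  assumes X: "smooth X" "\<And>p. (X has_derivative X' p) (at p)"
    and eq: "\<And>p u w. g p (X' p u) w + g p u (X' p w) =
      2 * snd (X p) * q (S *v pull p (fst u)) (pull p (fst w))"
  shows "killing_field g X"
proof -
  have "frechet_derivative X (at p) = X' p" for p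
    using frechet_derivative_at[OF X(2)] by simp
  then show ?thesis using X(1) eq by (simp add: killing_field_iff)
qed

lemma distribution_of_symmetryI:
  assumes "killing_field g X" "(X has_derivative X') (at p)" "\<And>u. X' u + christoffel p u (X p) = 0"
    "X p = v"
  shows "v \<in> distribution_of_symmetry g p"
proof -
  have "frechet_derivative X (at p) = X'"
    using frechet_derivative_at[OF assms(2)] by simp
  with assms show ?thesis unfolding distribution_of_symmetry_iff by blast
qed

lemma fst_A_has_derivative: "((\<lambda>p::pt. A *v fst p) has_derivative (\<lambda>h. A *v fst h)) (at p)"
  by (intro bounded_linear.has_derivative[OF matrix_vector_mul_bounded_linear]
      has_derivative_fst has_derivative_ident)

text \<open>Either r = 0, or \<open>S\<close> equals \<open>A\<close> and therefore commutes with
  the matrices \<open>E t\<close>, which \<open>S\<close> does not do in general.\<close>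

lemma S_pull_r:
  assumes "\<And>u. r *\<^sub>R (A *v u) = r *\<^sub>R (S *v u)"
  shows "r *\<^sub>R (E (snd p) *v (S *v pull p u)) = r *\<^sub>R (A *v u)"
proof -
  have "r *\<^sub>R (E (snd p) *v (S *v pull p u)) = E (snd p) *v (r *\<^sub>R (S *v pull p u))"
    by (simp add: bounded_bilinear.scaleR_right[OF bounded_bilinear_mv])
  also have "\<dots> = r *\<^sub>R (A *v u)"
    by (simp add: assms[symmetric] bounded_bilinear.scaleR_right[OF bounded_bilinear_mv] E_commute)
  finally show ?thesis .
qed

lemmas mv_simps = matrix_vector_right_distrib matrix_vector_mult_diff_distrib
  bounded_bilinear.scaleR_right[OF bounded_bilinear_mv]
  bounded_bilinear.minus_right[OF bounded_bilinear_mv]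

text \<open>Here \<open>X\<close> is the right invariant field which agrees at \<open>p\<close> with the left invariant one.\<close>

lemma right_invariant_mem_distribution_of_symmetry:
  assumes Sw: "S *v w = 0" and r: "\<And>u. r *\<^sub>R (A *v u) = r *\<^sub>R (S *v u)"
  shows "sd_field A (w, r) p \<in> distribution_of_symmetry g p"
proof -
  \<comment> \<open>A right invariant field has horizontal part r A x plus a constant, and vertical
    part r. The constant is adjusted to the prescribed value at p.\<close>
  define X :: "pt vfield" where
    "X = (\<lambda>y. (E (snd p) *v w - r *\<^sub>R (A *v fst p) + r *\<^sub>R (A *v fst y), r))"
  have smooth: "smooth X"
    unfolding X_def by (intro smooth_intros)
  have der: "(X has_derivative (\<lambda>h. (r *\<^sub>R (A *v fst h), 0))) (at y)" for y
  proof -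
    have "(X has_derivative (\<lambda>h. (0 + r *\<^sub>R (A *v fst h), 0))) (at y)"
      unfolding X_def
      by (intro has_derivative_Pair has_derivative_add has_derivative_const
          has_derivative_scaleR_right fst_A_has_derivative)
    then show ?thesis by simp
  qed
  have "killing_field g X"
  proof (rule killing_fieldI[OF smooth der], goal_cases)
    case (1 y u v)
    show ?case
      using arg_cong[OF q_S[of "pull y (fst u)" "pull y (fst v)"], of "\<lambda>x. r * x"]
      by (simp add: g_def X_def pull_simps pull_A q.scaleR_left q.scaleR_right algebra_simps)
  qed
  moreover have "X p = sd_field A (w, r) p"
    by (simp add: X_def sd_field_E)
  \<comment> \<open>Horizontally this is r A - r S = 0. Vertically it is q(S u, w) = q(S w, u) =
    0.\<close>
  moreover have "(r *\<^sub>R (A *v fst u), 0) + christoffel p u (sd_field A (w, r) p) = 0" for u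
  proof -
    have "q (S *v pull p (fst u)) w = 0"
      using q_S_sym[of "pull p (fst u)" w] Sw by (simp add: q.zero_left)
    then show ?thesis
      using S_pull_r[OF r, of p "fst u"]
      by (auto simp: christoffel_def sd_field_E pull_simps mv_simps Sw zero_prod_def)
  qed
  ultimately show ?thesis
    by (intro distribution_of_symmetryI[OF _ der]) simp_all
qed

lemma exists_q_dual: "\<exists>z. \<forall>u. q z u = l \<bullet> u"
proof -
  have "q (matrix_inv Q *v l) u = l \<bullet> u" for u
    using Q_sym[of "matrix_inv Q *v l" u]
    by (simp add: q_def matrix_vector_mul_assoc Q_inv inner_commute)
  then show ?thesis by blast
qed

text \<open>Both sides solve the same linear differential equation in t, so their quotient is
  constant.\<close>

lemma E_eigen_covector:
  assumes "\<And>u. l \<bullet> (A *v u) = m * (l \<bullet> u)"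
  shows "l \<bullet> (E t *v u) = exp (m * t) * (l \<bullet> u)"
proof -
  let ?f = "\<lambda>t. exp (- (m * t)) * (l \<bullet> (E t *v u))"
  have "(?f has_derivative (\<lambda>h. 0)) (at t)" for t
  proof -
    have 1: "((\<lambda>t. exp (- (m * t))) has_derivative (\<lambda>h. - (m * h) * exp (- (m * t)))) (at t)"
      by (auto intro!: derivative_eq_intros)
    have 2: "((\<lambda>t. l \<bullet> (E t *v u)) has_derivative (\<lambda>h. l \<bullet> (h *\<^sub>R (A *v (E t *v u))))) (at t)"
      by (intro has_derivative_inner_right E_has_derivative)
    show ?thesis
      by (rule has_derivative_eq_rhs[OF has_derivative_mult[OF 1 2]])
        (simp add: fun_eq_iff assms algebra_simps)
  qed
  then obtain C where C: "\<And>t. ?f t = C"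
    using has_derivative_zero_constant[of UNIV ?f] by auto
  have "?f t = ?f 0" using C by metis
  then have "exp (m * t) * (exp (- (m * t)) * (l \<bullet> (E t *v u))) = exp (m * t) * (l \<bullet> u)"
    by simp
  then show ?thesis by (simp add: mult.assoc[symmetric] exp_add[symmetric])
qed

text \<open>The mixed Killing equation forces \<open>rho' = - \<nu> Q(t)\<^sup>-\<^sup>1 l\<close> when the vertical component is \<open>l \<bullet> x\<close>,
  where \<open>Q(t)\<close> is the Gram matrix of the coordinate fields at height \<open>t\<close>.\<close>

lemma rank_one_mem_distribution_of_symmetry:
  assumes A: "\<And>u. A *v u = (l \<bullet> u) *\<^sub>R f" and m: "m = l \<bullet> f" "m \<noteq> 0"
    and z: "\<And>u. q z u = l \<bullet> u"
    and Sw: "S *v w = k *\<^sub>R z" and r: "\<And>u. r *\<^sub>R (A *v u) = r *\<^sub>R (S *v u)"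
  shows "sd_field A (w, r) p \<in> distribution_of_symmetry g p"
proof -
  have lA: "l \<bullet> (A *v u) = m * (l \<bullet> u)" for u by (simp add: A m)
  have lE: "l \<bullet> (E t *v u) = exp (m * t) * (l \<bullet> u)" for t u by (rule E_eigen_covector[OF lA])
  \<comment> \<open>h is the slope of the vertical component along l. Its value is forced at p by
    q(S w, u) = - \<nu> times the derivative of that component, where \<open>pull\<close> rescales l
    by exp(- m t).\<close>
  define h where "h = - (k / (\<nu> * exp (m * snd p)))"
  have k: "k = - (\<nu> * h * exp (m * snd p))"
    using nu_pos by (simp add: h_def)
  \<comment> \<open>y solves (A + m) y = z, which integrates exp(m t) E t z in closed form. The
    inverse of A + m is explicit because A A = m A.\<close>
  define y where "y = (1 / m) *\<^sub>R (z - (1 / (2 * m)) *\<^sub>R (A *v z))"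
  have "A *v y + m *\<^sub>R y = z"
  proof -
    have "A *v (A *v z) = m *\<^sub>R (A *v z)" by (simp add: A m)
    then have "A *v y = (1 / m) *\<^sub>R (A *v z - (1 / 2) *\<^sub>R (A *v z))"
      using m(2) by (simp add: y_def mv_simps)
    also have "A *v z - (1 / 2) *\<^sub>R (A *v z) = (1 / 2) *\<^sub>R (A *v z)"
      using scaleR_left_diff_distrib[of 1 "1 / 2" "A *v z"] by simp
    finally have "A *v y = (1 / (2 * m)) *\<^sub>R (A *v z)" by simp
    moreover have "m *\<^sub>R y = z - (1 / (2 * m)) *\<^sub>R (A *v z)"
      using m(2) by (simp add: y_def)
    ultimately show ?thesis by simp
  qed
  then have y: "E t *v (A *v y) + m *\<^sub>R (E t *v y) = E t *v z" for t
    by (metis matrix_vector_right_distrib bounded_bilinear.scaleR_right[OF bounded_bilinear_mv])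
  define rho where "rho = (\<lambda>t. - (\<nu> * exp (m * t)) *\<^sub>R (E t *v y))"
  have rho: "(rho has_derivative (\<lambda>d. d *\<^sub>R (- (\<nu> * exp (m * t)) *\<^sub>R (E t *v z)))) (at t)" for t
  proof -
    have 1: "((\<lambda>t. - (\<nu> * exp (m * t))) has_derivative (\<lambda>d. - (\<nu> * (m * d * exp (m * t))))) (at t)"
      by (auto intro!: derivative_eq_intros)
    show ?thesis
      unfolding rho_def
      by (rule has_derivative_eq_rhs[OF has_derivative_scaleR[OF 1 E_has_derivative]])
        (simp add: fun_eq_iff y[symmetric] E_commute algebra_simps)
  qed
  have smooth_rho: "smooth (\<lambda>p::pt. rho (snd p))"
    unfolding rho_def
    by (intro smooth_intros smooth_E_snd smooth_comp_linear[OF smooth_exp, of "\<lambda>p. m * snd p"]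
        bounded_linear_const_mult bounded_linear_snd)
  define b where "b = r - h * (l \<bullet> fst p)"
  \<comment> \<open>The horizontal part must have horizontal derivative tau A with tau = b + h (l .
    x). The quadratic term is a primitive of (l . x) A, available because A u = (l . u) f.\<close>
  define X0 where "X0 = (\<lambda>y::pt. b *\<^sub>R (A *v fst y) +
      h *\<^sub>R (((1 / 2) * ((l \<bullet> fst y) * (l \<bullet> fst y))) *\<^sub>R f + rho (snd y)))"
  define X :: "pt vfield" where
    "X = (\<lambda>y. (E (snd p) *v w - X0 p + X0 y, b + h * (l \<bullet> fst y)))"
  define X' where "X' = (\<lambda>y u. ((b + h * (l \<bullet> fst y)) *\<^sub>R (A *v fst u) +
      (h * snd u) *\<^sub>R (- (\<nu> * exp (m * snd y)) *\<^sub>R (E (snd y) *v z)), h * (l \<bullet> fst u)))"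
  have smooth: "smooth X"
    unfolding X_def X0_def
    by (intro smooth_intros smooth_rho)
  have der: "(X has_derivative X' y) (at y)" for y
  proof -
    have l: "((\<lambda>y::pt. l \<bullet> fst y) has_derivative (\<lambda>u. l \<bullet> fst u)) (at y)"
      by (intro has_derivative_inner_right has_derivative_fst has_derivative_ident)
    have rs: "((\<lambda>y::pt. rho (snd y)) has_derivative
        (\<lambda>u. snd u *\<^sub>R (- (\<nu> * exp (m * snd y)) *\<^sub>R (E (snd y) *v z)))) (at y)"
      using has_derivative_compose[OF has_derivative_snd[OF has_derivative_ident] rho] by simp
    have "(X has_derivative (\<lambda>u. (0 + (b *\<^sub>R (A *v fst u) + h *\<^sub>R
        (((1 / 2) * ((l \<bullet> fst y) * (l \<bullet> fst u) + (l \<bullet> fst u) * (l \<bullet> fst y))) *\<^sub>R f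
         + snd u *\<^sub>R (- (\<nu> * exp (m * snd y)) *\<^sub>R (E (snd y) *v z)))), 0 + h * (l \<bullet> fst u)))) (at y)"
      unfolding X_def X0_def
      by (intro has_derivative_Pair has_derivative_add has_derivative_const
          has_derivative_scaleR_right has_derivative_scaleR_left has_derivative_mult_right
          has_derivative_mult fst_A_has_derivative l rs)
    then show ?thesis
      by (rule has_derivative_eq_rhs) (simp add: X'_def fun_eq_iff A algebra_simps)
  qed
  have qz: "exp (m * snd y) * q z (pull y u) = l \<bullet> u" for u y
    using lE[of "snd y" "pull y u"] by (simp add: z)
  have qz': "exp (m * snd y) * q (pull y u) z = l \<bullet> u" for u y
    using qz[of y u] q_sym by metis
  have "killing_field g X"
  proof (rule killing_fieldI[OF smooth der], goal_cases)
    case (1 y u v)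
    define c where "c = b + h * (l \<bullet> fst y)"
    have X'c: "X' y a = (c *\<^sub>R (A *v fst a) +
      (h * snd a) *\<^sub>R (- (\<nu> * exp (m * snd y)) *\<^sub>R (E (snd y) *v z)), h * (l \<bullet> fst a))" for a
      unfolding X'_def c_def ..
    have "g y (X' y u) v = c * q (A *v pull y (fst u)) (pull y (fst v))
       - \<nu> * h * snd u * (exp (m * snd y) * q z (pull y (fst v))) + \<nu> * (h * (l \<bullet> fst u) * snd v)"
      by (simp add: g_def X'c pull_simps pull_A q.add_left q.diff_left q.minus_left
          q.scaleR_left algebra_simps)
    moreover have "g y u (X' y v) = c * q (pull y (fst u)) (A *v pull y (fst v))
       - \<nu> * h * snd v * (exp (m * snd y) * q (pull y (fst u)) z) + \<nu> * (h * (l \<bullet> fst v) * snd u)"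
      by (simp add: g_def X'c pull_simps pull_A q.add_right q.diff_right q.minus_right
          q.scaleR_right algebra_simps)
    moreover have "snd (X y) = c" by (simp add: X_def c_def)
    ultimately show ?case
      using arg_cong[OF q_S[of "pull y (fst u)" "pull y (fst v)"], of "\<lambda>x. c * x"]
      unfolding qz qz' by (simp add: algebra_simps)
  qed
  moreover have X: "X p = sd_field A (w, r) p"
    by (simp add: X_def sd_field_E b_def)
  moreover have "X' p u + christoffel p u (sd_field A (w, r) p) = 0" for u
  proof -
    have "q (S *v pull p (fst u)) w = - (\<nu> * h * (l \<bullet> fst u))"
      using q_S_sym[of "pull p (fst u)" w] qz[of p "fst u"] by (simp add: Sw k q.scaleR_left q.minus_left)
    moreover have "X' p u = (r *\<^sub>R (A *v fst u) +
        (h * snd u) *\<^sub>R (- (\<nu> * exp (m * snd p)) *\<^sub>R (E (snd p) *v z)), h * (l \<bullet> fst u))"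
      by (simp add: X'_def b_def)
    ultimately show ?thesis
      using S_pull_r[OF r, of p "fst u"] nu_pos
      by (auto simp: christoffel_def sd_field_E pull_simps mv_simps Sw k zero_prod_def algebra_simps)
  qed
  ultimately show ?thesis
    by (intro distribution_of_symmetryI[OF _ der]) simp_all
qed

text \<open>In the upper half space model of hyperbolic space, \<open>X\<close> below is a combination of a
  translation, the dilation about \<open>p\<close> and a special conformal field of the horizontal plane.\<close>

lemma umbilic_distribution_of_symmetry:
  assumes S: "\<And>u. S *v u = u"
  shows "distribution_of_symmetry g p = UNIV"
proof -
  \<comment> \<open>For S = 1 the horizontal metric at height t is exp(-2 t) q even if
    \<open>A\<close> itself is not scalar, which gives the half space model.\<close>
  have pull_q: "q (pull y u) (pull y v) = exp (- (2 * snd y)) * q u v" for y u v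
  proof -
    let ?f = "\<lambda>t. exp (- (2 * t)) * q (E t *v u) (E t *v v)"
    have "(?f has_derivative (\<lambda>h. 0)) (at t)" for t
    proof -
      have 1: "((\<lambda>t. exp (- (2 * t))) has_derivative (\<lambda>h. - (2 * h) * exp (- (2 * t)))) (at t)"
        by (auto intro!: derivative_eq_intros)
      note 2 = bounded_bilinear.FDERIV[OF bounded_bilinear_q E_has_derivative[of u] E_has_derivative[of v]]
      have "q (A *v (E t *v u)) (E t *v v) + q (E t *v u) (A *v (E t *v v)) = 2 * q (E t *v u) (E t *v v)"
        using q_S[of "E t *v u" "E t *v v"] by (simp add: S)
      then have 3: "h * (exp (- (2 * t)) * (q (A *v (E t *v u)) (E t *v v) + q (E t *v u) (A *v (E t *v v)))) =
          h * (exp (- (2 * t)) * (2 * q (E t *v u) (E t *v v)))" for h by simp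
      show ?thesis
      proof (rule has_derivative_eq_rhs[OF has_derivative_mult[OF 1 2]], intro ext, goal_cases)
        case (1 h)
        show ?case using 3[of h] by (simp add: q.scaleR_left q.scaleR_right algebra_simps)
      qed
    qed
    then obtain C where C: "\<And>t. ?f t = C"
      using has_derivative_zero_constant[of UNIV ?f] by auto
    have "?f (- snd y) = ?f 0" using C by metis
    then have "exp (- (2 * snd y)) * (exp (2 * snd y) * q (pull y u) (pull y v)) =
        exp (- (2 * snd y)) * q u v"
      by (simp add: pull_def)
    then show ?thesis by (simp add: mult.assoc[symmetric] exp_add[symmetric])
  qed
  have "v \<in> distribution_of_symmetry g p" for v
  proof -
    define w where "w = fst v"
    \<comment> \<open>Forced by the vertical part of parallelism at p: h q(w, u) must cancel the
      vertical Christoffel term.\<close>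
    define h where "h = - (exp (- (2 * snd p)) / \<nu>)"
    define c where "c = (\<lambda>y::pt. fst y - fst p)"
    \<comment> \<open>The mixed Killing equation makes the height derivative of the coefficient of w
      equal to exp(2 (t - t_p)), where t_p is the height of p. The constant 1/2 then makes the
      coefficient equal to 1 at p.\<close>
    define X :: "pt vfield" where
      "X = (\<lambda>y. (((1 + exp (2 * (snd y - snd p))) / 2) *\<^sub>R w + snd v *\<^sub>R c y +
        h *\<^sub>R (q w (c y) *\<^sub>R c y - ((1 / 2) * q (c y) (c y)) *\<^sub>R w), snd v + h * q w (c y)))"
    define X' where "X' = (\<lambda>y u. ((snd u * exp (2 * (snd y - snd p))) *\<^sub>R w + snd v *\<^sub>R fst u +
        h *\<^sub>R (q w (c y) *\<^sub>R fst u + q w (fst u) *\<^sub>R c y - q (c y) (fst u) *\<^sub>R w), h * q w (fst u)))"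
    have smooth: "smooth X"
    proof -
      have 1: "smooth (\<lambda>y::pt. exp (2 * snd y))"
        by (intro smooth_comp_linear[OF smooth_exp, of "\<lambda>p. 2 * snd p"]
          bounded_linear_const_mult bounded_linear_snd)
      have 2: "(1 + exp (2 * (snd y - snd p))) / 2 =
          1 / 2 + exp (2 * snd y) * (exp (- (2 * snd p)) / 2)" for y :: pt
        by (simp add: exp_add[symmetric] algebra_simps add_divide_distrib)
      show ?thesis
        unfolding X_def c_def 2 by (intro smooth_intros smooth_q 1)
    qed
    have der: "(X has_derivative X' y) (at y)" for y
    proof -
      have c: "(c has_derivative fst) (at y)"
        unfolding c_def by (auto intro!: derivative_eq_intros)
      have e: "((\<lambda>y::pt. (1 + exp (2 * (snd y - snd p))) / 2) has_derivative
          (\<lambda>u. snd u * exp (2 * (snd y - snd p)))) (at y)"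
        by (auto intro!: derivative_eq_intros)
      have qwc: "((\<lambda>y. q w (c y)) has_derivative (\<lambda>u. q w (fst u))) (at y)"
        by (rule bounded_linear.has_derivative[OF q.bounded_linear_right c])
      have qcc: "((\<lambda>y. q (c y) (c y)) has_derivative (\<lambda>u. q (c y) (fst u) + q (fst u) (c y))) (at y)"
        by (rule bounded_bilinear.FDERIV[OF bounded_bilinear_q c c])
      have "(X has_derivative (\<lambda>u. ((snd u * exp (2 * (snd y - snd p))) *\<^sub>R w + snd v *\<^sub>R fst u +
        h *\<^sub>R ((q w (c y) *\<^sub>R fst u + q w (fst u) *\<^sub>R c y) -
          ((1 / 2) * (q (c y) (fst u) + q (fst u) (c y))) *\<^sub>R w), 0 + h * q w (fst u)))) (at y)"
        unfolding X_def
        by (intro has_derivative_Pair has_derivative_add has_derivative_diff has_derivative_const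
          has_derivative_scaleR_right has_derivative_scaleR_left has_derivative_mult_right
          has_derivative_scaleR c e qwc qcc)
      then show ?thesis
        by (rule has_derivative_eq_rhs) (simp add: X'_def fun_eq_iff q_sym[of "fst _" "c y"])
    qed
    have ex: "exp (- (2 * snd y)) * exp (2 * (snd y - snd p)) = - (\<nu> * h)" for y :: pt
      using nu_pos by (simp add: h_def exp_add[symmetric])
    have "killing_field g X"
    proof (rule killing_fieldI[OF smooth der], goal_cases)
      case (1 y u v')
      have 1: "g y (X' y a) a' = snd (X y) * (exp (- (2 * snd y)) * q (fst a) (fst a')) +
         snd a * (exp (- (2 * snd y)) * exp (2 * (snd y - snd p))) * q w (fst a') +
         exp (- (2 * snd y)) * h * (q w (fst a) * q (c y) (fst a') - q (c y) (fst a) * q w (fst a')) +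
         \<nu> * h * q w (fst a) * snd a'" for a a'
        by (simp add: g_def X'_def X_def pull_q q.add_left q.diff_left q.scaleR_left algebra_simps)
      show ?case
        unfolding g_sym[of y u "X' y v'"] 1 ex S pull_q
        by (simp add: q_sym[of "fst v'" "fst u"] algebra_simps)
    qed
    moreover have X: "X p = v"
      by (simp add: X_def c_def w_def q.zero_right q.zero_left prod_eq_iff)
    moreover have "X' p u + christoffel p u v = 0" for u
    proof -
      have "1 / \<nu> * (exp (- (2 * snd p)) * q (fst u) w) = - (h * q w (fst u))"
        using nu_pos by (simp add: h_def q_sym[of w])
      then show ?thesis
        by (simp add: X'_def christoffel_def S c_def q.zero_right q.zero_left pull_q w_def zero_prod_def)
    qed
    ultimately show ?thesis
      by (intro distribution_of_symmetryI[OF _ der]) simp_all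
  qed
  then show ?thesis by blast
qed

end

section \<open>Constraints on Killing fields\<close>

lemma deriv_along_linear:
  "bounded_linear L \<Longrightarrow> smooth f \<Longrightarrow> deriv_along V (\<lambda>x. L (f x)) p = L (deriv_along V f p)"
  by (simp add: deriv_along_def frechet_derivative_linear_comp)

lemma deriv_along_add:
  assumes "smooth f" "smooth h"
  shows "deriv_along V (\<lambda>x. f x + h x) p = deriv_along V f p + deriv_along V h p"
  using fun_cong[OF frechet_derivative_at[OF has_derivative_add[OF assms[THEN smooth_has_derivative, of p]]], of "V p"]
  by (simp add: deriv_along_def)

lemma deriv_along_diff:
  assumes "smooth f" "smooth h"
  shows "deriv_along V (\<lambda>x. f x - h x) p = deriv_along V f p - deriv_along V h p"
  using fun_cong[OF frechet_derivative_at[OF has_derivative_diff[OF assms[THEN smooth_has_derivative, of p]]], of "V p"]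
  by (simp add: deriv_along_def)

lemma deriv_along_const: "deriv_along V (\<lambda>x. c) p = 0"
  by (simp add: deriv_along_def)

lemma vec2_expand: "u = u $ 1 *\<^sub>R axis 1 1 + u $ 2 *\<^sub>R axis 2 1" for u :: "real^2"
  by (simp add: vec_eq_iff forall_2 axis_def)

definition area :: "real^2 \<Rightarrow> real^2 \<Rightarrow> real" where
  "area u w = u $ 1 * w $ 2 - u $ 2 * w $ 1"

text \<open>With \<open>m = trace A\<close>, the hypothesis says \<open>m M + [M, A] = 0\<close> for the trace-free matrix
  \<open>M = A + B - m\<close>; multiplying by \<open>M\<close> and taking traces gives \<open>trace (M ** M) = 0\<close>.\<close>

lemma nilpotent_of_area_identity:
  fixes A B :: "real^2^2"
  assumes m: "m = trace A" "m = trace B" "m \<noteq> 0"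
    and eq: "\<And>u w. area u (B *v (A *v w)) - area (A *v u) (A *v w) +
      (area (A *v u) (B *v w) - area (A *v (A *v u)) w) = 0"
    and M: "\<And>u. M u = A *v u + B *v u - m *\<^sub>R u"
  shows "M (M u) = 0"
proof -
  define a11 a12 a21 a22 where a: "a11 = A $ 1 $ 1" "a12 = A $ 1 $ 2" "a21 = A $ 2 $ 1" "a22 = A $ 2 $ 2"
  define b11 b12 b21 b22 where b: "b11 = B $ 1 $ 1" "b12 = B $ 1 $ 2" "b21 = B $ 2 $ 1" "b22 = B $ 2 $ 2"
  have m1: "m = a11 + a22" and b22: "b22 = a11 + a22 - b11"
    using m by (simp_all add: trace_def sum_2 a b)
  define x y z where xyz: "x = b11 - a22" "y = a12 + b12" "z = a21 + b21"
  note comp = area_def matrix_vector_mult_def sum_2 axis_def a[symmetric] b[symmetric]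
  have e: "m * x = a12 * z - a21 * y" "a22 * y + a12 * x = 0" "a11 * z - a21 * x = 0"
    using eq[of "axis 1 1" "axis 1 1"] eq[of "axis 1 1" "axis 2 1"]
      eq[of "axis 2 1" "axis 1 1"] eq[of "axis 2 1" "axis 2 1"]
    by (simp_all add: comp b22 m1 xyz algebra_simps)
  \<comment> \<open>M has rows (x, y) and (z, -x), so x * x + y * z is half the trace of M M. The
    equations \<open>e\<close> are combined with the entries of M as weights, and m is split into
    a11 + a22.\<close>
  have "m * (x * x + y * z) = x * (m * x) + m * y * z" by (simp add: algebra_simps)
  also have "\<dots> = z * (a22 * y + a12 * x) + y * (a11 * z - a21 * x)"
    unfolding e(1) by (simp add: m1 algebra_simps)
  also have "\<dots> = 0" by (simp add: e)
  finally have 0: "x * x + y * z = 0" using m(3) by simp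
  have M1: "M u $ 1 = x * u $ 1 + y * u $ 2" and M2: "M u $ 2 = z * u $ 1 - x * u $ 2" for u
    by (simp_all add: M comp m1 b22 xyz algebra_simps)
  have "M (M u) $ 1 = (x * x + y * z) * u $ 1" "M (M u) $ 2 = (x * x + y * z) * u $ 2"
    unfolding M1 M2 by (simp_all add: algebra_simps)
  then show ?thesis by (simp add: vec_eq_iff forall_2 0)
qed

context sd_space
begin

text \<open>\<open>U u\<close> is the field E_u of the overview, whereas \<open>E\<close> in the
  code denotes the one-parameter group of \<open>A\<close>.\<close>

definition U :: "real^2 \<Rightarrow> pt vfield" where "U u = sd_field A (u, 0)"

definition T :: "pt vfield" where "T = sd_field A (0, 1)"

lemma U_eq: "U u p = (E (snd p) *v u, 0)" and T_eq: "T p = (0, 1)"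
  by (simp_all add: U_def T_def sd_field_E)

lemma smooth_sd_field: "smooth (sd_field A v)"
  unfolding sd_field_E[abs_def] by (intro smooth_Pair smooth_E_snd smooth_const)

lemma smooth_U: "smooth (U u)" and smooth_T: "smooth T"
  unfolding U_def T_def by (rule smooth_sd_field)+

lemma deriv_along_U_linear:
  assumes "smooth f"
  shows "deriv_along (U (u + w)) f p = deriv_along (U u) f p + deriv_along (U w) f p"
    "deriv_along (U (c *\<^sub>R u)) f p = c *\<^sub>R deriv_along (U u) f p"
proof -
  note lin = linear_frechet_derivative_smooth[OF assms, of p]
  have "U (u + w) p = U u p + U w p" "U (c *\<^sub>R u) p = c *\<^sub>R U u p"
    by (simp_all add: U_eq mv_simps)
  then show "deriv_along (U (u + w)) f p = deriv_along (U u) f p + deriv_along (U w) f p"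
    "deriv_along (U (c *\<^sub>R u)) f p = c *\<^sub>R deriv_along (U u) f p"
    unfolding deriv_along_def by (simp_all only: linear_add[OF lin] linear_scale[OF lin])
qed

lemma deriv_along_T_U:
  fixes f :: "pt \<Rightarrow> 'b::euclidean_space"
  assumes "smooth f"
  shows "deriv_along T (deriv_along (U u) f) p =
    deriv_along (U u) (deriv_along T f) p + deriv_along (U (A *v u)) f p"
proof -
  have "lie_bracket T (U u) = U (A *v u)"
    unfolding T_def U_def lie_bracket_sd_field by simp
  with deriv_along_commute[OF smooth_T smooth_U assms, of u p] show ?thesis
    by (simp add: algebra_simps)
qed

lemma deriv_along_U_U:
  fixes f :: "pt \<Rightarrow> 'b::euclidean_space"
  assumes "smooth f"
  shows "deriv_along (U u) (deriv_along (U w) f) p = deriv_along (U w) (deriv_along (U u) f) p"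
proof -
  have "lie_bracket (U u) (U w) p = 0"
    unfolding U_def lie_bracket_sd_field by (simp add: sd_field_E zero_prod_def)
  then have "deriv_along (lie_bracket (U u) (U w)) f p = 0"
    using linear_0[OF linear_frechet_derivative_smooth[OF assms]] by (simp add: deriv_along_def)
  with deriv_along_commute[OF smooth_U smooth_U assms, of u w p] show ?thesis
    by simp
qed

text \<open>\<open>hor X\<close> and \<open>vert X\<close> are the zeta and tau of the
  overview.\<close>

definition hor :: "pt vfield \<Rightarrow> pt \<Rightarrow> real^2" where "hor X p = pull p (fst (X p))"

definition vert :: "pt vfield \<Rightarrow> pt \<Rightarrow> real" where "vert X p = snd (X p)"

lemma smooth_hor: "smooth X \<Longrightarrow> smooth (hor X)"
  unfolding hor_def[abs_def] by (intro smooth_pull smooth_fst)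

lemma smooth_vert: "smooth X \<Longrightarrow> smooth (vert X)"
  unfolding vert_def[abs_def] by (intro smooth_snd)

lemma frechet_derivative_hor:
  assumes "smooth X"
  shows "frechet_derivative (hor X) (at p) h =
    pull p (fst (frechet_derivative X (at p) h)) - snd h *\<^sub>R (A *v hor X p)"
  using fun_cong[OF frechet_derivative_at[OF pull_has_derivative[OF
        has_derivative_fst[OF smooth_has_derivative[OF assms]]]], symmetric]
  by (simp add: hor_def[abs_def])

lemma frechet_derivative_vert:
  assumes "smooth X"
  shows "frechet_derivative (vert X) (at p) h = snd (frechet_derivative X (at p) h)"
  using fun_cong[OF frechet_derivative_at[OF has_derivative_snd[OF smooth_has_derivative[OF assms]]], symmetric]
  by (simp add: vert_def[abs_def])

text \<open>These are the horizontal, mixed and vertical components of Killing's equation. The term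
  \<open>A *v hor X p\<close> appears because \<open>hor\<close> uses a frame which varies with the
  height.\<close>

lemma killing_frame:
  assumes "killing_field g X"
  shows "q (deriv_along (U u) (hor X) p) w + q u (deriv_along (U w) (hor X) p) =
      vert X p * (q (A *v u) w + q u (A *v w))"
    and "\<nu> * deriv_along (U u) (vert X) p + q (A *v hor X p + deriv_along T (hor X) p) u = 0"
    and "deriv_along T (vert X) p = 0"
proof -
  have X: "smooth X" and K: "\<And>p u w. g p (frechet_derivative X (at p) u) w +
      g p u (frechet_derivative X (at p) w) = 2 * snd (X p) * q (S *v pull p (fst u)) (pull p (fst w))"
    using assms unfolding killing_field_iff by blast+
  note D = deriv_along_def frechet_derivative_hor[OF X] frechet_derivative_vert[OF X] U_eq T_eq
  show "q (deriv_along (U u) (hor X) p) w + q u (deriv_along (U w) (hor X) p) =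
      vert X p * (q (A *v u) w + q u (A *v w))"
    using K[of p "U u p" "U w p"] q_S[of u w]
    by (simp add: D g_def vert_def)
  show "\<nu> * deriv_along (U u) (vert X) p + q (A *v hor X p + deriv_along T (hor X) p) u = 0"
    using K[of p "U u p" "T p"] q_sym[of u]
    by (simp add: D g_def pull_simps q.zero_right q.zero_left)
  show "deriv_along T (vert X) p = 0"
    using K[of p "T p" "T p"] nu_pos
    by (simp add: D g_def pull_simps q.zero_right q.zero_left)
qed

text \<open>This bounds the Killing algebra from above: along the plane, the vertical component
  determines how the horizontal one varies. Prolonging the mixed equation is what excludes an
  infinitesimal rotation phi.\<close>

lemma killing_hor_derivative:
  assumes K: "killing_field g X" and tr: "trace A \<noteq> 0" and S: "\<nexists>c. \<forall>u. S *v u = c *\<^sub>R u"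
  shows "deriv_along (U u) (hor X) p = vert X p *\<^sub>R (A *v u)"
proof -
  have X: "smooth X" using K by (simp add: killing_field_def)
  define z where "z = hor X"
  define t where "t = vert X"
  have z: "smooth z" and t: "smooth t" using smooth_hor[OF X] smooth_vert[OF X] by (simp_all add: z_def t_def)
  note K1 = killing_frame(1)[OF K, folded z_def t_def]
    and K2 = killing_frame(2)[OF K, folded z_def t_def]
    and K3 = killing_frame(3)[OF K, folded z_def t_def]
  \<comment> \<open>The horizontal Killing equation says that this defect is skew for q.\<close>
  define s where "s u p = t p *\<^sub>R (A *v u) - deriv_along (U u) z p" for u p
  have ds: "deriv_along (U u) z p = t p *\<^sub>R (A *v u) - s u p" for u p
    by (simp add: s_def)
  have smooth_s: "smooth (s u)" for u
    unfolding s_def[abs_def] by (intro smooth_intros smooth_deriv_along smooth_U t z)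
  have s_lin: "s (u + w) p = s u p + s w p" "s (c *\<^sub>R u) p = c *\<^sub>R s u p" for u w c p
    by (simp_all add: s_def deriv_along_U_linear[OF z] mv_simps algebra_simps)
  have skew: "q (s u p) w = - q (s w p) u" for u w p
    using K1[of u p w] q_sym[of u "A *v w"] q_sym[of u "deriv_along (U w) z p"]
    by (simp add: s_def q.diff_left q.scaleR_left algebra_simps)
  define \<phi> where "\<phi> p = q (s (axis 1 1) p) (axis 2 1)" for p
  have smooth_phi: "smooth \<phi>"
    unfolding \<phi>_def[abs_def] by (intro smooth_q smooth_s smooth_const)
  have s_area: "q (s u p) w = \<phi> p * area u w" for u w p
  proof -
    have 0: "q (s (axis 1 1) p) (axis 1 1) = 0" "q (s (axis 2 1) p) (axis 2 1) = 0"
      using skew[of "axis 1 1" p "axis 1 1"] skew[of "axis 2 1" p "axis 2 1"] by simp_all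
    have "q (s u p) w = q (s (u $ 1 *\<^sub>R axis 1 1 + u $ 2 *\<^sub>R axis 2 1) p) (w $ 1 *\<^sub>R axis 1 1 + w $ 2 *\<^sub>R axis 2 1)"
      using vec2_expand by metis
    also have "\<dots> = \<phi> p * area u w"
      using 0 skew[of "axis 2 1" p "axis 1 1"]
      by (simp only: s_lin q.add_left q.add_right q.scaleR_left q.scaleR_right)
        (simp add: \<phi>_def area_def algebra_simps)
    finally show ?thesis .
  qed
  define H where "H u w p = deriv_along (U u) (deriv_along (U w) t) p" for u w p
  have smooth_Ut: "smooth (deriv_along (U w) t)" for w
    by (intro smooth_deriv_along smooth_U t)
  have T_phi: "deriv_along T \<phi> p * area u w =
      \<nu> * H u w p - \<phi> p * (area u (B *v w) - area (A *v u) w)" for u w p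
  proof -
    have "deriv_along T \<phi> p * area u w = deriv_along T (\<lambda>p. \<phi> p * area u w) p"
      by (rule deriv_along_linear[OF bounded_linear_mult_left smooth_phi, symmetric])
    also have "\<dots> = deriv_along T (\<lambda>p. q (s u p) w) p"
      by (simp only: s_area)
    also have "\<dots> = q (deriv_along T (s u) p) w"
      by (rule deriv_along_linear[OF q.bounded_linear_left smooth_s])
    also have "deriv_along T (s u) p = - deriv_along T (deriv_along (U u) z) p"
    proof -
      have "deriv_along T (\<lambda>p. t p *\<^sub>R (A *v u)) p = 0"
        by (simp add: deriv_along_linear[OF bounded_linear_scaleR_left t] K3)
      moreover have "smooth (\<lambda>p. t p *\<^sub>R (A *v u))" "smooth (deriv_along (U u) z)"
        by (intro smooth_intros smooth_deriv_along smooth_U t z)+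
      ultimately show ?thesis
        unfolding s_def[abs_def] by (simp add: deriv_along_diff)
    qed
    also have "\<dots> = - deriv_along (U u) (deriv_along T z) p - deriv_along (U (A *v u)) z p"
      by (simp add: deriv_along_T_U[OF z])
    also have "q \<dots> w = - q (deriv_along (U u) (deriv_along T z) p) w - q (deriv_along (U (A *v u)) z p) w"
      by (simp add: q.diff_left q.minus_left)
    also have "- q (deriv_along (U u) (deriv_along T z) p) w =
        \<nu> * H u w p + q (A *v deriv_along (U u) z p) w"
    proof -
      have Tz: "smooth (deriv_along T z)" by (intro smooth_deriv_along smooth_T z)
      have Az: "smooth (\<lambda>p. A *v z p)" by (intro smooth_intros z)
      \<comment> \<open>The mixed Killing equation holds at every point and may be differentiated.
        This trades the mixed second derivative of zeta for a second derivative of tau.\<close>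
      have "deriv_along (U u) (\<lambda>p. \<nu> * deriv_along (U w) t p + q (A *v z p + deriv_along T z p) w) p = 0"
        unfolding K2 by (rule deriv_along_const)
      moreover have "deriv_along (U u) (\<lambda>p. \<nu> * deriv_along (U w) t p + q (A *v z p + deriv_along T z p) w) p =
          \<nu> * H u w p + q (A *v deriv_along (U u) z p + deriv_along (U u) (deriv_along T z) p) w"
      proof -
        have "deriv_along (U u) (\<lambda>p. \<nu> * deriv_along (U w) t p + q (A *v z p + deriv_along T z p) w) p =
          deriv_along (U u) (\<lambda>p. \<nu> * deriv_along (U w) t p) p +
          deriv_along (U u) (\<lambda>p. q (A *v z p + deriv_along T z p) w) p"
          by (intro deriv_along_add smooth_intros smooth_q smooth_Ut z Tz)
        also have "deriv_along (U u) (\<lambda>p. \<nu> * deriv_along (U w) t p) p = \<nu> * H u w p"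
          unfolding H_def by (rule deriv_along_linear[OF bounded_linear_mult_right smooth_Ut])
        also have "deriv_along (U u) (\<lambda>p. q (A *v z p + deriv_along T z p) w) p =
            q (deriv_along (U u) (\<lambda>p. A *v z p + deriv_along T z p) p) w"
          by (intro deriv_along_linear[OF q.bounded_linear_left] smooth_intros z Tz)
        also have "deriv_along (U u) (\<lambda>p. A *v z p + deriv_along T z p) p =
            A *v deriv_along (U u) z p + deriv_along (U u) (deriv_along T z) p"
          by (simp add: deriv_along_add[OF Az Tz] deriv_along_linear[OF matrix_vector_mul_bounded_linear z])
        finally show ?thesis .
      qed
      ultimately show ?thesis by (simp add: q.add_left)
    qed
    also have "q (A *v deriv_along (U u) z p) w = q (deriv_along (U u) z p) (B *v w)"
      using q_B[of w] q_sym by metis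
    \<comment> \<open>After inserting \<open>ds\<close>, the terms containing t cancel because
      \<open>B\<close> is the adjoint of \<open>A\<close>.\<close>
    finally show ?thesis
      unfolding ds by (simp add: q.diff_left q.scaleR_left s_area algebra_simps)
        (use q_B[of w "A *v u"] q_sym[of "A *v u" "B *v w"] q_sym[of w] in simp)
  qed
  have T_phi_0: "deriv_along T \<phi> p = 0" for p
  proof -
    \<comment> \<open>Exchanging the arguments fixes H and reverses the area, so subtracting the two
      instances of \<open>T_phi\<close> leaves 2 T phi = phi (trace A - trace B).\<close>
    have "H (axis 1 1) (axis 2 1) p = H (axis 2 1) (axis 1 1) p"
      unfolding H_def by (rule deriv_along_U_U[OF t])
    moreover have "A $ 1 $ 1 + A $ 2 $ 2 = B $ 1 $ 1 + B $ 2 $ 2"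
      using trace_B by (simp add: trace_def sum_2)
    then have "\<phi> p * (A $ 1 $ 1 + A $ 2 $ 2) = \<phi> p * (B $ 1 $ 1 + B $ 2 $ 2)" by simp
    ultimately show ?thesis
      using T_phi[of p "axis 1 1" "axis 2 1"] T_phi[of p "axis 2 1" "axis 1 1"]
      by (simp add: area_def matrix_vector_mult_def sum_2 axis_def algebra_simps)
  qed
  have H_phi: "\<nu> * H u w p = \<phi> p * (area u (B *v w) - area (A *v u) w)" for u w p
    using T_phi[of p u w] T_phi_0 by simp
  \<comment> \<open>T kills t, hence it acts on the second derivatives of t only through the
    brackets [T, U u] = U (A u).\<close>
  have H_T: "deriv_along T (H u w) p = H u (A *v w) p + H (A *v u) w p" for u w p
  proof -
    have "deriv_along T (deriv_along (U w) t) = deriv_along (U (A *v w)) t"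
    proof
      fix p
      have "deriv_along T t = (\<lambda>p. 0)" using K3 by blast
      then show "deriv_along T (deriv_along (U w) t) p = deriv_along (U (A *v w)) t p"
        by (simp add: deriv_along_T_U[OF t] deriv_along_const)
    qed
    then show ?thesis
      unfolding H_def[abs_def] deriv_along_T_U[OF smooth_Ut] by simp
  qed
  have phi_0: "\<phi> p = 0" for p
  proof (rule ccontr)
    assume nz: "\<phi> p \<noteq> 0"
    \<comment> \<open>By \<open>H_phi\<close> and T phi = 0, T annihilates H. With
      \<open>H_T\<close> this becomes phi times an algebraic expression in \<open>A\<close> and
      \<open>B\<close>.\<close>
    have eq: "area u (B *v (A *v w)) - area (A *v u) (A *v w) +
      (area (A *v u) (B *v w) - area (A *v (A *v u)) w) = 0" for u w
    proof -
      have "0 = deriv_along T \<phi> p * (area u (B *v w) - area (A *v u) w)"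
        by (simp add: T_phi_0)
      also have "\<dots> = deriv_along T (\<lambda>p. \<phi> p * (area u (B *v w) - area (A *v u) w)) p"
        by (rule deriv_along_linear[OF bounded_linear_mult_left smooth_phi, symmetric])
      also have "\<dots> = deriv_along T (\<lambda>p. \<nu> * H u w p) p"
        by (simp only: H_phi)
      also have "\<dots> = \<nu> * deriv_along T (H u w) p"
        unfolding H_def[abs_def]
        by (intro deriv_along_linear[OF bounded_linear_mult_right] smooth_deriv_along smooth_U t)
      also have "\<dots> = \<phi> p * (area u (B *v (A *v w)) - area (A *v u) (A *v w) +
          (area (A *v u) (B *v w) - area (A *v (A *v u)) w))"
        unfolding H_T distrib_left H_phi ..
      finally show ?thesis using nz by simp
    qed
    \<comment> \<open>M is self-adjoint for the definite form q, so M M = 0 forces M = 0. That would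
      make \<open>S\<close> scalar.\<close>
    define M where "M u = A *v u + B *v u - trace A *\<^sub>R u" for u
    have "M u = 0" for u
    proof -
      have "M (M u) = 0"
        by (rule nilpotent_of_area_identity[OF refl trace_B[symmetric] tr eq M_def])
      moreover have "q (M u) w = q u (M w)" for u w
        using q_B[of u w] q_B[of w u] q_sym[of "A *v u"] q_sym[of u "B *v w"]
        by (simp add: M_def q.add_left q.add_right q.diff_left q.diff_right q.scaleR_left q.scaleR_right)
      ultimately have "q (M u) (M u) = 0" by (simp add: q.zero_right)
      then show ?thesis by (simp add: q_eq_0)
    qed
    then have "S *v u = (trace A / 2) *\<^sub>R u" for u
      by (simp add: M_def S_mult)
    then show False using S by blast
  qed
  have "s u p = 0"
    by (rule q_eqI) (simp add: s_area phi_0 q.zero_left)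
  then show ?thesis
    using ds[of u p] by (simp add: z_def t_def)
qed

text \<open>Parallelism at p expresses the derivatives of tau there through \<open>S\<close> and v.
  The commutation relation for zeta thereby becomes a condition on v alone.\<close>

lemma distribution_of_symmetryD:
  assumes tr: "trace A \<noteq> 0" and S: "\<nexists>c. \<forall>u. S *v u = c *\<^sub>R u"
    and v: "v \<in> distribution_of_symmetry g p"
  shows "q (S *v pull p (fst v)) u *\<^sub>R (A *v w) = q (S *v pull p (fst v)) w *\<^sub>R (A *v u)"
    and "snd v *\<^sub>R (A *v u) = snd v *\<^sub>R (S *v u)"
proof -
  obtain X where K: "killing_field g X" and Xp: "X p = v"
    and par: "\<And>u. frechet_derivative X (at p) u + christoffel p u v = 0"
    using v unfolding distribution_of_symmetry_iff by blast
  have X: "smooth X" using K by (simp add: killing_field_def)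
  note hd = killing_hor_derivative[OF K tr S]
  have 1: "deriv_along (U u) (hor X) p = snd v *\<^sub>R (S *v u)" for u
    using arg_cong[OF par[of "U u p"], of "\<lambda>y. pull p (fst y)"]
    by (simp add: deriv_along_def frechet_derivative_hor[OF X] U_eq christoffel_def pull_simps mv_simps)
  have 2: "q (S *v pull p (fst v)) u = - \<nu> * deriv_along (U u) (vert X) p" for u
    using arg_cong[OF par[of "U u p"], of snd] nu_pos q_S_sym[of u "pull p (fst v)"]
    by (simp add: deriv_along_def frechet_derivative_vert[OF X] U_eq christoffel_def field_simps)
  show "snd v *\<^sub>R (A *v u) = snd v *\<^sub>R (S *v u)"
    using 1[of u] unfolding hd vert_def Xp .
  have "deriv_along (U u) (deriv_along (U w) (hor X)) p =
      deriv_along (U u) (vert X) p *\<^sub>R (A *v w)" for u w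
  proof -
    have "deriv_along (U w) (hor X) = (\<lambda>p. vert X p *\<^sub>R (A *v w))" using hd by blast
    then show ?thesis
      by (simp add: deriv_along_linear[OF bounded_linear_scaleR_left smooth_vert[OF X]])
  qed
  with deriv_along_U_U[OF smooth_hor[OF X], of u w p]
  have *: "deriv_along (U u) (vert X) p *\<^sub>R (A *v w) = deriv_along (U w) (vert X) p *\<^sub>R (A *v u)"
    by simp
  show "q (S *v pull p (fst v)) u *\<^sub>R (A *v w) = q (S *v pull p (fst v)) w *\<^sub>R (A *v u)"
    unfolding 2 scaleR_scaleR[symmetric] * by (rule refl)
qed

text \<open>Independent u and w have independent images under an invertible \<open>A\<close>, so
  both coefficients in the commutation relation vanish and q(S w, .) = 0. Right invariant fields
  realise every remaining vector.\<close>

theorem distribution_of_symmetry_invertible: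
  assumes tr: "trace A \<noteq> 0" and S: "\<nexists>c. \<forall>u. S *v u = c *\<^sub>R u" and det: "det A \<noteq> 0"
  shows "distribution_of_symmetry g p =
    {sd_field A (w, r) p | w r. S *v w = 0 \<and> (\<forall>u. r *\<^sub>R (A *v u) = r *\<^sub>R (S *v u))}"
proof (intro subset_antisym subsetI)
  fix v assume v: "v \<in> distribution_of_symmetry g p"
  define w where "w = pull p (fst v)"
  define x y where "x = q (S *v w) (axis 1 1)" "y = q (S *v w) (axis 2 1)"
  have "x *\<^sub>R (A *v axis 2 1) = y *\<^sub>R (A *v axis 1 1)"
    unfolding x_y_def w_def by (rule distribution_of_symmetryD(1)[OF tr S v])
  then have e: "x * A $ 1 $ 2 = y * A $ 1 $ 1" "x * A $ 2 $ 2 = y * A $ 2 $ 1"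
    by (simp_all add: vec_eq_iff forall_2 matrix_vector_mult_def sum_2 axis_def)
  \<comment> \<open>The relation says that the columns of \<open>A\<close>, weighted by x and y,
    coincide. Expanding the determinant turns this into x det A = y det A = 0.\<close>
  have "x * det A = A $ 1 $ 1 * (x * A $ 2 $ 2) - A $ 2 $ 1 * (x * A $ 1 $ 2)"
    by (simp add: det_2 algebra_simps)
  also have "\<dots> = 0" unfolding e by simp
  finally have x: "x = 0" using det by simp
  have "y * det A = A $ 2 $ 2 * (y * A $ 1 $ 1) - A $ 1 $ 2 * (y * A $ 2 $ 1)"
    by (simp add: det_2 algebra_simps)
  also have "\<dots> = 0" unfolding e[symmetric] by simp
  finally have y: "y = 0" using det by simp
  have "q (S *v w) u = x * u $ 1 + y * u $ 2" for u
    by (subst vec2_expand[of u]) (simp only: q.add_right q.scaleR_right x_y_def real_scaleR_def mult.commute)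
  then have "S *v w = 0" using x y q_eq_0[of "S *v w"] by simp
  moreover have "\<forall>u. snd v *\<^sub>R (A *v u) = snd v *\<^sub>R (S *v u)"
    using distribution_of_symmetryD(2)[OF tr S v] by blast
  moreover have "v = sd_field A (w, snd v) p"
    using sd_field_pull[of p v] by (simp add: w_def)
  ultimately show "v \<in> {sd_field A (w, r) p | w r. S *v w = 0 \<and> (\<forall>u. r *\<^sub>R (A *v u) = r *\<^sub>R (S *v u))}"
    by blast
next
  fix v
  assume "v \<in> {sd_field A (w, r) p | w r. S *v w = 0 \<and> (\<forall>u. r *\<^sub>R (A *v u) = r *\<^sub>R (S *v u))}"
  then show "v \<in> distribution_of_symmetry g p"
    using right_invariant_mem_distribution_of_symmetry by blast
qed

text \<open>Now the commutation relation only compares multiples of f. Testing it against f itself,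
  where l does not vanish, shows that q(S w, .) is a multiple of l.\<close>

theorem distribution_of_symmetry_rank_one:
  assumes tr: "trace A \<noteq> 0" and S: "\<nexists>c. \<forall>u. S *v u = c *\<^sub>R u"
    and A: "\<And>u. A *v u = (l \<bullet> u) *\<^sub>R f" and lf: "l \<bullet> f \<noteq> 0"
  shows "distribution_of_symmetry g p =
    {sd_field A (w, r) p | w r. (\<exists>k. \<forall>u. q (S *v w) u = k * (l \<bullet> u)) \<and>
      (\<forall>u. r *\<^sub>R (A *v u) = r *\<^sub>R (S *v u))}"
proof (intro subset_antisym subsetI)
  fix v assume v: "v \<in> distribution_of_symmetry g p"
  define w where "w = pull p (fst v)"
  have "q (S *v w) u = (q (S *v w) f / (l \<bullet> f)) * (l \<bullet> u)" for u
  proof -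
    have "(q (S *v w) u * (l \<bullet> f)) *\<^sub>R f = (q (S *v w) f * (l \<bullet> u)) *\<^sub>R f"
      using distribution_of_symmetryD(1)[OF tr S v, of u f] by (simp add: A w_def)
    moreover have "f \<noteq> 0" using lf by auto
    ultimately have "q (S *v w) u * (l \<bullet> f) = q (S *v w) f * (l \<bullet> u)" by simp
    then show ?thesis using lf by (simp add: field_simps)
  qed
  moreover have "\<forall>u. snd v *\<^sub>R (A *v u) = snd v *\<^sub>R (S *v u)"
    using distribution_of_symmetryD(2)[OF tr S v] by blast
  moreover have "v = sd_field A (w, snd v) p"
    using sd_field_pull[of p v] by (simp add: w_def)
  ultimately show "v \<in> {sd_field A (w, r) p | w r. (\<exists>k. \<forall>u. q (S *v w) u = k * (l \<bullet> u)) \<and>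
      (\<forall>u. r *\<^sub>R (A *v u) = r *\<^sub>R (S *v u))}"
    by blast
next
  fix v
  assume "v \<in> {sd_field A (w, r) p | w r. (\<exists>k. \<forall>u. q (S *v w) u = k * (l \<bullet> u)) \<and>
      (\<forall>u. r *\<^sub>R (A *v u) = r *\<^sub>R (S *v u))}"
  then obtain w r k where v: "v = sd_field A (w, r) p" and k: "\<And>u. q (S *v w) u = k * (l \<bullet> u)"
    and r: "\<And>u. r *\<^sub>R (A *v u) = r *\<^sub>R (S *v u)" by blast
  obtain z where z: "\<And>u. q z u = l \<bullet> u" using exists_q_dual by blast
  have "S *v w = k *\<^sub>R z"
    by (rule q_eqI) (simp add: k z q.scaleR_left)
  then show "v \<in> distribution_of_symmetry g p"
    unfolding v by (intro rank_one_mem_distribution_of_symmetry[OF A refl lf z _ r])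
qed

end

section \<open>The matrices $A_c$\<close>

lemma index_of_symmetry_eqI:
  assumes "\<And>p. dim (distribution_of_symmetry g p) = k"
  shows "index_of_symmetry g = k"
  unfolding index_of_symmetry_def using assms by (intro the_equality) auto

definition gram2 :: "real \<Rightarrow> real \<Rightarrow> real \<Rightarrow> real^2^2" where
  "gram2 a b d = vector [vector [a, b], vector [b, d]]"

definition gram3 :: "real \<Rightarrow> real \<Rightarrow> real \<Rightarrow> real \<Rightarrow> real^3^3" where
  "gram3 a b d \<nu> = vector [vector [a, b, 0], vector [b, d, 0], vector [0, 0, \<nu>]]"

lemma gram2_form:
  "u \<bullet> (gram2 a b d *v w) = a * (u $ 1 * w $ 1) + b * (u $ 1 * w $ 2 + u $ 2 * w $ 1) + d * (u $ 2 * w $ 2)"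
  by (simp add: gram2_def inner_vec_def matrix_vector_mult_def sum_2 algebra_simps)

lemma sd_space_gram2:
  assumes "0 < a" "b\<^sup>2 < a * d" "0 < \<nu>"
  shows "sd_space (gram2 a b d) \<nu>"
proof
  fix u w :: "real^2"
  show "u \<bullet> (gram2 a b d *v w) = w \<bullet> (gram2 a b d *v u)"
    by (simp add: gram2_form algebra_simps)
  assume "u \<noteq> 0"
  have "a * (u \<bullet> (gram2 a b d *v u)) = (a * u $ 1 + b * u $ 2)\<^sup>2 + (a * d - b\<^sup>2) * (u $ 2)\<^sup>2"
    by (simp add: gram2_form power2_eq_square algebra_simps)
  also have "\<dots> > 0"
  proof (cases "u $ 2 = 0")
    case True
    with \<open>u \<noteq> 0\<close> have "u $ 1 \<noteq> 0" by (auto simp: vec_eq_iff forall_2)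
    with True assms(1) show ?thesis by simp
  next
    case False
    with assms(2) show ?thesis by (intro add_nonneg_pos) auto
  qed
  finally show "0 < u \<bullet> (gram2 a b d *v u)"
    using assms(1) by (simp add: zero_less_mult_iff)
qed (rule assms)

lemma coords_gram3:
  "coords x \<bullet> (gram3 a b d \<nu> *v coords y) = fst x \<bullet> (gram2 a b d *v fst y) + \<nu> * (snd x * snd y)"
  unfolding gram2_form
  by (simp add: split_beta coords_def gram3_def inner_vec_def matrix_vector_mult_def sum_3 algebra_simps)

lemma sd_metric_gram3:
  assumes "sd_space (gram2 a b d) \<nu>"
  shows "sd_metric A (gram3 a b d \<nu>) = sd_space.g A (gram2 a b d) \<nu>"
proof (intro ext)
  fix p u v
  show "sd_metric A (gram3 a b d \<nu>) p u v = sd_space.g A (gram2 a b d) \<nu> p u v"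
    unfolding sd_metric_def left_inv_metric_def frechet_derivative_sd_mult
      sd_space.g_def[OF assms] sd_space.pull_def[OF assms] sd_space.E_def[OF assms]
      sd_space.q_def[OF assms]
    by (simp add: coords_gram3 sd_inv_def split_beta)
qed

lemma A_c_mult: "(A_c c *v u) $ 1 = - c * u $ 2" "(A_c c *v u) $ 2 = u $ 1 + 2 * u $ 2"
  by (simp_all add: A_c_def matrix_vector_mult_def sum_2)

lemma trace_A_c: "trace (A_c c) = 2" and det_A_c: "det (A_c c) = c"
  by (simp_all add: A_c_def trace_def sum_2 det_2)

text \<open>\<open>a_pos\<close> and \<open>disc\<close> are Sylvester's criterion for the plane
  block. The entries stay free so that every family on G_c is an instance.\<close>

locale A_c_space =
  fixes c a b d \<nu> :: real
  assumes a_pos: "0 < a" and disc: "b\<^sup>2 < a * d" and nu: "0 < \<nu>"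
begin

sublocale sd_space "A_c c" "gram2 a b d" \<nu>
  by (rule sd_space_gram2[OF a_pos disc nu])

lemma metric: "sd_metric (A_c c) (gram3 a b d \<nu>) = g"
  by (rule sd_metric_gram3) (rule sd_space_axioms)

lemma q_entries:
  "q u w = a * (u $ 1 * w $ 1) + b * (u $ 1 * w $ 2 + u $ 2 * w $ 1) + d * (u $ 2 * w $ 2)"
  by (simp add: q_def gram2_form)

text \<open>The entries b, (d - c a + 2 b) / 2 and 2 d - c b of this symmetric form reappear in all
  case distinctions below.\<close>

lemma q_S_entries: "q (S *v w) u = (b * w $ 1 + (d - c * a + 2 * b) / 2 * w $ 2) * u $ 1 +
    ((d - c * a + 2 * b) / 2 * w $ 1 + (2 * d - c * b) * w $ 2) * u $ 2"
proof -
  have "2 * q (S *v w) u = 2 * ((b * w $ 1 + (d - c * a + 2 * b) / 2 * w $ 2) * u $ 1 +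
    ((d - c * a + 2 * b) / 2 * w $ 1 + (2 * d - c * b) * w $ 2) * u $ 2)"
    unfolding q_S by (simp add: q_entries A_c_mult field_simps)
  then show ?thesis by simp
qed

lemma S_mult_eq_0: "S *v w = 0 \<longleftrightarrow> b * w $ 1 + (d - c * a + 2 * b) / 2 * w $ 2 = 0 \<and>
    (d - c * a + 2 * b) / 2 * w $ 1 + (2 * d - c * b) * w $ 2 = 0"
proof
  assume "S *v w = 0"
  then have "q (S *v w) (axis i 1) = 0" for i by (simp add: q.zero_left)
  from this[of 1] this[of 2] show "b * w $ 1 + (d - c * a + 2 * b) / 2 * w $ 2 = 0 \<and>
    (d - c * a + 2 * b) / 2 * w $ 1 + (2 * d - c * b) * w $ 2 = 0"
    unfolding q_S_entries by (simp add: axis_def)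
next
  assume "b * w $ 1 + (d - c * a + 2 * b) / 2 * w $ 2 = 0 \<and>
    (d - c * a + 2 * b) / 2 * w $ 1 + (2 * d - c * b) * w $ 2 = 0"
  then have "q (S *v w) (S *v w) = 0" unfolding q_S_entries by simp
  then show "S *v w = 0" by (simp add: q_eq_0)
qed

text \<open>In dimension two the skew part of \<open>A\<close> is a single number. It vanishes iff
  \<open>A\<close> is self-adjoint for q, which is what admits e_2.\<close>

lemma skew_part: "q (A_c c *v u) w - q (S *v u) w = (d + c * a - 2 * b) / 2 * area u w"
  unfolding q_S_entries by (simp add: q_entries A_c_mult area_def field_simps)

lemma scaleR_A_eq_S:
  "(\<forall>u. r *\<^sub>R (A_c c *v u) = r *\<^sub>R (S *v u)) \<longleftrightarrow> (d + c * a - 2 * b) * r = 0"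
proof
  assume *: "\<forall>u. r *\<^sub>R (A_c c *v u) = r *\<^sub>R (S *v u)"
  have "r * (q (A_c c *v axis 1 1) (axis 2 1) - q (S *v axis 1 1) (axis 2 1)) =
      q (r *\<^sub>R (A_c c *v axis 1 1)) (axis 2 1) - q (r *\<^sub>R (S *v axis 1 1)) (axis 2 1)"
    by (simp only: q.scaleR_left real_scaleR_def right_diff_distrib)
  also have "\<dots> = 0" unfolding *[rule_format] by simp
  finally show "(d + c * a - 2 * b) * r = 0"
    unfolding skew_part by (auto simp: area_def axis_def)
next
  assume *: "(d + c * a - 2 * b) * r = 0"
  show "\<forall>u. r *\<^sub>R (A_c c *v u) = r *\<^sub>R (S *v u)"
  proof
    fix u
    have "q (r *\<^sub>R (A_c c *v u)) w = q (r *\<^sub>R (S *v u)) w" for w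
    proof -
      have "r * (q (A_c c *v u) w - q (S *v u) w) = 0"
        unfolding skew_part using * by auto
      then show ?thesis by (simp only: q.scaleR_left real_scaleR_def right_diff_distrib)
    qed
    then show "r *\<^sub>R (A_c c *v u) = r *\<^sub>R (S *v u)" by (rule q_eqI)
  qed
qed

lemma S_scalar_imp:
  assumes "\<exists>k. \<forall>u. S *v u = k *\<^sub>R u"
  shows "b = a \<and> d = c * a"
proof -
  obtain k where k: "\<And>u. S *v u = k *\<^sub>R u" using assms by blast
  have "q (S *v axis i 1) (axis j 1) = k * q (axis i 1) (axis j 1)" for i j
    by (simp add: k q.scaleR_left)
  from this[of 1 1] this[of 1 2] this[of 2 2]
  have 1: "b = k * a" and 2: "(d - c * a + 2 * b) / 2 = k * b" and 3: "2 * d - c * b = k * d"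
    unfolding q_S_entries unfolding q_entries by (simp_all add: axis_def)
  \<comment> \<open>This is the trace of \<open>S\<close>, computed with the adjugate of the Gram
    matrix. It equals trace A = 2, so k = 1.\<close>
  have "2 * (k * (a * d - b\<^sup>2)) = d * (k * a) - 2 * b * (k * b) + a * (k * d)"
    by (simp add: power2_eq_square algebra_simps)
  also have "\<dots> = 2 * (a * d - b\<^sup>2)"
    unfolding 1[symmetric] 2[symmetric] 3[symmetric] by (simp add: power2_eq_square field_simps)
  finally have "k * (a * d - b\<^sup>2) = 1 * (a * d - b\<^sup>2)" by linarith
  then have "k = 1" unfolding mult_cancel_right using disc by simp
  with 1 2 show ?thesis by simp
qed

lemma distribution_of_symmetry_eq:
  assumes "c \<noteq> 0" "\<not> (b = a \<and> d = c * a)"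
  shows "distribution_of_symmetry g p = {sd_field (A_c c) (w, r) p | w r.
    b * w $ 1 + (d - c * a + 2 * b) / 2 * w $ 2 = 0 \<and>
    (d - c * a + 2 * b) / 2 * w $ 1 + (2 * d - c * b) * w $ 2 = 0 \<and> (d + c * a - 2 * b) * r = 0}"
  using distribution_of_symmetry_invertible[of p] assms S_scalar_imp
  unfolding S_mult_eq_0 scaleR_A_eq_S by (auto simp: trace_A_c det_A_c)

end

section \<open>Ranks of the fibres and kernels of the symmetric form\<close>

lemma sd_field_scaleR: "sd_field A (k *\<^sub>R v) p = k *\<^sub>R sd_field A v p"
  and sd_field_add: "sd_field A (v + w) p = sd_field A v p + sd_field A w p"
  and sd_field_0: "sd_field A 0 p = 0"
  by (simp_all add: sd_field_eq zero_prod_def bounded_bilinear.scaleR_right[OF bounded_bilinear_mv]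
      matrix_vector_right_distrib)

lemma sd_field_eq_0_iff: "sd_field A v p = 0 \<longleftrightarrow> v = 0"
proof
  assume *: "sd_field A v p = 0"
  have "mexp (- snd p *\<^sub>R A) *v (mexp (snd p *\<^sub>R A) *v fst v) = fst v"
    by (simp only: matrix_vector_mul_assoc mexp_inverse(1) matrix_vector_mul_lid)
  with * show "v = 0" by (simp add: sd_field_eq prod_eq_iff)
qed (simp add: sd_field_0)

lemma index_of_symmetry_0:
  "(\<And>p. distribution_of_symmetry g p = {0}) \<Longrightarrow> index_of_symmetry g = 0"
  by (rule index_of_symmetry_eqI) simp

lemma index_of_symmetry_1:
  assumes "\<And>p. distribution_of_symmetry g p = span {sd_field A v p}" "v \<noteq> 0"
  shows "index_of_symmetry g = 1"
  by (rule index_of_symmetry_eqI) (simp add: assms sd_field_eq_0_iff)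

lemma index_of_symmetry_3:
  fixes g :: "pt metric"
  assumes "\<And>p. distribution_of_symmetry g p = UNIV"
  shows "index_of_symmetry g = 3"
  by (rule index_of_symmetry_eqI) (simp add: assms)

lemma kernel_trivial:
  fixes \<alpha> \<beta> \<gamma> x y :: real
  assumes "\<alpha> * \<gamma> \<noteq> \<beta>\<^sup>2" "\<alpha> * x + \<beta> * y = 0" "\<beta> * x + \<gamma> * y = 0"
  shows "x = 0" "y = 0"
proof -
  have "(\<alpha> * \<gamma> - \<beta>\<^sup>2) * x = \<gamma> * (\<alpha> * x + \<beta> * y) - \<beta> * (\<beta> * x + \<gamma> * y)"
    "(\<alpha> * \<gamma> - \<beta>\<^sup>2) * y = \<alpha> * (\<beta> * x + \<gamma> * y) - \<beta> * (\<alpha> * x + \<beta> * y)"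
    by (simp_all add: power2_eq_square algebra_simps)
  with assms show "x = 0" "y = 0" by auto
qed

context A_c_space
begin

lemma umbilic_imp_UNIV:
  assumes "b = a" "d = c * a"
  shows "distribution_of_symmetry g p = UNIV"
proof (rule umbilic_distribution_of_symmetry)
  fix u
  have "q (S *v u) w = q u w" for w
    unfolding q_S_entries unfolding q_entries by (simp add: assms algebra_simps)
  then show "S *v u = u" by (rule q_eqI)
qed

text \<open>The first inequality makes the form q(S ., .) nondegenerate and excludes horizontal
  components. The second says that \<open>A\<close> is not self-adjoint and excludes a component
  along e_2.\<close>

lemma distribution_of_symmetry_trivial:
  assumes "c \<noteq> 0" "\<not> (b = a \<and> d = c * a)"
    and "b * (2 * d - c * b) \<noteq> ((d - c * a + 2 * b) / 2)\<^sup>2" "d + c * a \<noteq> 2 * b"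
  shows "distribution_of_symmetry g p = {0}"
proof -
  have "w = 0" if "b * w $ 1 + (d - c * a + 2 * b) / 2 * w $ 2 = 0"
    "(d - c * a + 2 * b) / 2 * w $ 1 + (2 * d - c * b) * w $ 2 = 0" for w :: "real^2"
    using kernel_trivial[OF assms(3) that] by (simp add: vec_eq_iff forall_2)
  moreover have "r = 0" if "(d + c * a - 2 * b) * r = 0" for r
    using that assms(4) by simp
  moreover have "sd_field (A_c c) (0, 0) p = 0"
    using sd_field_0 by (simp add: zero_prod_def)
  ultimately show ?thesis
    unfolding distribution_of_symmetry_eq[OF assms(1,2)] by (fastforce intro: exI[of _ 0])
qed

lemma distribution_of_symmetry_basis2:
  assumes "c \<noteq> 0" "\<not> (b = a \<and> d = c * a)"
    and "b * (2 * d - c * b) \<noteq> ((d - c * a + 2 * b) / 2)\<^sup>2" "d + c * a = 2 * b"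
  shows "distribution_of_symmetry g p = span {sd_field (A_c c) basis2 p}"
proof -
  have "w = 0" if "b * w $ 1 + (d - c * a + 2 * b) / 2 * w $ 2 = 0"
    "(d - c * a + 2 * b) / 2 * w $ 1 + (2 * d - c * b) * w $ 2 = 0" for w :: "real^2"
    using kernel_trivial[OF assms(3) that] by (simp add: vec_eq_iff forall_2)
  then have "distribution_of_symmetry g p = range (\<lambda>r. sd_field (A_c c) (0, r) p)"
    unfolding distribution_of_symmetry_eq[OF assms(1,2)] using assms(4) by force
  moreover have "sd_field (A_c c) (0, r) p = r *\<^sub>R sd_field (A_c c) basis2 p" for r
    by (simp add: sd_field_scaleR[symmetric] basis2_def)
  ultimately show ?thesis by (simp add: span_singleton)
qed

lemma distribution_of_symmetry_line:
  assumes "c \<noteq> 0" "\<not> (b = a \<and> d = c * a)" "d + c * a \<noteq> 2 * b"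
    and n: "b * n $ 1 + (d - c * a + 2 * b) / 2 * n $ 2 = 0"
    "(d - c * a + 2 * b) / 2 * n $ 1 + (2 * d - c * b) * n $ 2 = 0" "n \<noteq> 0"
  shows "distribution_of_symmetry g p = span {sd_field (A_c c) (n, 0) p}"
proof -
  define \<alpha> \<beta> \<gamma> where abc: "\<alpha> = b" "\<beta> = (d - c * a + 2 * b) / 2" "\<gamma> = 2 * d - c * b"
  \<comment> \<open>If all three entries vanished, then b = 0 and d = 0, against
    \<open>disc\<close>. So the kernel of the form is at most a line.\<close>
  have nz: "\<not> (\<alpha> = 0 \<and> \<beta> = 0 \<and> \<gamma> = 0)"
    using disc a_pos by (auto simp: abc)
  have w: "(\<alpha> * w $ 1 + \<beta> * w $ 2 = 0 \<and> \<beta> * w $ 1 + \<gamma> * w $ 2 = 0) \<longleftrightarrow> (\<exists>k. w = k *\<^sub>R n)" for w :: "real^2"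
  proof
    assume w: "\<alpha> * w $ 1 + \<beta> * w $ 2 = 0 \<and> \<beta> * w $ 1 + \<gamma> * w $ 2 = 0"
    \<comment> \<open>D is the determinant of the pair w, n. Two independent null vectors would make
      the form zero.\<close>
    define D where "D = w $ 1 * n $ 2 - w $ 2 * n $ 1"
    have "\<alpha> * D = (\<alpha> * w $ 1 + \<beta> * w $ 2) * n $ 2 - (\<alpha> * n $ 1 + \<beta> * n $ 2) * w $ 2"
      "\<beta> * D = (\<beta> * w $ 1 + \<gamma> * w $ 2) * n $ 2 - (\<beta> * n $ 1 + \<gamma> * n $ 2) * w $ 2"
      "\<gamma> * D = w $ 1 * (\<beta> * n $ 1 + \<gamma> * n $ 2) - n $ 1 * (\<beta> * w $ 1 + \<gamma> * w $ 2)"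
      by (simp_all add: D_def algebra_simps)
    then have "\<alpha> * D = 0" "\<beta> * D = 0" "\<gamma> * D = 0"
      using n w by (simp_all add: abc)
    with nz have "D = 0" by auto
    then have D: "w $ 1 * n $ 2 = w $ 2 * n $ 1" by (simp add: D_def)
    from n(3) consider "n $ 1 \<noteq> 0" | "n $ 2 \<noteq> 0" by (auto simp: vec_eq_iff forall_2)
    then show "\<exists>k. w = k *\<^sub>R n"
    proof cases
      case 1
      with D have "w = (w $ 1 / n $ 1) *\<^sub>R n" by (simp add: vec_eq_iff forall_2 field_simps)
      then show ?thesis ..
    next
      case 2
      with D have "w = (w $ 2 / n $ 2) *\<^sub>R n" by (simp add: vec_eq_iff forall_2 field_simps)
      then show ?thesis ..
    qed
  next
    assume "\<exists>k. w = k *\<^sub>R n"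
    then obtain k where "w = k *\<^sub>R n" ..
    then have "\<alpha> * w $ 1 + \<beta> * w $ 2 = k * (\<alpha> * n $ 1 + \<beta> * n $ 2)"
      "\<beta> * w $ 1 + \<gamma> * w $ 2 = k * (\<beta> * n $ 1 + \<gamma> * n $ 2)"
      by (simp_all add: algebra_simps)
    then show "\<alpha> * w $ 1 + \<beta> * w $ 2 = 0 \<and> \<beta> * w $ 1 + \<gamma> * w $ 2 = 0"
      using n by (simp add: abc)
  qed
  have "distribution_of_symmetry g p = {sd_field (A_c c) (w, r) p | w r.
    (\<alpha> * w $ 1 + \<beta> * w $ 2 = 0 \<and> \<beta> * w $ 1 + \<gamma> * w $ 2 = 0) \<and> r = 0}"
    unfolding distribution_of_symmetry_eq[OF assms(1,2)] using assms(3) by (auto simp: abc)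
  also have "\<dots> = range (\<lambda>k. sd_field (A_c c) (k *\<^sub>R n, 0) p)"
    unfolding w by blast
  also have "\<dots> = span {sd_field (A_c c) (n, 0) p}"
    by (simp add: sd_field_scaleR[symmetric] span_singleton)
  finally show ?thesis .
qed

text \<open>The number d - 2 b enters twice: it measures the failure of q(S w, .) to be a multiple
  of l and the failure of \<open>A\<close> to be self-adjoint. Hence the rank is 1 or 3.\<close>

lemma distribution_of_symmetry_c_0:
  assumes "c = 0"
  shows "distribution_of_symmetry g p = {sd_field (A_c c) (w, r) p | w r.
    (d - 2 * b) * (w $ 1 + 2 * w $ 2) = 0 \<and> (d - 2 * b) * r = 0}"
proof -
  \<comment> \<open>The factors of the rank one matrix \<open>A_c 0\<close>, with l . f equal to its
    trace 2.\<close>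
  define l f :: "real^2" where "l = vector [1, 2]" and "f = vector [0, 1]"
  have l: "l \<bullet> u = u $ 1 + 2 * u $ 2" for u
    by (simp add: l_def inner_vec_def sum_2)
  have A: "A_c c *v u = (l \<bullet> u) *\<^sub>R f" for u
    by (simp add: vec_eq_iff forall_2 A_c_mult assms l f_def)
  have lf: "l \<bullet> f \<noteq> 0" by (simp add: l f_def)
  have S: "\<nexists>k. \<forall>u. S *v u = k *\<^sub>R u"
  proof
    assume "\<exists>k. \<forall>u. S *v u = k *\<^sub>R u"
    from S_scalar_imp[OF this] have "d = 0" by (simp add: assms)
    with disc show False by simp
  qed
  have "(\<exists>k. \<forall>u. q (S *v w) u = k * (l \<bullet> u)) \<longleftrightarrow> (d - 2 * b) * (w $ 1 + 2 * w $ 2) = 0" for w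
  proof
    assume "\<exists>k. \<forall>u. q (S *v w) u = k * (l \<bullet> u)"
    then obtain k where "\<And>u. q (S *v w) u = k * (l \<bullet> u)" by blast
    from this[of "axis 1 1"] this[of "axis 2 1"] show "(d - 2 * b) * (w $ 1 + 2 * w $ 2) = 0"
      unfolding q_S_entries l by (simp add: axis_def assms field_simps)
  next
    assume *: "(d - 2 * b) * (w $ 1 + 2 * w $ 2) = 0"
    \<comment> \<open>The coefficient of \<open>u $ 1\<close> fixes the multiple of l. The remainder
      is the obstruction.\<close>
    have "q (S *v w) u = (b * w $ 1 + (d + 2 * b) / 2 * w $ 2) * (l \<bullet> u) +
        (d - 2 * b) * (w $ 1 + 2 * w $ 2) / 2 * u $ 2" for u
      unfolding q_S_entries l by (simp add: assms field_simps)
    with * show "\<exists>k. \<forall>u. q (S *v w) u = k * (l \<bullet> u)" by auto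
  qed
  then show ?thesis
    using distribution_of_symmetry_rank_one[OF _ S A lf, of p] scaleR_A_eq_S
    by (simp add: trace_A_c assms)
qed

end

text \<open>The first two rows of the change of basis are left eigenvectors of the matrix of ad e_2,
  with eigenvalues 1 - s and 1 + s for s = sqrt (1 - c). So \<mu> is the cosine of the angle between
  two eigenvectors.\<close>

lemma gram_change_of_basis:
  assumes c: "0 < c" "c < 1"
  shows "transpose (change_of_basis c) **
      vector [vector [1, \<mu>, 0], vector [\<mu>, 1, 0], vector [0, 0, \<nu>]] ** change_of_basis c =
    gram3 ((2 - c - \<mu> * c) / (2 * (1 - c) * c\<^sup>2)) ((1 - \<mu>) / (2 * (1 - c) * c)) ((1 - \<mu>) / (2 * (1 - c))) \<nu>"
proof -
  define s where "s = sqrt (1 - c)"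
  have s: "0 < s" "s < 1" and cs: "c = 1 - s * s"
    using c by (simp_all add: s_def)
  have "1 - s * s = (1 - s) * (1 + s)" by (simp add: algebra_simps)
  then have c': "c = (1 - s) * (1 + s)" using cs by simp
  \<comment> \<open>The entries after cancelling with c = (1 - s) (1 + s).\<close>
  define x y z where xyz: "x = - (1 / (2 * s * (1 - s)))" "y = 1 / (2 * s * (1 + s))" "z = 1 / (2 * s)"
  have P: "change_of_basis c = vector [vector [x, - z, 0], vector [y, z, 0], vector [0, 0, 1]]"
  proof -
    have "- (1 + s) / (2 * c * s) = x" "(1 - s) / (2 * c * s) = y"
      using s unfolding c' xyz by (simp_all add: divide_simps)
    then show ?thesis by (simp add: change_of_basis_def s_def[symmetric] xyz(3))
  qed
  have e: "x * x + 2 * \<mu> * (x * y) + y * y = (2 - c - \<mu> * c) / (2 * (1 - c) * c\<^sup>2)"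
    "- (x * z) + \<mu> * (x * z) - \<mu> * (y * z) + y * z = (1 - \<mu>) / (2 * (1 - c) * c)"
    "2 * (z * z) - 2 * \<mu> * (z * z) = (1 - \<mu>) / (2 * (1 - c))"
  proof -
    have 1: "1 - c = s * s" by (simp add: cs)
    have nz: "s \<noteq> 0" "1 - s \<noteq> 0" "1 + s \<noteq> 0" using s by auto
    have x': "x = - ((1 + s) / (2 * s * c))" and y': "y = (1 - s) / (2 * s * c)"
      using nz unfolding xyz c' by (simp_all add: divide_simps)
    have "c \<noteq> 0" using c by simp
    show "x * x + 2 * \<mu> * (x * y) + y * y = (2 - c - \<mu> * c) / (2 * (1 - c) * c\<^sup>2)"
    proof -
      have "x * x + 2 * \<mu> * (x * y) + y * y =
          ((1 + s) * (1 + s) - 2 * \<mu> * ((1 - s) * (1 + s)) + (1 - s) * (1 - s)) / (4 * (s * s) * c\<^sup>2)"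
        using nz \<open>c \<noteq> 0\<close> unfolding x' y' by (simp add: field_simps power2_eq_square)
      also have "(1 + s) * (1 + s) - 2 * \<mu> * ((1 - s) * (1 + s)) + (1 - s) * (1 - s) =
          2 * (2 - c - \<mu> * c)"
        unfolding c'[symmetric] by (simp add: cs algebra_simps)
      also have "2 * (2 - c - \<mu> * c) / (4 * (s * s) * c\<^sup>2) = (2 - c - \<mu> * c) / (2 * (s * s) * c\<^sup>2)"
        using nz \<open>c \<noteq> 0\<close> by (simp add: divide_simps)
      finally show ?thesis unfolding 1 .
    qed
    show "- (x * z) + \<mu> * (x * z) - \<mu> * (y * z) + y * z = (1 - \<mu>) / (2 * (1 - c) * c)"
      using nz \<open>c \<noteq> 0\<close> unfolding x' y' xyz(3) 1 by (simp add: field_simps)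
    show "2 * (z * z) - 2 * \<mu> * (z * z) = (1 - \<mu>) / (2 * (1 - c))"
      using nz unfolding xyz(3) 1 by (simp add: field_simps)
  qed
  show ?thesis
    unfolding P gram3_def e[symmetric]
    by (simp add: vec_eq_iff forall_3 matrix_matrix_mult_def transpose_def sum_3 algebra_simps)
qed

section \<open>The seven families of metrics\<close>

lemma A_c_space_index_0:
  assumes "A_c_space a b d \<nu>" "c \<noteq> 0" "\<not> (b = a \<and> d = c * a)"
    and "b * (2 * d - c * b) \<noteq> ((d - c * a + 2 * b) / 2)\<^sup>2" "d + c * a \<noteq> 2 * b"
  shows "index_of_symmetry (sd_metric (A_c c) (gram3 a b d \<nu>)) = 0"
proof -
  interpret A_c_space c a b d \<nu> by (rule assms)
  show ?thesis
    unfolding metric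
    by (rule index_of_symmetry_0) (rule distribution_of_symmetry_trivial[OF assms(2-5)])
qed

lemma A_c_space_basis2:
  assumes "A_c_space a b d \<nu>" "c \<noteq> 0" "\<not> (b = a \<and> d = c * a)"
    and "b * (2 * d - c * b) \<noteq> ((d - c * a + 2 * b) / 2)\<^sup>2" "d + c * a = 2 * b"
  shows "index_of_symmetry (sd_metric (A_c c) (gram3 a b d \<nu>)) = 1 \<and>
    (\<forall>p. distribution_of_symmetry (sd_metric (A_c c) (gram3 a b d \<nu>)) p =
      span {sd_field (A_c c) basis2 p})"
proof -
  interpret A_c_space c a b d \<nu> by (rule assms)
  note D = distribution_of_symmetry_basis2[OF assms(2-5)]
  show ?thesis
    unfolding metric using index_of_symmetry_1[OF D] D by (simp add: basis2_def zero_prod_def)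
qed

lemma A_c_space_line:
  assumes "A_c_space a b d \<nu>" "c \<noteq> 0" "\<not> (b = a \<and> d = c * a)" "d + c * a \<noteq> 2 * b"
    and n: "b * x + (d - c * a + 2 * b) / 2 * y = 0"
      "(d - c * a + 2 * b) / 2 * x + (2 * d - c * b) * y = 0" "x \<noteq> 0 \<or> y \<noteq> 0"
  shows "index_of_symmetry (sd_metric (A_c c) (gram3 a b d \<nu>)) = 1 \<and>
    (\<forall>p. distribution_of_symmetry (sd_metric (A_c c) (gram3 a b d \<nu>)) p =
      span {x *\<^sub>R sd_field (A_c c) basis0 p + y *\<^sub>R sd_field (A_c c) basis1 p})"
proof -
  interpret A_c_space c a b d \<nu> by (rule assms)
  define n :: "real^2" where "n = vector [x, y]"
  have n0: "n \<noteq> 0" using assms(7) by (auto simp: n_def vec_eq_iff forall_2)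
  have D: "distribution_of_symmetry g p = span {sd_field (A_c c) (n, 0) p}" for p
    by (rule distribution_of_symmetry_line[OF assms(2-4) _ _ n0]) (use n in \<open>simp_all add: n_def\<close>)
  moreover have "(n, 0) = x *\<^sub>R basis0 + y *\<^sub>R basis1"
    by (simp add: n_def basis0_def basis1_def vec_eq_iff forall_2 axis_def)
  then have "sd_field (A_c c) (n, 0) p = x *\<^sub>R sd_field (A_c c) basis0 p + y *\<^sub>R sd_field (A_c c) basis1 p" for p
    by (simp only: sd_field_add sd_field_scaleR)
  ultimately show ?thesis
    unfolding metric using index_of_symmetry_1[OF D] n0 by (simp add: zero_prod_def)
qed

lemma A_c_space_UNIV:
  assumes "A_c_space a b d \<nu>" "b = a" "d = c * a"
  shows "index_of_symmetry (sd_metric (A_c c) (gram3 a b d \<nu>)) = 3 \<and>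
    (\<forall>p. distribution_of_symmetry (sd_metric (A_c c) (gram3 a b d \<nu>)) p = UNIV)"
proof -
  interpret A_c_space c a b d \<nu> by (rule assms)
  note D = umbilic_imp_UNIV[OF assms(2,3)]
  show ?thesis unfolding metric using index_of_symmetry_3[OF D] D by simp
qed

text \<open>The line is the kernel of \<open>A_c 0\<close>, so the field is central and Killing. It
  is not parallel, since q(S w, u) = - (d - 2 b) / 4 times l . u, and the additional Killing field
  of the rank one case is needed.\<close>

lemma A_0_line:
  assumes "A_c_space a b d \<nu>" "d \<noteq> 2 * b"
  shows "index_of_symmetry (sd_metric (A_c 0) (gram3 a b d \<nu>)) = 1 \<and>
    (\<forall>p. distribution_of_symmetry (sd_metric (A_c 0) (gram3 a b d \<nu>)) p =
      span {sd_field (A_c 0) basis0 p - (1/2) *\<^sub>R sd_field (A_c 0) basis1 p})"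
proof -
  interpret A_c_space 0 a b d \<nu> by (rule assms)
  define n :: "real^2" where "n = vector [1, - 1 / 2]"
  have n0: "n \<noteq> 0" by (auto simp: n_def vec_eq_iff forall_2)
  have w: "w $ 1 + 2 * w $ 2 = 0 \<longleftrightarrow> (\<exists>k. w = k *\<^sub>R n)" for w
  proof
    assume "w $ 1 + 2 * w $ 2 = 0"
    then have "w = (w $ 1) *\<^sub>R n" by (simp add: n_def vec_eq_iff forall_2)
    then show "\<exists>k. w = k *\<^sub>R n" ..
  qed (auto simp: n_def)
  have "distribution_of_symmetry g p = range (\<lambda>k. sd_field (A_c 0) (k *\<^sub>R n, 0) p)" for p
  proof -
    have "distribution_of_symmetry g p = {sd_field (A_c 0) (w, r) p | w r. w $ 1 + 2 * w $ 2 = 0 \<and> r = 0}"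
      unfolding distribution_of_symmetry_c_0[OF refl] using assms(2) by simp
    then show ?thesis unfolding w by blast
  qed
  then have D: "distribution_of_symmetry g p = span {sd_field (A_c 0) (n, 0) p}" for p
    by (simp add: sd_field_scaleR[symmetric] span_singleton)
  moreover have "(n, 0) = basis0 + (- (1 / 2)) *\<^sub>R basis1"
    by (simp add: n_def basis0_def basis1_def vec_eq_iff forall_2 axis_def)
  then have "sd_field (A_c 0) (n, 0) p =
      sd_field (A_c 0) basis0 p + (- (1 / 2)) *\<^sub>R sd_field (A_c 0) basis1 p" for p
    by (simp only: sd_field_add sd_field_scaleR)
  ultimately show ?thesis
    unfolding metric using index_of_symmetry_1[OF D] n0 by (simp add: zero_prod_def)
qed

text \<open>For d = 2 b the matrix is self-adjoint with eigenvalues 0 and 2. The space is then the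
  product of a line and a hyperbolic plane.\<close>

lemma A_0_UNIV:
  assumes "A_c_space a b d \<nu>" "d = 2 * b"
  shows "index_of_symmetry (sd_metric (A_c 0) (gram3 a b d \<nu>)) = 3 \<and>
    (\<forall>p. distribution_of_symmetry (sd_metric (A_c 0) (gram3 a b d \<nu>)) p = UNIV)"
proof -
  interpret A_c_space 0 a b d \<nu> by (rule assms)
  have D: "distribution_of_symmetry g p = UNIV" for p
  proof -
    have "sd_field (A_c 0) (w, r) p \<in> distribution_of_symmetry g p" for w r
      unfolding distribution_of_symmetry_c_0[OF refl] using assms(2) by auto
    from this[of "pull p (fst v)" "snd v" for v] show ?thesis
      unfolding sd_field_pull by blast
  qed
  show ?thesis unfolding metric using index_of_symmetry_3[OF D] D by simp
qed

lemma A_I_UNIV: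
  assumes "0 < \<nu>"
  shows "index_of_symmetry (sd_metric A_I (gram3 1 0 1 \<nu>)) = 3 \<and>
    (\<forall>p. distribution_of_symmetry (sd_metric A_I (gram3 1 0 1 \<nu>)) p = UNIV)"
proof -
  have sd: "sd_space (gram2 1 0 1) \<nu>" by (rule sd_space_gram2) (use assms in simp_all)
  interpret sd_space A_I "gram2 1 0 1" \<nu> by (rule sd)
  have "S *v u = u" for u
  proof (rule q_eqI)
    show "q (S *v u) w = q u w" for w using q_S[of u w] by (simp add: A_I_def)
  qed
  from umbilic_distribution_of_symmetry[OF this]
  have D: "distribution_of_symmetry g p = UNIV" for p .
  show ?thesis unfolding sd_metric_gram3[OF sd] using index_of_symmetry_3[OF D] D by simp
qed

text \<open>Up to positive factors, the determinant of q(S ., .) is c - m^2 and the skew part of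
  \<open>A\<close> is m. These vanish at m = sqrt c and at m = 0, which are the exceptional
  metrics.\<close>

lemma A_c_space_change_of_basis:
  assumes c: "0 < c" "c < 1" and m: "0 \<le> m" "m < 1" and \<nu>: "0 < \<nu>"
    and g: "g = sd_metric (A_c c) (transpose (change_of_basis c) **
      vector [vector [1, m, 0], vector [m, 1, 0], vector [0, 0, \<nu>]] ** change_of_basis c)"
  shows "m = 0 \<Longrightarrow> index_of_symmetry g = 1 \<and>
      (\<forall>p. distribution_of_symmetry g p = span {sd_field (A_c c) basis2 p})"
    and "0 < m \<Longrightarrow> m \<noteq> sqrt c \<Longrightarrow> index_of_symmetry g = 0"
    and "m = sqrt c \<Longrightarrow> index_of_symmetry g = 1 \<and>
      (\<forall>p. distribution_of_symmetry g p =
         span {sd_field (A_c c) basis0 p + (1 / sqrt c) *\<^sub>R sd_field (A_c c) basis1 p})"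
proof -
  define k where "k = 1 / (2 * (1 - c))"
  have k: "0 < k" and kc: "k * (1 - c) = 1 / 2" using c by (simp_all add: k_def)
  define a b d where abd: "a = (2 - c - m * c) / (2 * (1 - c) * c\<^sup>2)"
    "b = (1 - m) / (2 * (1 - c) * c)" "d = (1 - m) / (2 * (1 - c))"
  have a: "a = k * (2 - c - m * c) / c\<^sup>2" and b: "b = k * (1 - m) / c" and d: "d = k * (1 - m)"
    by (simp_all add: abd k_def)
  have ca: "c * a = k * (2 - c - m * c) / c"
    using c by (simp add: a power2_eq_square)
  have "m * c < c" using c m by simp
  then have mc: "m * c < 2 - c" using c by linarith
  have pos: "0 < a" unfolding a using k c mc by (intro divide_pos_pos mult_pos_pos) auto
  have ab: "a * d - b\<^sup>2 = k\<^sup>2 * ((1 - m) * (1 + m) * (1 - c)) / c\<^sup>2"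
    using c by (simp add: a b d field_simps power2_eq_square)
  have "0 < k\<^sup>2 * ((1 - m) * (1 + m) * (1 - c)) / c\<^sup>2"
    using k c m by (intro divide_pos_pos mult_pos_pos) auto
  with ab have sp: "A_c_space a b d \<nu>"
    by (unfold_locales) (use pos \<nu> in linarith)+
  have beta: "(d - c * a + 2 * b) / 2 = k * (c - m) / c"
    unfolding ca using c by (simp add: b d field_simps)
  have gamma: "2 * d - c * b = k * (1 - m)"
    using c by (simp add: b d)
  have skew: "d + c * a - 2 * b = k * (2 * m * (1 - c)) / c"
    unfolding ca using c by (simp add: b d field_simps)
  \<comment> \<open>The umbilic case would give the plane block the determinant (c - 1) a^2,
    negative for c < 1.\<close>
  have nonumb: "\<not> (b = a \<and> d = c * a)"
  proof
    assume *: "b = a \<and> d = c * a"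
    then have "a * d - b\<^sup>2 = (c - 1) * a\<^sup>2" by (simp add: power2_eq_square algebra_simps)
    moreover have "(c - 1) * a\<^sup>2 < 0" using c pos by (intro mult_neg_pos) auto
    ultimately show False using sp by (simp add: A_c_space_def)
  qed
  have det: "b * (2 * d - c * b) - ((d - c * a + 2 * b) / 2)\<^sup>2 = k\<^sup>2 * ((1 - c) * (c - m\<^sup>2)) / c\<^sup>2"
    unfolding beta gamma using c by (simp add: b field_simps power2_eq_square)
  have c0: "c \<noteq> 0" using c by simp
  have det0: "b * (2 * d - c * b) \<noteq> ((d - c * a + 2 * b) / 2)\<^sup>2" if "m \<noteq> sqrt c"
  proof -
    have "m\<^sup>2 \<noteq> c" using that m by (metis real_sqrt_unique)
    then have "k\<^sup>2 * ((1 - c) * (c - m\<^sup>2)) / c\<^sup>2 \<noteq> 0" using k c by simp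
    with det show ?thesis by linarith
  qed
  have g': "g = sd_metric (A_c c) (gram3 a b d \<nu>)"
    unfolding g gram_change_of_basis[OF c] abd ..
  show "index_of_symmetry g = 1 \<and> (\<forall>p. distribution_of_symmetry g p = span {sd_field (A_c c) basis2 p})"
    if "m = 0"
    unfolding g'
  proof (rule A_c_space_basis2[OF sp c0 nonumb det0])
    show "m \<noteq> sqrt c" using that c by simp
    show "d + c * a = 2 * b" using skew that by simp
  qed
  have sk0: "d + c * a \<noteq> 2 * b" if "0 < m"
  proof -
    have "0 < k * (2 * m * (1 - c)) / c" using that k c by simp
    with skew show ?thesis by linarith
  qed
  show "index_of_symmetry g = 0" if "0 < m" "m \<noteq> sqrt c"
    unfolding g' by (rule A_c_space_index_0[OF sp c0 nonumb det0[OF that(2)] sk0[OF that(1)]])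
  show "index_of_symmetry g = 1 \<and> (\<forall>p. distribution_of_symmetry g p =
         span {sd_field (A_c c) basis0 p + (1 / sqrt c) *\<^sub>R sd_field (A_c c) basis1 p})"
    if ms: "m = sqrt c"
  proof -
    have m0: "0 < m" and cm: "c = m * m" using ms c by simp_all
    have "k * (1 - m) / c + k * (c - m) / c * (1 / m) = 0"
      unfolding cm using m0 by (simp add: field_simps)
    then have "b * 1 + (d - c * a + 2 * b) / 2 * (1 / sqrt c) = 0"
      unfolding beta ms[symmetric] by (simp add: b)
    moreover have "(d - c * a + 2 * b) / 2 * 1 + (2 * d - c * b) * (1 / sqrt c) = 0"
      unfolding beta gamma ms[symmetric] unfolding cm using m0 by (simp add: field_simps)
    ultimately show ?thesis
      unfolding g' using A_c_space_line[OF sp c0 nonumb sk0[OF m0], of 1 "1 / sqrt c"] by simp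
  qed
qed

theorem mainTheorem9:
  fixes \<nu> :: real
  assumes "\<nu> > 0"
  shows
    "(let g = sd_metric A_I (vector [vector [1, 0, 0], vector [0, 1, 0], vector [0, 0, \<nu>]])
      in index_of_symmetry g = 3 \<and> (\<forall>p. distribution_of_symmetry g p = UNIV)) \<and>
     (\<forall>c \<mu>. c < 0 \<longrightarrow> 0 < \<mu> \<longrightarrow> \<mu> \<le> \<bar>c\<bar> \<longrightarrow>
       (let g = sd_metric (A_c c) (vector [vector [1, 0, 0], vector [0, \<mu>, 0], vector [0, 0, \<nu>]])
        in (\<mu> < \<bar>c\<bar> \<longrightarrow> index_of_symmetry g = 0) \<and>
           (\<mu> = \<bar>c\<bar> \<longrightarrow> index_of_symmetry g = 1 \<and>
              (\<forall>p. distribution_of_symmetry g p = span {sd_field (A_c c) basis2 p})))) \<and>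
     (\<forall>\<mu>. 0 < \<mu> \<longrightarrow>
       (let g = sd_metric (A_c 0) (vector [vector [1, 0, 0], vector [0, \<mu>, 0], vector [0, 0, \<nu>]])
        in index_of_symmetry g = 1 \<and>
           (\<forall>p. distribution_of_symmetry g p =
              span {sd_field (A_c 0) basis0 p - (1/2) *\<^sub>R sd_field (A_c 0) basis1 p}))) \<and>
     (let g = sd_metric (A_c 0) (vector [vector [1, 1/2, 0], vector [1/2, 1, 0], vector [0, 0, \<nu>]])
      in index_of_symmetry g = 3 \<and> (\<forall>p. distribution_of_symmetry g p = UNIV)) \<and>
     (\<forall>c \<mu>. 0 < c \<longrightarrow> c < 1 \<longrightarrow> 0 \<le> \<mu> \<longrightarrow> \<mu> < 1 \<longrightarrow>
       (let P = change_of_basis c;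
            g = sd_metric (A_c c) (transpose P **
                  vector [vector [1, \<mu>, 0], vector [\<mu>, 1, 0], vector [0, 0, \<nu>]] ** P)
        in (\<mu> = 0 \<longrightarrow> index_of_symmetry g = 1 \<and>
              (\<forall>p. distribution_of_symmetry g p = span {sd_field (A_c c) basis2 p})) \<and>
           (0 < \<mu> \<and> \<mu> \<noteq> sqrt c \<longrightarrow> index_of_symmetry g = 0) \<and>
           (\<mu> = sqrt c \<longrightarrow> index_of_symmetry g = 1 \<and>
              (\<forall>p. distribution_of_symmetry g p =
                 span {sd_field (A_c c) basis0 p + (1 / sqrt c) *\<^sub>R sd_field (A_c c) basis1 p})))) \<and>
     (\<forall>\<mu>. 0 < \<mu> \<longrightarrow> \<mu> \<le> 1 \<longrightarrow>
       (let g = sd_metric (A_c 1) (vector [vector [1, 0, 0], vector [0, \<mu>, 0], vector [0, 0, \<nu>]])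
        in (\<mu> < 1 \<longrightarrow> index_of_symmetry g = 0) \<and>
           (\<mu> = 1 \<longrightarrow> index_of_symmetry g = 1 \<and>
              (\<forall>p. distribution_of_symmetry g p = span {sd_field (A_c 1) basis0 p})))) \<and>
     (\<forall>l. 0 < l \<longrightarrow> l < 1 \<longrightarrow>
       index_of_symmetry
         (sd_metric (A_c 1) (vector [vector [1, l, 0], vector [l, 1, 0], vector [0, 0, \<nu>]])) = 0) \<and>
     (\<forall>c \<mu>. 1 < c \<longrightarrow> 1 < \<mu> \<longrightarrow> \<mu> \<le> c \<longrightarrow>
       (let g = sd_metric (A_c c) (vector [vector [1, 1, 0], vector [1, \<mu>, 0], vector [0, 0, \<nu>]])
        in (\<mu> < c \<and> \<mu> \<noteq> (sqrt c - 1)\<^sup>2 + 1 \<longrightarrow> index_of_symmetry g = 0) \<and>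
           (\<mu> < c \<and> \<mu> = (sqrt c - 1)\<^sup>2 + 1 \<longrightarrow> index_of_symmetry g = 1 \<and>
              (\<forall>p. distribution_of_symmetry g p =
                 span {((c - 3 * sqrt c + 2) / (sqrt c - 1)) *\<^sub>R sd_field (A_c c) basis0 p
                       + sd_field (A_c c) basis1 p})) \<and>
           (\<mu> = c \<longrightarrow> index_of_symmetry g = 3 \<and>
              (\<forall>p. distribution_of_symmetry g p = UNIV))))"
proof -
  note nu = assms
  have sp: "A_c_space a b d \<nu>" if "0 < a" "b\<^sup>2 < a * d" for a b d
    by unfold_locales (use that nu in auto)
  have c2: "(\<mu> < \<bar>c\<bar> \<longrightarrow> index_of_symmetry (sd_metric (A_c c) (gram3 1 0 \<mu> \<nu>)) = 0) \<and>
      (\<mu> = \<bar>c\<bar> \<longrightarrow> index_of_symmetry (sd_metric (A_c c) (gram3 1 0 \<mu> \<nu>)) = 1 \<and>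
        (\<forall>p. distribution_of_symmetry (sd_metric (A_c c) (gram3 1 0 \<mu> \<nu>)) p =
          span {sd_field (A_c c) basis2 p}))"
    if "c < 0" "0 < \<mu>" for c \<mu>
  proof -
    have s: "A_c_space 1 0 \<mu> \<nu>" using that by (intro sp) auto
    \<comment> \<open>Since b = 0, the determinant of the form is minus this square, and \<mu> - c >
      0. The skew part \<mu> + c vanishes exactly for \<mu> = -c.\<close>
    have "0 < ((\<mu> - c * 1 + 2 * 0) / 2)\<^sup>2" using that by simp
    then have "0 * (2 * \<mu> - c * 0) \<noteq> ((\<mu> - c * 1 + 2 * 0) / 2)\<^sup>2" by simp
    then show ?thesis
      using A_c_space_index_0[OF s, of c] A_c_space_basis2[OF s, of c] that by auto
  qed
  have c3: "index_of_symmetry (sd_metric (A_c 0) (gram3 1 0 \<mu> \<nu>)) = 1 \<and>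
    (\<forall>p. distribution_of_symmetry (sd_metric (A_c 0) (gram3 1 0 \<mu> \<nu>)) p =
      span {sd_field (A_c 0) basis0 p - (1/2) *\<^sub>R sd_field (A_c 0) basis1 p})" if "0 < \<mu>" for \<mu>
    using that by (intro A_0_line sp) auto
  have c3': "index_of_symmetry (sd_metric (A_c 0) (gram3 1 (1/2) 1 \<nu>)) = 3 \<and>
    (\<forall>p. distribution_of_symmetry (sd_metric (A_c 0) (gram3 1 (1/2) 1 \<nu>)) p = UNIV)"
    by (intro A_0_UNIV sp) (auto simp: power2_eq_square)
  have c5: "(\<mu> < 1 \<longrightarrow> index_of_symmetry (sd_metric (A_c 1) (gram3 1 0 \<mu> \<nu>)) = 0) \<and>
      (\<mu> = 1 \<longrightarrow> index_of_symmetry (sd_metric (A_c 1) (gram3 1 0 \<mu> \<nu>)) = 1 \<and>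
        (\<forall>p. distribution_of_symmetry (sd_metric (A_c 1) (gram3 1 0 \<mu> \<nu>)) p =
          span {sd_field (A_c 1) basis0 p}))"
    if "0 < \<mu>" for \<mu>
  proof -
    have s: "A_c_space 1 0 \<mu> \<nu>" using that by (intro sp) auto
    \<comment> \<open>Here the determinant is - ((\<mu> - 1) / 2)^2. For \<mu> = 1 only the last
      diagonal entry of the form survives, so e_0 spans its kernel.\<close>
    show ?thesis
      using A_c_space_index_0[OF s, of 1] A_c_space_line[OF s, of 1 1 0] that by auto
  qed
  have c5': "index_of_symmetry (sd_metric (A_c 1) (gram3 1 l 1 \<nu>)) = 0" if l: "0 < l" "l < 1" for l
  proof (rule A_c_space_index_0)
    show "A_c_space 1 l 1 \<nu>" using l by (intro sp) (auto simp: power_less_one_iff)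
    have "l * (2 * 1 - 1 * l) - ((1 - 1 * 1 + 2 * l) / 2)\<^sup>2 = 2 * l * (1 - l)"
      by (simp add: power2_eq_square algebra_simps)
    moreover have "0 < 2 * l * (1 - l)" using l by simp
    ultimately show "l * (2 * 1 - 1 * l) \<noteq> ((1 - 1 * 1 + 2 * l) / 2)\<^sup>2" by linarith
  qed (use l in auto)
  have c6: "(\<mu> < c \<and> \<mu> \<noteq> (sqrt c - 1)\<^sup>2 + 1 \<longrightarrow>
        index_of_symmetry (sd_metric (A_c c) (gram3 1 1 \<mu> \<nu>)) = 0) \<and>
      (\<mu> < c \<and> \<mu> = (sqrt c - 1)\<^sup>2 + 1 \<longrightarrow>
        index_of_symmetry (sd_metric (A_c c) (gram3 1 1 \<mu> \<nu>)) = 1 \<and>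
        (\<forall>p. distribution_of_symmetry (sd_metric (A_c c) (gram3 1 1 \<mu> \<nu>)) p =
           span {((c - 3 * sqrt c + 2) / (sqrt c - 1)) *\<^sub>R sd_field (A_c c) basis0 p
                 + sd_field (A_c c) basis1 p})) \<and>
      (\<mu> = c \<longrightarrow> index_of_symmetry (sd_metric (A_c c) (gram3 1 1 \<mu> \<nu>)) = 3 \<and>
        (\<forall>p. distribution_of_symmetry (sd_metric (A_c c) (gram3 1 1 \<mu> \<nu>)) p = UNIV))"
    if c: "1 < c" and \<mu>: "1 < \<mu>" "\<mu> \<le> c" for c \<mu>
  proof (intro conjI impI allI)
    have s: "A_c_space 1 1 \<mu> \<nu>" using \<mu> by (intro sp) auto
    define x where "x = sqrt c"
    have x: "1 < x" and cx: "c = x * x" using c by (simp_all add: x_def)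
    \<comment> \<open>As a quadratic in \<mu> this has the roots (x - 1)^2 + 1 and (x + 1)^2 + 1.
      The larger one exceeds c and is out of range.\<close>
    have det: "((\<mu> - c * 1 + 2 * 1) / 2)\<^sup>2 - 1 * (2 * \<mu> - c * 1) =
        (\<mu> - ((x - 1)\<^sup>2 + 1)) * (\<mu> - ((x + 1)\<^sup>2 + 1)) / 4"
      by (simp add: cx power2_eq_square field_simps)
    have "\<mu> - ((x + 1)\<^sup>2 + 1) < 0"
      using \<mu> x by (simp add: cx power2_eq_square algebra_simps)
    then have det0: "1 * (2 * \<mu> - c * 1) \<noteq> ((\<mu> - c * 1 + 2 * 1) / 2)\<^sup>2" if "\<mu> \<noteq> (sqrt c - 1)\<^sup>2 + 1"
    proof -
      have "\<mu> - ((x - 1)\<^sup>2 + 1) \<noteq> 0" using that by (simp add: x_def)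
      moreover have "\<mu> - ((x + 1)\<^sup>2 + 1) \<noteq> 0" using \<open>\<mu> - ((x + 1)\<^sup>2 + 1) < 0\<close> by linarith
      ultimately have "(\<mu> - ((x - 1)\<^sup>2 + 1)) * (\<mu> - ((x + 1)\<^sup>2 + 1)) / 4 \<noteq> 0"
        by (simp only: mult_eq_0_iff divide_eq_0_iff) simp
      with det show ?thesis by linarith
    qed
    {
      assume "\<mu> < c \<and> \<mu> \<noteq> (sqrt c - 1)\<^sup>2 + 1"
      then show "index_of_symmetry (sd_metric (A_c c) (gram3 1 1 \<mu> \<nu>)) = 0"
        using c \<mu> det0 by (intro A_c_space_index_0 s) auto
    next
      assume *: "\<mu> < c \<and> \<mu> = (sqrt c - 1)\<^sup>2 + 1"
      \<comment> \<open>c - 3 x + 2 = (x - 1) (x - 2) with x = sqrt c.\<close>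
      have y: "(c - 3 * sqrt c + 2) / (sqrt c - 1) = x - 2"
        using x unfolding x_def[symmetric] by (simp add: cx field_simps)
      have \<mu>x: "\<mu> = (x - 1) * (x - 1) + 1" using * by (simp add: x_def power2_eq_square)
      \<comment> \<open>At this \<mu> the entries of the form are 1, 2 - x and (x - 2)^2. It is the
        square of a linear form, with null vector (x - 2, 1).\<close>
      have e: "1 * (x - 2) + (\<mu> - c * 1 + 2 * 1) / 2 * 1 = 0"
        "(\<mu> - c * 1 + 2 * 1) / 2 * (x - 2) + (2 * \<mu> - c * 1) * 1 = 0"
        by (simp_all add: \<mu>x cx field_simps)
      have "\<mu> + c * 1 \<noteq> 2 * 1" "\<not> (1 = 1 \<and> \<mu> = c * 1)" "c \<noteq> 0"
        using c \<mu>(1) * by linarith+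
      then have "index_of_symmetry (sd_metric (A_c c) (gram3 1 1 \<mu> \<nu>)) = 1 \<and>
        (\<forall>p. distribution_of_symmetry (sd_metric (A_c c) (gram3 1 1 \<mu> \<nu>)) p =
           span {(x - 2) *\<^sub>R sd_field (A_c c) basis0 p + 1 *\<^sub>R sd_field (A_c c) basis1 p})"
        by (intro A_c_space_line s e) simp_all
      then show "index_of_symmetry (sd_metric (A_c c) (gram3 1 1 \<mu> \<nu>)) = 1"
        "distribution_of_symmetry (sd_metric (A_c c) (gram3 1 1 \<mu> \<nu>)) p =
           span {((c - 3 * sqrt c + 2) / (sqrt c - 1)) *\<^sub>R sd_field (A_c c) basis0 p
                 + sd_field (A_c c) basis1 p}" for p
        unfolding y scaleR_one by blast+
    next
      assume "\<mu> = c"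
      then have "\<mu> = c * 1" by simp
      from A_c_space_UNIV[OF s refl this] show "index_of_symmetry (sd_metric (A_c c) (gram3 1 1 \<mu> \<nu>)) = 3"
        "distribution_of_symmetry (sd_metric (A_c c) (gram3 1 1 \<mu> \<nu>)) p = UNIV" for p
        by blast+
    }
  qed
  show ?thesis
    unfolding Let_def gram3_def[symmetric]
  proof (rule conjI[OF _ conjI[OF _ conjI[OF _ conjI[OF _ conjI[OF _ conjI[OF _ conjI]]]]]], goal_cases)
    case 1
    show ?case by (rule A_I_UNIV[OF nu])
  next
    case 2
    show ?case by (intro allI impI c2)
  next
    case 3
    show ?case by (intro allI impI c3)
  next
    case 4
    show ?case by (rule c3')
  next
    case 5
    show ?case
    proof (intro allI impI, goal_cases)
      case (1 c \<mu>)
      note c4 = A_c_space_change_of_basis[OF 1 nu refl, folded gram3_def]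
      show ?case using c4(1) c4(2) c4(3) by blast
    qed
  next
    case 6
    show ?case by (intro allI impI c5)
  next
    case 7
    show ?case by (intro allI impI c5')
  next
    case 8
    show ?case by (intro allI impI c6)
  qed
qed

end
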